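(* In the Nakagami model with parameters $L_c>0$, $L_s>0$, let $\Delta^*(L_s,L_c)=\lim_{\rho\to\infty}-\frac{\log ED^*(\rho)}{\log\rho}$ be the optimal distortion exponent. If $L_c\ge1$, then $$\Delta^*(L_s,L_c)=1+\Big(1-\frac1{L_s}\Big)^+ .$$ If $L_c<1$ and $L_s\le1+L_c$, then $$\Delta^*(L_s,L_c)=\min\{1,L_s+L_c\}+\Big(1-\frac1{L_s}\Big)^+ .$$ (In both cases the limit exists.)
   Context: System model: $S_1,\dots,S_n$ are i.i.d. $\mathcal N(0,1)$. $H_c,\Gamma_c$ are real random variables (channel and side-information fading states), mutually independent and independent of the source and the noises, constant over the whole block. Write $H=H_c^2$, $\Gamma=\Gamma_c^2$. An encoder is any map $f^n:\mathbb R^n\to\mathbb R^n$, $X^n=f^n(S^n)$, with $\frac1n\sum_{i=1}^n\mathrm E[X_i^2]\le1$, not observing $H_c,\Gamma_c$. The decoder observes $Y^n=H_cX^n+N^n$, $T^n=\Gamma_cS^n+Z^n$, and $H_c,\Gamma_c$, with $N^n,Z^n$ i.i.d. $\mathcal N(0,1)$ independent of everything else; $\hat S^n=g^n(Y^n,T^n,H_c,\Gamma_c)$. $D=\frac1n\sum_i(S_i-\hat S_i)^2$, $ED^*=\lim_{n\to\infty}\inf_{f^n,g^n}\mathrm E[D]$. Nakagami model: for SNR $\rho>0$, $H=\rho H_0$ and $\Gamma=\rho\Gamma_0$, where $H_0,\Gamma_0$ are independent, $H_0$ is Gamma distributed with shape $L_c$ and scale $1/L_c$, and $\Gamma_0$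 is Gamma distributed with shape $L_s$ and scale $1/L_s$ (Gamma$(L,\theta)$ density $\frac{1}{\theta^L\Gamma(L)}x^{L-1}e^{-x/\theta}$, $x\ge0$). $ED^*(\rho)$ denotes $ED^*$ for this model at SNR $\rho$. $(x)^+=\max\{0,x\}$. *)

theory Defs
  imports "HOL-Probability.Probability"
begin

definition gamma_density :: "real \<Rightarrow> real \<Rightarrow> real \<Rightarrow> real" where
  "gamma_density L \<theta> x =
     (if 0 \<le> x then x powr (L - 1) * exp (- x / \<theta>) / (\<theta> powr L * Gamma L) else 0)"

definition gamma_measure :: "real \<Rightarrow> real \<Rightarrow> real measure" where
  "gamma_measure L \<theta> = density lborel (\<lambda>x. ennreal (gamma_density L \<theta> x))"

definition vec_space :: "nat \<Rightarrow> (nat \<Rightarrow> real) measure" where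
  "vec_space n = (\<Pi>\<^sub>M i\<in>{..<n}. (borel :: real measure))"

definition std_normal_vec :: "nat \<Rightarrow> (nat \<Rightarrow> real) measure" where
  "std_normal_vec n = (\<Pi>\<^sub>M i\<in>{..<n}. density lborel std_normal_density)"

text \<open>Underlying probability space of a block: (S^n, N^n, Z^n, H0c, G0c),
  all independent; the fading amplitudes at SNR rho are sqrt rho * H0c, sqrt rho * G0c.\<close>
definition block_space ::
  "nat \<Rightarrow> real measure \<Rightarrow> real measure \<Rightarrow>
     ((nat \<Rightarrow> real) \<times> (nat \<Rightarrow> real) \<times> (nat \<Rightarrow> real) \<times> real \<times> real) measure" where
  "block_space n \<mu>h \<mu>g =
     std_normal_vec n \<Otimes>\<^sub>M (std_normal_vec n \<Otimes>\<^sub>M (std_normal_vec n \<Otimes>\<^sub>M (\<mu>h \<Otimes>\<^sub>M \<mu>g)))"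

text \<open>Measurable space of decoder inputs (Y^n, T^n, H_c, Gamma_c).\<close>
definition dec_input_space ::
  "nat \<Rightarrow> ((nat \<Rightarrow> real) \<times> (nat \<Rightarrow> real) \<times> real \<times> real) measure" where
  "dec_input_space n = vec_space n \<Otimes>\<^sub>M (vec_space n \<Otimes>\<^sub>M (borel \<Otimes>\<^sub>M borel))"

definition admissible_encoder :: "nat \<Rightarrow> ((nat \<Rightarrow> real) \<Rightarrow> (nat \<Rightarrow> real)) \<Rightarrow> bool" where
  "admissible_encoder n f \<longleftrightarrow>
     f \<in> vec_space n \<rightarrow>\<^sub>M vec_space n \<and>
     (\<integral>\<^sup>+ s. ennreal (\<Sum>i<n. (f s i)\<^sup>2) \<partial>std_normal_vec n) \<le> ennreal (real n)"

definition admissible_decoder ::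
  "nat \<Rightarrow> ((nat \<Rightarrow> real) \<times> (nat \<Rightarrow> real) \<times> real \<times> real \<Rightarrow> (nat \<Rightarrow> real)) \<Rightarrow> bool" where
  "admissible_decoder n g \<longleftrightarrow> g \<in> dec_input_space n \<rightarrow>\<^sub>M vec_space n"

definition expected_distortion ::
  "nat \<Rightarrow> real \<Rightarrow> real measure \<Rightarrow> real measure \<Rightarrow>
   ((nat \<Rightarrow> real) \<Rightarrow> (nat \<Rightarrow> real)) \<Rightarrow>
   ((nat \<Rightarrow> real) \<times> (nat \<Rightarrow> real) \<times> real \<times> real \<Rightarrow> (nat \<Rightarrow> real)) \<Rightarrow> ennreal" where
  "expected_distortion n \<rho> \<mu>h \<mu>g f g =
     (\<integral>\<^sup>+ \<omega>. (case \<omega> of (s, nz, zz, h0, g0) \<Rightarrow>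
        let hc = sqrt \<rho> * h0; gc = sqrt \<rho> * g0;
            y = restrict (\<lambda>i. hc * f s i + nz i) {..<n};
            t = restrict (\<lambda>i. gc * s i + zz i) {..<n};
            shat = g (y, t, hc, gc)
        in ennreal ((1 / real n) * (\<Sum>i<n. (s i - shat i)\<^sup>2)))
      \<partial>block_space n \<mu>h \<mu>g)"

definition opt_distortion :: "nat \<Rightarrow> real \<Rightarrow> real measure \<Rightarrow> real measure \<Rightarrow> ennreal" where
  "opt_distortion n \<rho> \<mu>h \<mu>g =
     (INF fg \<in> {(f, g). admissible_encoder n f \<and> admissible_decoder n g}.
        expected_distortion n \<rho> \<mu>h \<mu>g (fst fg) (snd fg))"

definition EDstar :: "real measure \<Rightarrow> real measure \<Rightarrow> real \<Rightarrow> real" where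
  "EDstar \<mu>h \<mu>g \<rho> = lim (\<lambda>n. enn2real (opt_distortion n \<rho> \<mu>h \<mu>g))"

definition nakagami_amplitude_law :: "real \<Rightarrow> real measure \<Rightarrow> bool" where
  "nakagami_amplitude_law L \<mu> \<longleftrightarrow>
     prob_space \<mu> \<and> sets \<mu> = sets borel \<and>
     distr \<mu> borel (\<lambda>x. x\<^sup>2) = gamma_measure L (1 / L)"

end

theory Submission
  imports Defs
begin

text \<open>
  Concatenating block codes makes the total distortion subadditive in the block length, so by
  Fekete's lemma the limit exists and equals the infimum over all block lengths. Lower bounds
  therefore have to hold for every block length, while scalar codes suffice for upper bounds.

  Converse: fix the channel amplitude \<open>h\<close> and side information amplitudes
  \<open>0 = g\<^sub>0 < \<dots> < g\<^sub>K\<close>, and let \<open>D\<^sub>j\<close> bound the distortion per letter at \<open>g\<^sub>j\<close>. Comparing the joint law of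
  the source, the channel output and successively refined side information with the Gaussian law
  predicted by the decoder's own estimates gives
  \<open>1 \<le> (1 + h\<^sup>2) D\<^sub>K \<Prod>\<^sub>j (1 + (g\<^sub>j\<^sub>+\<^sub>1\<^sup>2 - g\<^sub>j\<^sup>2) D\<^sub>j)\<close>.
  An expected distortion \<open>\<rho>\<close> to the power \<open>-d\<close> forces small \<open>D\<^sub>j\<close> at typical
  fading states of size \<open>\<rho>\<close> to the power \<open>1 - \<beta>\<close>; on a fine grid of such exponents \<open>\<beta>\<close> the
  inequality fails if \<open>d\<close> exceeds the claimed exponent.

  Achievability: for \<open>Ls \<le> 1\<close> uncoded transmission is optimal. For \<open>Ls > 1\<close> and \<open>Lc \<ge> 1\<close> send
  \<open>frac (\<xi> S)\<close> and resolve the integer part with the side information. For \<open>1 < Ls \<le> 1 + Lc\<close>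
  quantize \<open>S\<close> with step \<open>\<Delta>\<close> and send \<open>frac (sqrt 2 * i)\<close> for the index \<open>i\<close>: since
  \<open>sqrt 2\<close> is badly approximable, any \<open>M\<close> consecutive indices are mapped to points at distance at
  least of order \<open>1 / M\<close>, so channel and side information jointly identify \<open>i\<close>.
\<close>

section \<open>Gaussian vectors\<close>

text \<open>Treating every pair of fading states separately, as if the encoder knew them, would only
  give the exponent min(1, Lc) + min(1, Ls). The encoder does not see the side information gain, so
  one code must serve all levels at once; the product inequality expresses this. Where
  \<open>2 - min 1 (1 / Ls)\<close> comes from: a gain of order \<rho> to the power 1 - b has
  probability of order \<rho> to the power -Ls b, so the distortion there is at most of order \<rho>
  to the power Ls b - d, and the factor of the next level has exponent about 1 - d + (Ls - 1) b. For
  d slightly above 2 - \<beta> with \<beta> = min 1 (1 / Ls) this is nonpositive for all b \<le>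
  \<beta>. Only the channel, the jump from no side information to b = \<beta>, and the final
  distortion remain, with exponents 1, 1 - \<beta> and -d. The converse uses neither entropies nor
  densities of code outputs: Jensen's inequality for exponentials of quadratic costs replaces them.
  The codes are analysed without error probabilities: each squared error is bounded pointwise by a
  polynomial in source and noises times negative powers of the gains, whose moments exist below Lc
  and Ls.\<close>

abbreviation std_normal :: "real measure" where
  "std_normal \<equiv> density lborel std_normal_density"

definition sqnorm :: "nat \<Rightarrow> (nat \<Rightarrow> real) \<Rightarrow> real" where
  "sqnorm n x = (\<Sum>i<n. (x i)\<^sup>2)"

definition lincomb :: "nat \<Rightarrow> real \<Rightarrow> (nat \<Rightarrow> real) \<Rightarrow> real \<Rightarrow> (nat \<Rightarrow> real) \<Rightarrow> nat \<Rightarrow> real" where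
  "lincomb n a x b y = restrict (\<lambda>i. a * x i + b * y i) {..<n}"

lemma sqnorm_nonneg [simp]: "0 \<le> sqnorm n x"
  by (simp add: sqnorm_def sum_nonneg)

lemma lincomb_apply [simp]: "i < n \<Longrightarrow> lincomb n a x b y i = a * x i + b * y i"
  by (simp add: lincomb_def)

lemma prob_space_std_normal: "prob_space std_normal"
  by (rule prob_space_normal_density) simp

interpretation std_normal: prob_space std_normal
  by (rule prob_space_std_normal)

interpretation std_normal_family: product_sigma_finite "\<lambda>_::nat. std_normal"
  by standard

lemma prob_space_std_normal_vec: "prob_space (std_normal_vec n)"
  unfolding std_normal_vec_def by (intro prob_space_PiM prob_space_std_normal)

interpretation std_normal_vec: prob_space "std_normal_vec n" for n
  by (rule prob_space_std_normal_vec)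

lemma sets_std_normal_vec [measurable_cong, simp]: "sets (std_normal_vec n) = sets (vec_space n)"
  unfolding std_normal_vec_def vec_space_def by (intro sets_PiM_cong) auto

lemma space_std_normal_vec [simp]: "space (std_normal_vec n) = space (vec_space n)"
  using sets_std_normal_vec by (rule sets_eq_imp_space_eq)

lemma space_vec_space: "space (vec_space n) = (\<Pi>\<^sub>E i\<in>{..<n}. UNIV)"
  by (simp add: vec_space_def space_PiM)

lemma vec_space_eqI:
  "x \<in> space (vec_space n) \<Longrightarrow> y \<in> space (vec_space n) \<Longrightarrow> (\<And>i. i < n \<Longrightarrow> x i = y i) \<Longrightarrow> x = y"
  unfolding space_vec_space by (rule PiE_ext) auto

lemma restrict_in_space_vec_space [simp]: "restrict x {..<n} \<in> space (vec_space n)"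
  by (simp add: space_vec_space)

lemma lincomb_in_space [simp]: "lincomb n a x b y \<in> space (vec_space n)"
  by (simp add: lincomb_def)

lemma emeasure_std_normal_vec_space [simp]:
  "emeasure (std_normal_vec n) (space (vec_space n)) = 1"
  using std_normal_vec.emeasure_space_1[of n] by simp

lemma measurable_vec_component:
  "i < n \<Longrightarrow> (\<lambda>x. x i) \<in> borel_measurable (vec_space n)"
  unfolding vec_space_def by (rule measurable_component_singleton) auto

lemma measurable_vec_component_compose:
  "f \<in> M \<rightarrow>\<^sub>M vec_space n \<Longrightarrow> i < n \<Longrightarrow> (\<lambda>x. f x i) \<in> borel_measurable M"
  by (rule measurable_compose[OF _ measurable_vec_component])

lemma measurable_vecI:
  "(\<And>i. i < n \<Longrightarrow> (\<lambda>x. f x i) \<in> borel_measurable M) \<Longrightarrow>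
     (\<lambda>x. restrict (f x) {..<n}) \<in> M \<rightarrow>\<^sub>M vec_space n"
  unfolding vec_space_def by (rule measurable_restrict) auto

lemma measurable_lincomb [measurable (raw)]:
  assumes "f \<in> M \<rightarrow>\<^sub>M vec_space n" "g \<in> M \<rightarrow>\<^sub>M vec_space n"
    and "a \<in> borel_measurable M" "b \<in> borel_measurable M"
  shows "(\<lambda>x. lincomb n (a x) (f x) (b x) (g x)) \<in> M \<rightarrow>\<^sub>M vec_space n"
  unfolding lincomb_def
  by (rule measurable_vecI)
     (auto intro!: borel_measurable_add borel_measurable_times assms measurable_vec_component_compose[OF assms(1)]
        measurable_vec_component_compose[OF assms(2)])

lemma measurable_lincomb_const [measurable]:
  "lincomb n a c b \<in> vec_space n \<rightarrow>\<^sub>M vec_space n"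
  unfolding lincomb_def
  by (rule measurable_vecI) (auto intro!: borel_measurable_add borel_measurable_times measurable_vec_component)

lemma measurable_sqnorm [measurable (raw)]:
  "f \<in> M \<rightarrow>\<^sub>M vec_space n \<Longrightarrow> (\<lambda>x. sqnorm n (f x)) \<in> borel_measurable M"
  unfolding sqnorm_def by (intro borel_measurable_sum) (auto intro!: borel_measurable_power measurable_vec_component_compose)

section \<open>Moments and symmetries of the Gaussian vector law\<close>

lemma nn_integral_std_normal_vec_component:
  assumes [measurable]: "f \<in> borel_measurable borel" and "i < n"
  shows "(\<integral>\<^sup>+x. f (x i) \<partial>std_normal_vec n) = (\<integral>\<^sup>+x. f x \<partial>std_normal)"
proof -
  have *: "distr (std_normal_vec n) std_normal (\<lambda>x. x i) = std_normal"
    unfolding std_normal_vec_def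
    by (rule distr_PiM_component[where M = "\<lambda>_. std_normal"]) (use assms(2) in \<open>auto simp: prob_space_std_normal\<close>)
  have [measurable]: "(\<lambda>x. x i) \<in> std_normal_vec n \<rightarrow>\<^sub>M std_normal"
    unfolding std_normal_vec_def using assms(2) by (intro measurable_component_singleton) auto
  show ?thesis
    by (subst *[symmetric], subst nn_integral_distr[OF \<open>_ \<in> _ \<rightarrow>\<^sub>M std_normal\<close>]) auto
qed

lemma nn_integral_std_normal_even_moment:
  "(\<integral>\<^sup>+x. ennreal (x ^ (2 * k)) \<partial>std_normal) = ennreal (fact (2 * k) / (2 ^ k * fact k))"
proof -
  have "(\<integral>\<^sup>+x. ennreal (x ^ (2 * k)) \<partial>std_normal)
      = (\<integral>\<^sup>+x. ennreal (std_normal_density x * x ^ (2 * k)) \<partial>lborel)"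
    by (subst nn_integral_density) (auto simp: ennreal_mult' )
  also have "\<dots> = ennreal (fact (2 * k) / (2 ^ k * fact k))"
    using std_normal_moment_even[of k]
    by (intro nn_integral_eq_integrable[THEN iffD2])
       (auto simp: has_bochner_integral_iff)
  finally show ?thesis .
qed

lemma nn_integral_std_normal_shifted_square:
  "(\<integral>\<^sup>+x. ennreal ((c + x)\<^sup>2) \<partial>std_normal) = ennreal (c\<^sup>2 + 1)"
proof -
  have i0: "has_bochner_integral lborel (\<lambda>x. std_normal_density x) 1"
    using std_normal_moment_even[of 0] by simp
  have i1: "has_bochner_integral lborel (\<lambda>x. std_normal_density x * x) 0"
    using std_normal_moment_odd[of 0] by simp
  have i2: "has_bochner_integral lborel (\<lambda>x. std_normal_density x * x\<^sup>2) 1"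
    using std_normal_moment_even[of 1] by (simp add: fact_numeral)
  have "has_bochner_integral lborel (\<lambda>x. (c\<^sup>2 * std_normal_density x + 2 * c * (std_normal_density x * x)) + std_normal_density x * x\<^sup>2) ((c\<^sup>2 * 1 + 2 * c * 0) + 1)"
    by (intro has_bochner_integral_add has_bochner_integral_mult_right i0 i1 i2)
  then have *: "has_bochner_integral lborel (\<lambda>x. std_normal_density x * (c + x)\<^sup>2) (c\<^sup>2 + 1)"
    by (simp add: power2_eq_square algebra_simps)
  have "(\<integral>\<^sup>+x. ennreal ((c + x)\<^sup>2) \<partial>std_normal) = (\<integral>\<^sup>+x. ennreal (std_normal_density x * (c + x)\<^sup>2) \<partial>lborel)"
    by (subst nn_integral_density) (auto simp: ennreal_mult')
  also have "\<dots> = ennreal (c\<^sup>2 + 1)"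
    using * by (intro nn_integral_eq_integrable[THEN iffD2]) (auto simp: has_bochner_integral_iff)
  finally show ?thesis .
qed

lemma nn_integral_sqnorm_shift:
  "(\<integral>\<^sup>+w. ennreal (sqnorm n (lincomb n 1 c 1 w)) \<partial>std_normal_vec n) = ennreal (sqnorm n c + real n)"
proof -
  have "(\<integral>\<^sup>+w. ennreal (sqnorm n (lincomb n 1 c 1 w)) \<partial>std_normal_vec n)
      = (\<integral>\<^sup>+w. (\<Sum>i<n. ennreal ((c i + w i)\<^sup>2)) \<partial>std_normal_vec n)"
    by (simp add: sqnorm_def sum_ennreal)
  also have "\<dots> = (\<Sum>i<n. \<integral>\<^sup>+w. ennreal ((c i + w i)\<^sup>2) \<partial>std_normal_vec n)"
    proof (rule nn_integral_sum)
    fix i assume "i \<in> {..<n}"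
    then have [measurable]: "(\<lambda>x. x i) \<in> borel_measurable (vec_space n)"
      by (intro measurable_vec_component) auto
    show "(\<lambda>w. ennreal ((c i + w i)\<^sup>2)) \<in> borel_measurable (std_normal_vec n)" by measurable
  qed
  also have "\<dots> = (\<Sum>i<n. ennreal ((c i)\<^sup>2 + 1))"
    by (intro sum.cong refl)
       (subst nn_integral_std_normal_vec_component[where f="\<lambda>x. ennreal ((c _ + x)\<^sup>2)"], auto simp: nn_integral_std_normal_shifted_square)
  also have "\<dots> = ennreal (sqnorm n c + real n)"
    by (subst sum_ennreal) (auto simp: sqnorm_def sum.distrib)
  finally show ?thesis .
qed

lemma nn_integral_sqnorm:
  "(\<integral>\<^sup>+w. ennreal (sqnorm n w) \<partial>std_normal_vec n) = ennreal (real n)"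
proof -
  have "sqnorm n (lincomb n 1 (\<lambda>_. 0) 1 w) = sqnorm n w" for w
    by (simp add: sqnorm_def)
  then show ?thesis using nn_integral_sqnorm_shift[of n "\<lambda>_. 0"] by (simp add: sqnorm_def[of n "\<lambda>_. 0"])
qed

lemma nn_integral_std_normal_vec_prod:
  assumes "\<And>i. i < n \<Longrightarrow> f i \<in> borel_measurable borel"
  shows "(\<integral>\<^sup>+x. (\<Prod>i<n. f i (x i)) \<partial>std_normal_vec n) = (\<Prod>i<n. \<integral>\<^sup>+x. f i x \<partial>std_normal)"
  unfolding std_normal_vec_def
  by (rule std_normal_family.product_nn_integral_prod) (use assms in auto)

text \<open>The factor \<open>exp (sqnorm n w / 2)\<close> cancels the Gaussian density, so the
  weighted law is a multiple of Lebesgue measure. This is what later allows an output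
  \<open>m s + w\<close> to be treated as a free variable that does not involve
  \<open>s\<close>.\<close>

lemma nn_integral_std_normal_vec_flat_translate:
  assumes G [measurable]: "G \<in> borel_measurable (vec_space n)"
  shows "(\<integral>\<^sup>+w. ennreal (exp (sqnorm n w / 2)) * G (lincomb n 1 c 1 w) \<partial>std_normal_vec n)
       = (\<integral>\<^sup>+u. ennreal (exp (sqnorm n u / 2)) * G u \<partial>std_normal_vec n)"
proof -
  define flat :: "real measure" where "flat = density lborel (\<lambda>_. ennreal (1 / sqrt (2 * pi)))"
  interpret sigma_finite_measure flat
    unfolding flat_def by (rule sigma_finite_measure.sigma_finite_iff_density_finite[THEN iffD2]) (auto intro: sigma_finite_lborel)
  interpret flat: product_sigma_finite "\<lambda>_::nat. flat"
    by standard
  define \<nu> where "\<nu> = density (std_normal_vec n) (\<lambda>w. ennreal (exp (sqnorm n w / 2)))"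
  have [measurable_cong]: "sets \<nu> = sets (vec_space n)" by (simp add: \<nu>_def)
  have one: "(\<integral>\<^sup>+x. ennreal (exp (x\<^sup>2 / 2)) * indicator A (c + x) \<partial>std_normal) = emeasure flat A"
    if [measurable]: "A \<in> sets borel" for A and c :: real
  proof -
    have "(\<integral>\<^sup>+x. ennreal (exp (x\<^sup>2 / 2)) * indicator A (c + x) \<partial>std_normal)
        = (\<integral>\<^sup>+x. ennreal (std_normal_density x) * (ennreal (exp (x\<^sup>2 / 2)) * indicator A (c + x)) \<partial>lborel)"
      by (rule nn_integral_density) auto
    also have "\<dots> = (\<integral>\<^sup>+x. ennreal (1 / sqrt (2 * pi)) * indicator A (c + 1 * x) \<partial>lborel)"
      by (intro nn_integral_cong)
         (auto simp: std_normal_density_def mult.assoc[symmetric] ennreal_mult'[symmetric] exp_minus field_simps)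
    also have "\<dots> = (\<integral>\<^sup>+x. ennreal (1 / sqrt (2 * pi)) * indicator A x \<partial>lborel)"
      by (subst (2) nn_integral_real_affine[of _ 1 c]) auto
    also have "\<dots> = emeasure flat A"
      unfolding flat_def by (subst emeasure_density) auto
    finally show ?thesis .
  qed
  \<comment> \<open>The right side does not depend on \<open>c\<close>; the two sides of the lemma
    are the instances \<open>c\<close> and 0.\<close>
  have *: "distr \<nu> (vec_space n) (\<lambda>w. lincomb n 1 c 1 w) = PiM {..<n} (\<lambda>_. flat)" for c
  proof (rule flat.PiM_eqI)
    show "sets (distr \<nu> (vec_space n) (lincomb n 1 c 1)) = sets (PiM {..<n} (\<lambda>_. flat))"
      by (simp add: vec_space_def) (intro sets_PiM_cong, auto simp: flat_def)
    fix A :: "nat \<Rightarrow> real set" assume "\<And>i. i \<in> {..<n} \<Longrightarrow> A i \<in> sets flat"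
    then have A [measurable]: "\<And>i. i < n \<Longrightarrow> A i \<in> sets borel" by (simp add: flat_def)
    have [measurable]: "Pi\<^sub>E {..<n} A \<in> sets (vec_space n)"
      unfolding vec_space_def by (rule sets_PiM_I_finite) (auto simp: A)
    have "emeasure (distr \<nu> (vec_space n) (lincomb n 1 c 1)) (Pi\<^sub>E {..<n} A)
       = (\<integral>\<^sup>+w. ennreal (exp (sqnorm n w / 2)) * indicator (Pi\<^sub>E {..<n} A) (lincomb n 1 c 1 w) \<partial>std_normal_vec n)"
      by (subst nn_integral_indicator[symmetric], simp, subst nn_integral_distr, simp_all add: \<nu>_def, subst nn_integral_density) auto
    also have "\<dots> = (\<integral>\<^sup>+w. (\<Prod>i<n. ennreal (exp ((w i)\<^sup>2 / 2)) * indicator (A i) (c i + w i)) \<partial>std_normal_vec n)"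
    proof (intro nn_integral_cong)
      fix w
      have 1: "exp (sqnorm n w / 2) = (\<Prod>i<n. exp ((w i)\<^sup>2 / 2))"
        by (simp add: sqnorm_def sum_divide_distrib exp_sum)
      have 2: "(indicator (Pi\<^sub>E {..<n} A) (lincomb n 1 c 1 w) :: ennreal) = (\<Prod>i<n. indicator (A i) (c i + w i))"
      proof (cases "\<forall>i<n. c i + w i \<in> A i")
        case True
        then show ?thesis by (auto simp: indicator_def PiE_def lincomb_def Pi_iff)
      next
        case False
        then show ?thesis by (auto simp: indicator_def PiE_def lincomb_def Pi_iff)
      qed
      show "ennreal (exp (sqnorm n w / 2)) * indicator (Pi\<^sub>E {..<n} A) (lincomb n 1 c 1 w)
        = (\<Prod>i<n. ennreal (exp ((w i)\<^sup>2 / 2)) * indicator (A i) (c i + w i))"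
        unfolding 1 2 by (subst prod_ennreal[symmetric]) (auto simp: prod.distrib)
    qed
    also have "\<dots> = (\<Prod>i<n. emeasure flat (A i))"
      by (subst nn_integral_std_normal_vec_prod) (auto simp: one)
    finally show "emeasure (distr \<nu> (vec_space n) (lincomb n 1 c 1)) (Pi\<^sub>E {..<n} A) = (\<Prod>i\<in>{..<n}. emeasure flat (A i))" .
  qed auto
  have int: "(\<integral>\<^sup>+w. ennreal (exp (sqnorm n w / 2)) * G (lincomb n 1 c 1 w) \<partial>std_normal_vec n)
     = integral\<^sup>N (PiM {..<n} (\<lambda>_. flat)) G" for c
  proof -
    show ?thesis
      unfolding *[of c, symmetric]
      by (subst nn_integral_distr, simp_all add: \<nu>_def, subst nn_integral_density) auto
  qed
  have "(\<integral>\<^sup>+u. ennreal (exp (sqnorm n u / 2)) * G u \<partial>std_normal_vec n)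
      = (\<integral>\<^sup>+w. ennreal (exp (sqnorm n w / 2)) * G (lincomb n 1 (\<lambda>_. 0) 1 w) \<partial>std_normal_vec n)"
    by (intro nn_integral_cong arg_cong2[where f="(*)"] arg_cong[where f=G] refl vec_space_eqI[of _ n]) auto
  then show ?thesis using int by simp
qed

lemma nn_integral_std_normal_rotate:
  assumes "\<alpha>\<^sup>2 + \<beta>\<^sup>2 = 1" and [measurable]: "A \<in> sets borel"
  shows "(\<integral>\<^sup>+z. \<integral>\<^sup>+w. indicator A (\<alpha> * z + \<beta> * w) \<partial>std_normal \<partial>std_normal) = emeasure std_normal A"
proof -
  interpret Q: pair_prob_space std_normal std_normal ..
  have d1: "distr (std_normal \<Otimes>\<^sub>M std_normal) std_normal fst = std_normal"
    by (rule std_normal.distr_pair_fst)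
  have d2: "distr (std_normal \<Otimes>\<^sub>M std_normal) std_normal snd = std_normal"
  proof (rule measure_eqI)
    fix A assume "A \<in> sets (distr (std_normal \<Otimes>\<^sub>M std_normal) std_normal snd)"
    then have [measurable]: "A \<in> sets borel" by simp
    have "snd -` A \<inter> space (std_normal \<Otimes>\<^sub>M std_normal) = UNIV \<times> A"
      by (auto simp: space_pair_measure)
    then show "emeasure (distr (std_normal \<Otimes>\<^sub>M std_normal) std_normal snd) A = emeasure std_normal A"
      using std_normal.emeasure_space_1
      by (simp add: emeasure_distr std_normal.emeasure_pair_measure_Times)
  qed simp
  have D1: "distributed (std_normal \<Otimes>\<^sub>M std_normal) lborel fst std_normal_density"
    using d1 by (auto simp: distributed_def cong: distr_cong)
  have D2: "distributed (std_normal \<Otimes>\<^sub>M std_normal) lborel snd std_normal_density"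
    using d2 by (auto simp: distributed_def cong: distr_cong)
  have D: "distributed (std_normal \<Otimes>\<^sub>M std_normal) lborel (\<lambda>x. \<alpha> * fst x + \<beta> * snd x) std_normal_density"
  proof -
    \<comment> \<open>A zero coefficient would give a normal law of variance zero, which the sum
      rule for independent normals excludes.\<close>
    consider "\<alpha> = 0" | "\<beta> = 0" | "\<alpha> \<noteq> 0" "\<beta> \<noteq> 0" by blast
    then show ?thesis
    proof cases
      case 1
      then have "\<bar>\<beta>\<bar> = 1" "\<beta> \<noteq> 0" using assms(1) by (auto simp: power2_eq_1_iff)
      then show ?thesis using Q.P.normal_density_affine[OF D2, of \<beta> 0] 1 by simp
    next
      case 2
      then have "\<bar>\<alpha>\<bar> = 1" "\<alpha> \<noteq> 0" using assms(1) by (auto simp: power2_eq_1_iff)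
      then show ?thesis using Q.P.normal_density_affine[OF D1, of \<alpha> 0] 2 by simp
    next
      case 3
      have e1: "distributed (std_normal \<Otimes>\<^sub>M std_normal) lborel (\<lambda>x. \<alpha> * fst x) (normal_density 0 \<bar>\<alpha>\<bar>)"
        using Q.P.normal_density_affine[OF D1, of \<alpha> 0] 3 by simp
      have e2: "distributed (std_normal \<Otimes>\<^sub>M std_normal) lborel (\<lambda>x. \<beta> * snd x) (normal_density 0 \<bar>\<beta>\<bar>)"
        using Q.P.normal_density_affine[OF D2, of \<beta> 0] 3 by simp
      have i: "Q.P.indep_var borel fst borel snd"
        unfolding Q.P.indep_var_distribution_eq
        using d1 d2 distr_id2[of "borel \<Otimes>\<^sub>M borel" "std_normal \<Otimes>\<^sub>M std_normal"]
        by (auto cong: distr_cong sets_pair_measure_cong)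
      have "Q.P.indep_var borel (\<lambda>x. \<alpha> * fst x) borel (\<lambda>x. \<beta> * snd x)"
        using Q.P.indep_var_compose[OF i, of "\<lambda>x. \<alpha> * x" borel "\<lambda>x. \<beta> * x" borel] by (simp add: comp_def)
      from Q.P.add_indep_normal[OF this _ _ e1 e2] 3 show ?thesis
        using assms(1) by simp
    qed
  qed
  have "(\<integral>\<^sup>+z. \<integral>\<^sup>+w. indicator A (\<alpha> * z + \<beta> * w) \<partial>std_normal \<partial>std_normal)
      = (\<integral>\<^sup>+x. indicator A (\<alpha> * fst x + \<beta> * snd x) \<partial>(std_normal \<Otimes>\<^sub>M std_normal))"
    by (subst std_normal.nn_integral_fst[symmetric]) auto
  also have "\<dots> = (\<integral>\<^sup>+x. indicator A x \<partial>distr (std_normal \<Otimes>\<^sub>M std_normal) lborel (\<lambda>x. \<alpha> * fst x + \<beta> * snd x))"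
    by (subst nn_integral_distr) auto
  also have "\<dots> = emeasure std_normal A"
    using D by (simp add: distributed_def)
  finally show ?thesis .
qed

text \<open>Needed for refining side information: the noise of a coarse observation and the noise of
  a fresh one, combined with weights on the unit circle, act as a single standard noise
  vector.\<close>

lemma nn_integral_std_normal_vec_rotate:
  assumes "\<alpha>\<^sup>2 + \<beta>\<^sup>2 = 1" and G [measurable]: "G \<in> borel_measurable (vec_space n)"
  shows "(\<integral>\<^sup>+z. \<integral>\<^sup>+w. G (lincomb n \<alpha> z \<beta> w) \<partial>std_normal_vec n \<partial>std_normal_vec n)
       = (\<integral>\<^sup>+z. G z \<partial>std_normal_vec n)"
proof -
  let ?Q = "std_normal_vec n \<Otimes>\<^sub>M std_normal_vec n"
  let ?T = "\<lambda>x. lincomb n \<alpha> (fst x) \<beta> (snd x)"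
  have "distr ?Q (vec_space n) ?T = PiM {..<n} (\<lambda>_. std_normal)"
  proof (rule std_normal_family.PiM_eqI)
    show "sets (distr ?Q (vec_space n) ?T) = sets (PiM {..<n} (\<lambda>_. std_normal))"
      using sets_std_normal_vec[of n] by (simp add: std_normal_vec_def)
    fix A :: "nat \<Rightarrow> real set" assume "\<And>i. i \<in> {..<n} \<Longrightarrow> A i \<in> sets std_normal"
    then have A [measurable]: "\<And>i. i < n \<Longrightarrow> A i \<in> sets borel" by simp
    have [measurable]: "Pi\<^sub>E {..<n} A \<in> sets (vec_space n)"
      unfolding vec_space_def by (rule sets_PiM_I_finite) (auto simp: A)
    have "emeasure (distr ?Q (vec_space n) ?T) (Pi\<^sub>E {..<n} A)
       = (\<integral>\<^sup>+x. indicator (Pi\<^sub>E {..<n} A) (?T x) \<partial>?Q)"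
      by (subst nn_integral_indicator[symmetric], simp, subst nn_integral_distr) auto
    also have "\<dots> = (\<integral>\<^sup>+z. \<integral>\<^sup>+w. indicator (Pi\<^sub>E {..<n} A) (lincomb n \<alpha> z \<beta> w) \<partial>std_normal_vec n \<partial>std_normal_vec n)"
      by (subst std_normal_vec.nn_integral_fst[symmetric]) auto
    also have "\<dots> = (\<integral>\<^sup>+z. \<integral>\<^sup>+w. (\<Prod>i<n. indicator (A i) (\<alpha> * z i + \<beta> * w i)) \<partial>std_normal_vec n \<partial>std_normal_vec n)"
    proof (intro nn_integral_cong)
      fix z w
      show "(indicator (Pi\<^sub>E {..<n} A) (lincomb n \<alpha> z \<beta> w) :: ennreal) = (\<Prod>i<n. indicator (A i) (\<alpha> * z i + \<beta> * w i))"
      proof (cases "\<forall>i<n. \<alpha> * z i + \<beta> * w i \<in> A i")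
        case True
        then show ?thesis by (auto simp: indicator_def PiE_def lincomb_def Pi_iff)
      next
        case False
        then show ?thesis by (auto simp: indicator_def PiE_def lincomb_def Pi_iff)
      qed
    qed
    also have "\<dots> = (\<integral>\<^sup>+z. (\<Prod>i<n. \<integral>\<^sup>+w. indicator (A i) (\<alpha> * z i + \<beta> * w) \<partial>std_normal) \<partial>std_normal_vec n)"
      by (intro nn_integral_cong, subst nn_integral_std_normal_vec_prod) auto
    also have "\<dots> = (\<Prod>i<n. emeasure std_normal (A i))"
      by (subst nn_integral_std_normal_vec_prod[where f = "\<lambda>i z. \<integral>\<^sup>+w. indicator (A i) (\<alpha> * z + \<beta> * w) \<partial>std_normal"])
         (auto simp: nn_integral_std_normal_rotate[OF assms(1)])
    finally show "emeasure (distr ?Q (vec_space n) ?T) (Pi\<^sub>E {..<n} A) = (\<Prod>i\<in>{..<n}. emeasure std_normal (A i))" .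
  qed auto
  then have *: "distr ?Q (vec_space n) ?T = std_normal_vec n" by (simp add: std_normal_vec_def)
  have "(\<integral>\<^sup>+z. G z \<partial>std_normal_vec n) = (\<integral>\<^sup>+x. G (?T x) \<partial>?Q)"
    by (subst *[symmetric], subst nn_integral_distr) auto
  also have "\<dots> = (\<integral>\<^sup>+z. \<integral>\<^sup>+w. G (lincomb n \<alpha> z \<beta> w) \<partial>std_normal_vec n \<partial>std_normal_vec n)"
    by (subst std_normal_vec.nn_integral_fst[symmetric]) auto
  finally show ?thesis by simp
qed

text \<open>Once the weight has cancelled the reference density, \<open>sqrt v\<close> times a
  normal density of variance \<open>v\<close> remains. This \<open>sqrt v\<close> is what a Gaussian
  prediction of variance \<open>v\<close> contributes to the product inequality.\<close>

lemma nn_integral_exp_quadratic_std_normal: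
  assumes "v > 0"
  shows "(\<integral>\<^sup>+x. ennreal (exp (x\<^sup>2 / 2) * exp (- ((x - p)\<^sup>2 / (2 * v)))) \<partial>std_normal) = ennreal (sqrt v)"
proof -
  interpret N: prob_space "density lborel (normal_density p (sqrt v))"
    by (rule prob_space_normal_density) (use assms in simp)
  have "(\<integral>\<^sup>+x. ennreal (exp (x\<^sup>2 / 2) * exp (- ((x - p)\<^sup>2 / (2 * v)))) \<partial>std_normal)
     = (\<integral>\<^sup>+x. ennreal (std_normal_density x) * ennreal (exp (x\<^sup>2 / 2) * exp (- ((x - p)\<^sup>2 / (2 * v)))) \<partial>lborel)"
    by (rule nn_integral_density) auto
  also have "\<dots> = (\<integral>\<^sup>+x. ennreal (sqrt v) * ennreal (normal_density p (sqrt v) x) \<partial>lborel)"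
    using assms
    by (intro nn_integral_cong)
       (simp add: std_normal_density_def normal_density_def ennreal_mult'[symmetric] exp_minus real_sqrt_mult field_simps)
  also have "\<dots> = ennreal (sqrt v)"
    using N.emeasure_space_1 by (subst nn_integral_cmult) (auto simp: emeasure_density)
  finally show ?thesis .
qed

lemma nn_integral_exp_quadratic_std_normal_vec:
  assumes "v > 0"
  shows "(\<integral>\<^sup>+x. ennreal (exp (sqnorm n x / 2) * exp (- (sqnorm n (lincomb n 1 x (-1) p) / (2 * v)))) \<partial>std_normal_vec n)
     = ennreal (sqrt v ^ n)"
proof -
  have "(\<integral>\<^sup>+x. ennreal (exp (sqnorm n x / 2) * exp (- (sqnorm n (lincomb n 1 x (-1) p) / (2 * v)))) \<partial>std_normal_vec n)
     = (\<integral>\<^sup>+x. (\<Prod>i<n. ennreal (exp ((x i)\<^sup>2 / 2) * exp (- ((x i - p i)\<^sup>2 / (2 * v))))) \<partial>std_normal_vec n)"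
    by (intro nn_integral_cong, subst prod_ennreal)
       (auto simp: prod.distrib sqnorm_def sum_divide_distrib exp_sum sum_negf[symmetric])
  also have "\<dots> = (\<Prod>i<n. ennreal (sqrt v))"
    by (subst nn_integral_std_normal_vec_prod[where f="\<lambda>i x. ennreal (exp (x\<^sup>2 / 2) * exp (- ((x - p i)\<^sup>2 / (2 * v))))"])
       (auto simp: nn_integral_exp_quadratic_std_normal[OF assms])
  also have "\<dots> = ennreal (sqrt v ^ n)"
    using assms by (subst prod_ennreal) auto
  finally show ?thesis .
qed

section \<open>Converse for a fixed channel state\<close>

text \<open>Costs are integrals in \<open>ennreal\<close> and may be infinite; the value 0 at the
  top lets the change of measure run without integrability conditions on the code.\<close>

definition exp_neg :: "ennreal \<Rightarrow> ennreal" where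
  "exp_neg b = (if b = \<top> then 0 else ennreal (exp (- enn2real b)))"

lemma measurable_exp_neg [measurable]: "exp_neg \<in> borel_measurable borel"
  unfolding exp_neg_def by measurable

lemma exp_neg_ennreal [simp]: "0 \<le> b \<Longrightarrow> exp_neg (ennreal b) = ennreal (exp (- b))"
  by (simp add: exp_neg_def)

lemma exp_neg_add: "exp_neg (a + b) = exp_neg a * exp_neg b"
  by (cases a; cases b) (auto simp: exp_neg_def ennreal_plus[symmetric] ennreal_mult'[symmetric] exp_add[symmetric] simp del: ennreal_plus)

lemma exp_neg_antimono: "a \<le> b \<Longrightarrow> exp_neg b \<le> exp_neg a"
  by (cases a; cases b) (auto simp: exp_neg_def top_unique)

text \<open>Jensen's inequality for the exponent \<open>a - b\<close>, standing in for the
  nonnegativity of relative entropy. As \<open>b\<close> may be infinite, the tangent inequality is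
  rearranged so that only sums of nonnegative terms occur.\<close>

lemma (in prob_space) jensen_exp_neg:
  assumes a [measurable]: "a \<in> borel_measurable M" and "\<And>x. 0 \<le> a x"
    and A: "(\<integral>\<^sup>+x. ennreal (a x) \<partial>M) = ennreal A" "0 \<le> A"
    and b [measurable]: "b \<in> borel_measurable M"
  shows "ennreal (exp A) * exp_neg (\<integral>\<^sup>+x. b x \<partial>M) \<le> (\<integral>\<^sup>+x. ennreal (exp (a x)) * exp_neg (b x) \<partial>M)"
proof (cases "(\<integral>\<^sup>+x. b x \<partial>M)")
  case top
  then show ?thesis by (simp add: exp_neg_def)
next
  case (real m)
  let ?c = "exp (A - m)"
  \<comment> \<open>The tangent of \<open>exp\<close> at the mean exponent \<open>A - m\<close>,
    with all negative terms moved to the right side.\<close>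
  have pt: "ennreal (?c * (1 + m + a x)) \<le> ennreal (exp (a x)) * exp_neg (b x) + ennreal ?c * (b x + ennreal A)" for x
  proof (cases "b x")
    case top
    then show ?thesis by (simp add: ennreal_mult_top)
  next
    case (real r)
    have "1 + (a x - r - (A - m)) \<le> exp (a x - r - (A - m))"
      by (rule exp_ge_add_one_self)
    then have "?c * (1 + (a x - r - (A - m))) \<le> ?c * exp (a x - r - (A - m))" by simp
    also have "\<dots> = exp (a x) * exp (- r)"
      by (simp add: exp_add[symmetric])
    finally have "?c * (1 + m + a x) \<le> exp (a x) * exp (- r) + ?c * (r + A)"
      by (simp add: algebra_simps)
    then show ?thesis
      using real A(2) assms(2)[of x]
      by (simp add: ennreal_plus[symmetric] ennreal_mult'[symmetric] ennreal_leI del: ennreal_plus)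
  qed
  have "(\<integral>\<^sup>+x. ennreal (?c * (1 + m + a x)) \<partial>M)
      = (\<integral>\<^sup>+x. ennreal ?c * (ennreal (1 + m) + ennreal (a x)) \<partial>M)"
    using real assms(2) by (intro nn_integral_cong) (simp add: ennreal_plus[symmetric] ennreal_mult'[symmetric] del: ennreal_plus)
  also have "\<dots> = ennreal ?c * (ennreal (1 + m) + ennreal A)"
    using A real by (simp add: nn_integral_cmult nn_integral_add emeasure_space_1)
  finally have 1: "(\<integral>\<^sup>+x. ennreal (?c * (1 + m + a x)) \<partial>M) = ennreal ?c * (ennreal (1 + m) + ennreal A)" .
  have 2: "(\<integral>\<^sup>+x. ennreal (exp (a x)) * exp_neg (b x) + ennreal ?c * (b x + ennreal A) \<partial>M)
     = (\<integral>\<^sup>+x. ennreal (exp (a x)) * exp_neg (b x) \<partial>M) + ennreal ?c * (ennreal m + ennreal A)"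
    using real by (simp add: nn_integral_cmult nn_integral_add emeasure_space_1)
  have "ennreal ?c * (ennreal (1 + m) + ennreal A) \<le>
      (\<integral>\<^sup>+x. ennreal (exp (a x)) * exp_neg (b x) \<partial>M) + ennreal ?c * (ennreal m + ennreal A)"
    unfolding 1[symmetric] 2[symmetric] by (intro nn_integral_mono pt)
  moreover have "ennreal ?c * (ennreal (1 + m) + ennreal A) = ennreal ?c + ennreal ?c * (ennreal m + ennreal A)"
    using real A(2) by (simp add: ennreal_plus[symmetric] ennreal_mult'[symmetric] algebra_simps del: ennreal_plus)
  moreover have "ennreal ?c * (ennreal m + ennreal A) \<noteq> \<top>"
    using real A(2) by (simp add: ennreal_mult_eq_top_iff)
  ultimately have "ennreal ?c \<le> (\<integral>\<^sup>+x. ennreal (exp (a x)) * exp_neg (b x) \<partial>M)"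
    by (simp only: add.commute[of _ "ennreal ?c * (ennreal m + ennreal A)"] ennreal_add_left_cancel_le infinity_ennreal_def simp_thms)
  then show ?thesis using real
    by (simp add: ennreal_mult'[symmetric] exp_add[symmetric])
qed

text \<open>One step of the change of measure: a decoder in state \<open>z\<close> predicts the observation
  \<open>m s + W\<close> by a Gaussian with mean \<open>p z\<close> and variance \<open>v\<close>, and moves to state \<open>\<tau> (z, m s + W)\<close>.\<close>

definition observe :: "nat \<Rightarrow> ((nat \<Rightarrow> real) \<Rightarrow> (nat \<Rightarrow> real)) \<Rightarrow> ('z \<Rightarrow> (nat \<Rightarrow> real)) \<Rightarrow> real \<Rightarrow>
   ('z \<times> (nat \<Rightarrow> real) \<Rightarrow> 'y) \<Rightarrow> ((nat \<Rightarrow> real) \<times> 'y \<Rightarrow> ennreal) \<Rightarrow> (nat \<Rightarrow> real) \<times> 'z \<Rightarrow> ennreal" where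
  "observe n m p v \<tau> B = (\<lambda>(s, z). \<integral>\<^sup>+w. (let u = lincomb n 1 (m s) 1 w in
      ennreal (sqnorm n (lincomb n 1 u (-1) (p z)) / (2 * v)) + B (s, \<tau> (z, u))) \<partial>std_normal_vec n)"

lemma measurable_observe [measurable]:
  assumes [measurable]: "m \<in> vec_space n \<rightarrow>\<^sub>M vec_space n" "p \<in> Z \<rightarrow>\<^sub>M vec_space n"
    "\<tau> \<in> Z \<Otimes>\<^sub>M vec_space n \<rightarrow>\<^sub>M Y" "B \<in> borel_measurable (vec_space n \<Otimes>\<^sub>M Y)"
  shows "observe n m p v \<tau> B \<in> borel_measurable (vec_space n \<Otimes>\<^sub>M Z)"
  unfolding observe_def Let_def by measurable

text \<open>Jensen over the noise takes the average out of the exponent at the price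
  \<open>exp (- n / 2)\<close>, as the mean of \<open>sqnorm n w / 2\<close> is n / 2. Translation
  invariance then makes the observation \<open>u\<close> independent of \<open>s\<close>, so Fubini
  lets \<open>s\<close> be integrated first with the state \<open>\<tau> (z, u)\<close> fixed, which
  gives \<open>K\<close>; the Gaussian integral over \<open>u\<close> gives
  \<open>sqrt v ^ n\<close>.\<close>

lemma observe_bound:
  assumes [measurable]: "m \<in> vec_space n \<rightarrow>\<^sub>M vec_space n" "p \<in> Z \<rightarrow>\<^sub>M vec_space n"
    "\<tau> \<in> Z \<Otimes>\<^sub>M vec_space n \<rightarrow>\<^sub>M Y" "B \<in> borel_measurable (vec_space n \<Otimes>\<^sub>M Y)"
    and v: "v > 0"
    and K: "\<And>y. y \<in> space Y \<Longrightarrow> (\<integral>\<^sup>+s. ennreal (exp (sqnorm n s / 2)) * exp_neg (B (s, y)) \<partial>std_normal_vec n) \<le> ennreal K"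
    and z [simp]: "z \<in> space Z" and "K \<ge> 0"
  shows "(\<integral>\<^sup>+s. ennreal (exp (sqnorm n s / 2)) * exp_neg (observe n m p v \<tau> B (s, z)) \<partial>std_normal_vec n)
     \<le> ennreal (K * (exp (- (1 / 2)) * sqrt v) ^ n)"
proof -
  let ?\<mu> = "std_normal_vec n"
  define q where "q u = sqnorm n (lincomb n 1 u (-1) (p z)) / (2 * v)" for u
  have pz: "p z \<in> space (vec_space n)" using z assms(2) by (metis measurable_space)
  have [measurable]: "q \<in> borel_measurable (vec_space n)"
    unfolding q_def using pz by measurable
  have [measurable]: "(\<lambda>u. \<tau> (z, u)) \<in> vec_space n \<rightarrow>\<^sub>M Y" by measurable
  have q0: "0 \<le> q u" for u unfolding q_def using v by simp
  have e: "ennreal (exp (- (real n / 2))) * ennreal (exp (real n / 2)) = 1"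
    by (simp add: ennreal_mult'[symmetric] exp_add[symmetric])
  have step: "exp_neg (observe n m p v \<tau> B (s, z)) \<le> ennreal (exp (- (real n / 2))) *
     (\<integral>\<^sup>+u. ennreal (exp (sqnorm n u / 2)) * (ennreal (exp (- q u)) * exp_neg (B (s, \<tau> (z, u)))) \<partial>?\<mu>)"
    if s: "s \<in> space (vec_space n)" for s
  proof -
    have [measurable]: "m s \<in> space (vec_space n)" using s assms(1) by (metis measurable_space)
    have [measurable]: "(\<lambda>u. B (s, \<tau> (z, u))) \<in> borel_measurable (vec_space n)"
      using s by measurable
    have [measurable]: "lincomb n 1 (m s) 1 \<in> vec_space n \<rightarrow>\<^sub>M vec_space n"
      by measurable
    have half: "(\<integral>\<^sup>+w. ennreal (sqnorm n w / 2) \<partial>?\<mu>) = ennreal (real n / 2)"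
    proof -
      have "(\<integral>\<^sup>+w. ennreal (sqnorm n w / 2) \<partial>?\<mu>) = (\<integral>\<^sup>+w. ennreal (1/2) * ennreal (sqnorm n w) \<partial>?\<mu>)"
        by (intro nn_integral_cong) (subst ennreal_mult'[symmetric], auto)
      also have "\<dots> = ennreal (1/2) * ennreal (real n)"
        by (subst nn_integral_cmult) (auto simp: nn_integral_sqnorm)
      finally show ?thesis by (subst (asm) ennreal_mult'[symmetric]) auto
    qed
    have "exp_neg (observe n m p v \<tau> B (s, z)) = ennreal (exp (- (real n / 2))) *
       (ennreal (exp (real n / 2)) * exp_neg (\<integral>\<^sup>+w. ennreal (q (lincomb n 1 (m s) 1 w)) + B (s, \<tau> (z, lincomb n 1 (m s) 1 w)) \<partial>?\<mu>))"
      unfolding mult.assoc[symmetric] e by (simp add: observe_def Let_def q_def)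
    also have "\<dots> \<le> ennreal (exp (- (real n / 2))) *
       (\<integral>\<^sup>+w. ennreal (exp (sqnorm n w / 2)) * exp_neg (ennreal (q (lincomb n 1 (m s) 1 w)) + B (s, \<tau> (z, lincomb n 1 (m s) 1 w))) \<partial>?\<mu>)"
      by (intro mult_left_mono std_normal_vec.jensen_exp_neg half) auto
    also have "\<dots> = ennreal (exp (- (real n / 2))) *
       (\<integral>\<^sup>+w. ennreal (exp (sqnorm n w / 2)) * (ennreal (exp (- q (lincomb n 1 (m s) 1 w))) * exp_neg (B (s, \<tau> (z, lincomb n 1 (m s) 1 w)))) \<partial>?\<mu>)"
      by (simp add: exp_neg_add q0)
    also have "\<dots> = ennreal (exp (- (real n / 2))) *
       (\<integral>\<^sup>+u. ennreal (exp (sqnorm n u / 2)) * (ennreal (exp (- q u)) * exp_neg (B (s, \<tau> (z, u)))) \<partial>?\<mu>)"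
      by (subst nn_integral_std_normal_vec_flat_translate[where G = "\<lambda>u. ennreal (exp (- q u)) * exp_neg (B (s, \<tau> (z, u)))"]) auto
    finally show ?thesis .
  qed
  interpret pair_sigma_finite ?\<mu> ?\<mu> ..
  have "(\<integral>\<^sup>+s. ennreal (exp (sqnorm n s / 2)) * exp_neg (observe n m p v \<tau> B (s, z)) \<partial>?\<mu>)
     \<le> (\<integral>\<^sup>+s. ennreal (exp (sqnorm n s / 2)) * (ennreal (exp (- (real n / 2))) *
     (\<integral>\<^sup>+u. ennreal (exp (sqnorm n u / 2)) * (ennreal (exp (- q u)) * exp_neg (B (s, \<tau> (z, u)))) \<partial>?\<mu>)) \<partial>?\<mu>)"
    by (intro nn_integral_mono mult_left_mono step) auto
  also have "\<dots> = ennreal (exp (- (real n / 2))) * (\<integral>\<^sup>+s.  \<integral>\<^sup>+u. ennreal (exp (sqnorm n s / 2)) *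
     (ennreal (exp (sqnorm n u / 2)) * (ennreal (exp (- q u)) * exp_neg (B (s, \<tau> (z, u))))) \<partial>?\<mu> \<partial>?\<mu>)"
    by (subst nn_integral_cmult[symmetric]) (auto simp: nn_integral_cmult[symmetric] mult_ac intro!: nn_integral_cong)
  also have "(\<integral>\<^sup>+s.  \<integral>\<^sup>+u. ennreal (exp (sqnorm n s / 2)) *
     (ennreal (exp (sqnorm n u / 2)) * (ennreal (exp (- q u)) * exp_neg (B (s, \<tau> (z, u))))) \<partial>?\<mu> \<partial>?\<mu>)
     = (\<integral>\<^sup>+u.  \<integral>\<^sup>+s. ennreal (exp (sqnorm n s / 2)) *
     (ennreal (exp (sqnorm n u / 2)) * (ennreal (exp (- q u)) * exp_neg (B (s, \<tau> (z, u))))) \<partial>?\<mu> \<partial>?\<mu>)"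
    by (rule Fubini') measurable
  also have "\<dots> = (\<integral>\<^sup>+u. ennreal (exp (sqnorm n u / 2) * exp (- q u)) *
     (\<integral>\<^sup>+s. ennreal (exp (sqnorm n s / 2)) * exp_neg (B (s, \<tau> (z, u))) \<partial>?\<mu>) \<partial>?\<mu>)"
    by (intro nn_integral_cong, subst nn_integral_cmult[symmetric])
       (auto simp: ennreal_mult' mult_ac intro!: nn_integral_cong)
  also have "\<dots> \<le> (\<integral>\<^sup>+u. ennreal (exp (sqnorm n u / 2) * exp (- q u)) * ennreal K \<partial>?\<mu>)"
    by (intro nn_integral_mono mult_left_mono K)
       (auto intro: measurable_space[OF \<open>(\<lambda>u. \<tau> (z, u)) \<in> vec_space n \<rightarrow>\<^sub>M Y\<close>])
  also have "\<dots> = ennreal (sqrt v ^ n) * ennreal K"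
    by (subst nn_integral_multc) (auto simp: q_def nn_integral_exp_quadratic_std_normal_vec[OF v])
  also have "ennreal (exp (- (real n / 2))) * (ennreal (sqrt v ^ n) * ennreal K) = ennreal (K * (exp (- (1 / 2)) * sqrt v) ^ n)"
    using v \<open>K \<ge> 0\<close> by (simp add: ennreal_mult'[symmetric] power_mult_distrib exp_of_nat_mult[symmetric] mult_ac)
  finally show ?thesis by (simp add: mult_left_mono)
qed

section \<open>Gaussian side information of increasing amplitude\<close>

definition sideinfo_expectation ::
  "nat \<Rightarrow> real \<Rightarrow> ((nat \<Rightarrow> real) \<Rightarrow> (nat \<Rightarrow> real)) \<Rightarrow> real \<Rightarrow>
   ((nat \<Rightarrow> real) \<times> (nat \<Rightarrow> real) \<times> (nat \<Rightarrow> real) \<Rightarrow> ennreal) \<Rightarrow> ennreal" where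
  "sideinfo_expectation n h f g F = (\<integral>\<^sup>+s. \<integral>\<^sup>+w. \<integral>\<^sup>+z.
     F (s, lincomb n h (f s) 1 w, lincomb n g s 1 z) \<partial>std_normal_vec n \<partial>std_normal_vec n \<partial>std_normal_vec n)"

definition sqerror :: "nat \<Rightarrow> ((nat \<Rightarrow> real) \<times> (nat \<Rightarrow> real) \<Rightarrow> (nat \<Rightarrow> real)) \<Rightarrow>
   (nat \<Rightarrow> real) \<times> (nat \<Rightarrow> real) \<times> (nat \<Rightarrow> real) \<Rightarrow> ennreal" where
  "sqerror n e = (\<lambda>(s, z). ennreal (sqnorm n (lincomb n 1 s (-1) (e z))))"

lemma measurable_sqerror [measurable]:
  assumes [measurable]: "e \<in> vec_space n \<Otimes>\<^sub>M vec_space n \<rightarrow>\<^sub>M vec_space n"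
  shows "sqerror n e \<in> borel_measurable (vec_space n \<Otimes>\<^sub>M (vec_space n \<Otimes>\<^sub>M vec_space n))"
  unfolding sqerror_def by measurable

lemma sideinfo_expectation_eq_pair:
  assumes [measurable]: "f \<in> vec_space n \<rightarrow>\<^sub>M vec_space n"
    "F \<in> borel_measurable (vec_space n \<Otimes>\<^sub>M (vec_space n \<Otimes>\<^sub>M vec_space n))"
  shows "sideinfo_expectation n h f g F =
    (\<integral>\<^sup>+(s, w, z). F (s, lincomb n h (f s) 1 w, lincomb n g s 1 z)
       \<partial>(std_normal_vec n \<Otimes>\<^sub>M (std_normal_vec n \<Otimes>\<^sub>M std_normal_vec n)))"
proof -
  interpret pair_prob_space "std_normal_vec n" "std_normal_vec n" ..
  show ?thesis unfolding sideinfo_expectation_def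
    by (subst P.nn_integral_fst[symmetric], measurable,
        intro nn_integral_cong, subst std_normal_vec.nn_integral_fst[symmetric]) (auto, measurable)
qed

lemma sideinfo_expectation_add:
  assumes [measurable]: "f \<in> vec_space n \<rightarrow>\<^sub>M vec_space n"
    "F \<in> borel_measurable (vec_space n \<Otimes>\<^sub>M (vec_space n \<Otimes>\<^sub>M vec_space n))"
    "G \<in> borel_measurable (vec_space n \<Otimes>\<^sub>M (vec_space n \<Otimes>\<^sub>M vec_space n))"
  shows "sideinfo_expectation n h f g (\<lambda>x. F x + G x) = sideinfo_expectation n h f g F + sideinfo_expectation n h f g G"
  by (simp add: sideinfo_expectation_eq_pair split_beta' nn_integral_add)

lemma sideinfo_expectation_cmult:
  assumes [measurable]: "f \<in> vec_space n \<rightarrow>\<^sub>M vec_space n"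
    "F \<in> borel_measurable (vec_space n \<Otimes>\<^sub>M (vec_space n \<Otimes>\<^sub>M vec_space n))"
  shows "sideinfo_expectation n h f g (\<lambda>x. c * F x) = c * sideinfo_expectation n h f g F"
  by (simp add: sideinfo_expectation_eq_pair split_beta' nn_integral_cmult)

lemma sideinfo_expectation_const [simp]: "sideinfo_expectation n h f g (\<lambda>x. c) = c"
  unfolding sideinfo_expectation_def by (simp add: std_normal_vec.emeasure_space_1)

lemma nn_integral_sqnorm_shift_diff:
  "(\<integral>\<^sup>+w. ennreal (sqnorm n (lincomb n 1 (lincomb n 1 c 1 w) (-1) p) / (2 * v)) \<partial>std_normal_vec n)
   = ennreal (1 / (2 * v)) * (ennreal (sqnorm n (lincomb n 1 c (-1) p)) + ennreal (real n))"
  if "v > 0"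
proof -
  have "lincomb n 1 (lincomb n 1 c 1 w) (-1) p = lincomb n 1 (lincomb n 1 c (-1) p) 1 w" for w
    by (rule vec_space_eqI[of _ n]) auto
  then have "(\<integral>\<^sup>+w. ennreal (sqnorm n (lincomb n 1 (lincomb n 1 c 1 w) (-1) p) / (2 * v)) \<partial>std_normal_vec n)
     = (\<integral>\<^sup>+w. ennreal (1 / (2 * v)) * ennreal (sqnorm n (lincomb n 1 (lincomb n 1 c (-1) p) 1 w)) \<partial>std_normal_vec n)"
    using that by (intro nn_integral_cong) (subst ennreal_mult'[symmetric], auto)
  also have "\<dots> = ennreal (1 / (2 * v)) * ennreal (sqnorm n (lincomb n 1 c (-1) p) + real n)"
  proof (subst nn_integral_cmult)
    have "lincomb n 1 (lincomb n 1 c (-1) p) 1 \<in> vec_space n \<rightarrow>\<^sub>M vec_space n"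
      by measurable
    then show "(\<lambda>w. ennreal (sqnorm n (lincomb n 1 (lincomb n 1 c (-1) p) 1 w))) \<in> borel_measurable (std_normal_vec n)"
      by measurable
  qed (simp only: nn_integral_sqnorm_shift)
  finally show ?thesis by simp
qed

text \<open>Side information of amplitude \<open>g'\<close> is equivalent to side information of
  amplitude \<open>g\<close> together with an independent observation of squared amplitude
  \<open>g'\<^sup>2 - g\<^sup>2\<close>. The decoder at \<open>g\<close> predicts this extra
  observation from its own estimate, and its distortion \<open>D\<close> determines how sharp the
  prediction may be.\<close>

lemma sideinfo_step:
  fixes g g' D :: real
  assumes f [measurable]: "f \<in> vec_space n \<rightarrow>\<^sub>M vec_space n"
    and e [measurable]: "e \<in> vec_space n \<Otimes>\<^sub>M vec_space n \<rightarrow>\<^sub>M vec_space n"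
    and B [measurable]: "B \<in> borel_measurable (vec_space n \<Otimes>\<^sub>M (vec_space n \<Otimes>\<^sub>M vec_space n))"
    and K: "\<And>z. z \<in> space (vec_space n \<Otimes>\<^sub>M vec_space n) \<Longrightarrow>
       (\<integral>\<^sup>+s. ennreal (exp (sqnorm n s / 2)) * exp_neg (B (s, z)) \<partial>std_normal_vec n) \<le> ennreal K" "K \<ge> 0"
    and g: "\<bar>g\<bar> < \<bar>g'\<bar>"
    and D: "sideinfo_expectation n h f g (sqerror n e) \<le> ennreal (real n * D)" "D \<ge> 0"
  obtains B' where "B' \<in> borel_measurable (vec_space n \<Otimes>\<^sub>M (vec_space n \<Otimes>\<^sub>M vec_space n))"
    and "\<And>z. z \<in> space (vec_space n \<Otimes>\<^sub>M vec_space n) \<Longrightarrow>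
       (\<integral>\<^sup>+s. ennreal (exp (sqnorm n s / 2)) * exp_neg (B' (s, z)) \<partial>std_normal_vec n)
         \<le> ennreal (K * (exp (- (1 / 2)) * sqrt (1 + (g'\<^sup>2 - g\<^sup>2) * D)) ^ n)"
    and "sideinfo_expectation n h f g B' \<le> ennreal (real n / 2) + sideinfo_expectation n h f g' B"
proof
  \<comment> \<open>Weights of maximal ratio combining: they lie on the unit circle, so the noise
    stays standard, and \<open>\<alpha> * g + \<beta> * a = g'\<close>, so the signal reaches
    amplitude \<open>g'\<close>.\<close>
  define \<alpha> where "\<alpha> = g / g'"
  define \<beta> where "\<beta> = sqrt (1 - \<alpha>\<^sup>2)"
  define a where "a = (g' - \<alpha> * g) / \<beta>"
  \<comment> \<open>Noise variance plus \<open>a\<^sup>2 * D\<close>: for this \<open>v\<close> a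
    distortion of exactly \<open>D\<close> makes the expected cost of the prediction equal to n /
    2.\<close>
  define v where "v = 1 + (g'\<^sup>2 - g\<^sup>2) * D"
  have g2: "g\<^sup>2 < g'\<^sup>2" using power_strict_mono[OF g, of 2] by simp
  have g'0: "g' \<noteq> 0" using g by auto
  have \<alpha>2: "\<alpha>\<^sup>2 < 1" using g2 g'0 by (simp add: \<alpha>_def power_divide)
  have \<beta>2: "\<beta>\<^sup>2 = 1 - \<alpha>\<^sup>2" and \<beta>0: "\<beta> > 0" using \<alpha>2 by (auto simp: \<beta>_def)
  have \<alpha>\<beta>: "\<alpha>\<^sup>2 + \<beta>\<^sup>2 = 1" using \<beta>2 by simp
  have comb: "\<alpha> * g + \<beta> * a = g'" using \<beta>0 by (simp add: a_def)
  have a2: "a\<^sup>2 = g'\<^sup>2 - g\<^sup>2"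
  proof -
    have "g' - \<alpha> * g = g' * \<beta>\<^sup>2" using g'0 unfolding \<beta>2 by (simp add: \<alpha>_def power2_eq_square field_simps)
    then have "a = g' * \<beta>" using \<beta>0 by (simp add: a_def power2_eq_square)
    then have "a\<^sup>2 = g'\<^sup>2 * \<beta>\<^sup>2" by (simp add: power_mult_distrib)
    also have "\<dots> = g'\<^sup>2 - g\<^sup>2" using g'0 by (simp add: \<beta>2 \<alpha>_def field_simps)
    finally show ?thesis .
  qed
  have v1: "v \<ge> 1" using g2 D(2) by (simp add: v_def)
  then have v0: "v > 0" by simp
  define m where "m = (\<lambda>s::nat\<Rightarrow>real. lincomb n a s 0 s)"
  define p where "p = (\<lambda>z. lincomb n a (e z) 0 (e z))"
  define \<tau> where "\<tau> = (\<lambda>x. (fst (fst x) :: nat \<Rightarrow> real, lincomb n \<alpha> (snd (fst x)) \<beta> (snd x)))"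
  have [measurable]: "m \<in> vec_space n \<rightarrow>\<^sub>M vec_space n" "p \<in> vec_space n \<Otimes>\<^sub>M vec_space n \<rightarrow>\<^sub>M vec_space n"
    "\<tau> \<in> (vec_space n \<Otimes>\<^sub>M vec_space n) \<Otimes>\<^sub>M vec_space n \<rightarrow>\<^sub>M vec_space n \<Otimes>\<^sub>M vec_space n"
    unfolding m_def p_def \<tau>_def by measurable
  define B' where "B' = observe n m p v \<tau> B"
  show [measurable]: "B' \<in> borel_measurable (vec_space n \<Otimes>\<^sub>M (vec_space n \<Otimes>\<^sub>M vec_space n))"
    unfolding B'_def by measurable
  show "(\<integral>\<^sup>+s. ennreal (exp (sqnorm n s / 2)) * exp_neg (B' (s, z)) \<partial>std_normal_vec n)
         \<le> ennreal (K * (exp (- (1 / 2)) * sqrt (1 + (g'\<^sup>2 - g\<^sup>2) * D)) ^ n)"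
    if "z \<in> space (vec_space n \<Otimes>\<^sub>M vec_space n)" for z
    unfolding B'_def v_def[symmetric]
    by (rule observe_bound[where Z = "vec_space n \<Otimes>\<^sub>M vec_space n" and Y = "vec_space n \<Otimes>\<^sub>M vec_space n"])
       (use that v0 K in auto)
  \<comment> \<open>The cost left to the finer level, averaged over the fresh noise. After rotation
    its expectation at \<open>g\<close> is the expectation of \<open>B\<close> at
    \<open>g'\<close>.\<close>
  define B'' where "B'' = (\<lambda>(s, y, t). \<integral>\<^sup>+w. B (s, y, lincomb n \<alpha> t \<beta> (lincomb n 1 (m s) 1 w)) \<partial>std_normal_vec n)"
  have [measurable]: "B'' \<in> borel_measurable (vec_space n \<Otimes>\<^sub>M (vec_space n \<Otimes>\<^sub>M vec_space n))"
    unfolding B''_def by measurable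
  have split: "B' x = ennreal (1 / (2 * v)) * (ennreal (a\<^sup>2) * sqerror n e x + ennreal (real n)) + B'' x"
    if x: "x \<in> space (vec_space n \<Otimes>\<^sub>M (vec_space n \<Otimes>\<^sub>M vec_space n))" for x
  proof -
    obtain s y t where xx: "x = (s, y, t)" by (cases x) auto
    have sp [measurable]: "s \<in> space (vec_space n)" "y \<in> space (vec_space n)" "t \<in> space (vec_space n)"
      using x by (auto simp: xx space_pair_measure)
    have [measurable]: "p (y, t) \<in> space (vec_space n)" "m s \<in> space (vec_space n)"
      by (auto simp: p_def m_def)
    have "B' x = (\<integral>\<^sup>+w. ennreal (sqnorm n (lincomb n 1 (lincomb n 1 (m s) 1 w) (-1) (p (y, t))) / (2 * v)) \<partial>std_normal_vec n) + B'' x"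
      unfolding B'_def xx observe_def Let_def B''_def prod.case \<tau>_def fst_conv snd_conv
      by (subst nn_integral_add) measurable
    also have "sqnorm n (lincomb n 1 (m s) (-1) (p (y, t))) = a\<^sup>2 * sqnorm n (lincomb n 1 s (-1) (e (y, t)))"
      by (auto simp: sqnorm_def m_def p_def sum_distrib_left power2_eq_square algebra_simps intro!: sum.cong)
    then have "(\<integral>\<^sup>+w. ennreal (sqnorm n (lincomb n 1 (lincomb n 1 (m s) 1 w) (-1) (p (y, t))) / (2 * v)) \<partial>std_normal_vec n)
       = ennreal (1 / (2 * v)) * (ennreal (a\<^sup>2) * sqerror n e x + ennreal (real n))"
      by (subst nn_integral_sqnorm_shift_diff[OF v0]) (simp add: sqerror_def xx ennreal_mult')
    finally show ?thesis .
  qed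
  have "sideinfo_expectation n h f g B' = sideinfo_expectation n h f g (\<lambda>x. ennreal (1 / (2 * v)) * (ennreal (a\<^sup>2) * sqerror n e x + ennreal (real n)) + B'' x)"
    unfolding sideinfo_expectation_def
    by (intro nn_integral_cong split) (auto simp: space_pair_measure)
  also have "\<dots> = ennreal (1 / (2 * v)) * (ennreal (a\<^sup>2) * sideinfo_expectation n h f g (sqerror n e) + ennreal (real n)) + sideinfo_expectation n h f g B''"
    by (simp add: sideinfo_expectation_add sideinfo_expectation_cmult)
  also have "\<dots> \<le> ennreal (1 / (2 * v)) * (ennreal (a\<^sup>2) * ennreal (real n * D) + ennreal (real n)) + sideinfo_expectation n h f g B''"
    by (intro add_right_mono mult_left_mono D) auto
  also have "ennreal (1 / (2 * v)) * (ennreal (a\<^sup>2) * ennreal (real n * D) + ennreal (real n)) = ennreal (real n / 2)"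
  proof -
    have "ennreal (1 / (2 * v)) * (ennreal (a\<^sup>2) * ennreal (real n * D) + ennreal (real n)) = ennreal (1 / (2 * v) * (a\<^sup>2 * (real n * D) + real n))"
      using D(2) v0 by (simp only: ennreal_mult'[symmetric] ennreal_plus[symmetric] zero_le_power2 of_nat_0_le_iff mult_nonneg_nonneg zero_le_divide_1_iff add_nonneg_nonneg)
    also have "a\<^sup>2 * (real n * D) + real n = real n * v" unfolding a2 v_def by (simp add: algebra_simps)
    also have "1 / (2 * v) * (real n * v) = real n / 2" using v0 by simp
    finally show ?thesis .
  qed
  also have "sideinfo_expectation n h f g B'' = sideinfo_expectation n h f g' B"
    unfolding sideinfo_expectation_def
  proof (rule nn_integral_cong, rule nn_integral_cong)
    fix s w assume sw: "s \<in> space (std_normal_vec n)" "w \<in> space (std_normal_vec n)"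
    define y where "y = lincomb n h (f s) 1 w"
    have [measurable]: "y \<in> space (vec_space n)" "s \<in> space (vec_space n)" using sw by (auto simp: y_def)
    have eq: "lincomb n \<alpha> (lincomb n g s 1 z) \<beta> (lincomb n 1 (m s) 1 u) = lincomb n g' s 1 (lincomb n \<alpha> z \<beta> u)" for z u
      by (rule vec_space_eqI[of _ n]) (auto simp: m_def comb[symmetric] algebra_simps)
    have [measurable]: "(\<lambda>x. B (s, y, lincomb n g' s 1 x)) \<in> borel_measurable (vec_space n)"
      by measurable
    show "(\<integral>\<^sup>+z. B'' (s, lincomb n h (f s) 1 w, lincomb n g s 1 z) \<partial>std_normal_vec n)
       = (\<integral>\<^sup>+z. B (s, lincomb n h (f s) 1 w, lincomb n g' s 1 z) \<partial>std_normal_vec n)"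
      unfolding B''_def prod.case eq y_def[symmetric]
      by (rule nn_integral_std_normal_vec_rotate[OF \<alpha>\<beta>, where G = "\<lambda>x. B (s, y, lincomb n g' s 1 x)"]) measurable
  qed
  finally show "sideinfo_expectation n h f g B' \<le> ennreal (real n / 2) + sideinfo_expectation n h f g' B" .
qed

text \<open>For uncoded transmission the product telescopes and equality holds.\<close>

theorem gaussian_sideinfo_converse:
  fixes g D :: "nat \<Rightarrow> real" and h :: real
  assumes n: "n > 0"
    and f [measurable]: "f \<in> vec_space n \<rightarrow>\<^sub>M vec_space n"
    and pow: "(\<integral>\<^sup>+s. ennreal (sqnorm n (f s)) \<partial>std_normal_vec n) \<le> ennreal (real n)"
    and e: "\<And>j. j \<le> K \<Longrightarrow> e j \<in> vec_space n \<Otimes>\<^sub>M vec_space n \<rightarrow>\<^sub>M vec_space n"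
    and D: "\<And>j. j \<le> K \<Longrightarrow> sideinfo_expectation n h f (g j) (sqerror n (e j)) \<le> ennreal (real n * D j)"
    and D0: "\<And>j. j \<le> K \<Longrightarrow> D j > 0"
    and g0: "g 0 = 0" and g: "\<And>j. j < K \<Longrightarrow> \<bar>g j\<bar> < \<bar>g (Suc j)\<bar>"
  shows "1 \<le> (1 + h\<^sup>2) * D K * (\<Prod>j<K. 1 + ((g (Suc j))\<^sup>2 - (g j)\<^sup>2) * D j)"
proof -
  let ?\<mu> = "std_normal_vec n"
  define v where "v j = 1 + ((g (Suc j))\<^sup>2 - (g j)\<^sup>2) * D j" for j
  \<comment> \<open>Mass bound once the levels \<open>j\<close> to \<open>K - 1\<close> have been
    processed: \<open>sqrt (D K) ^ n\<close> comes from predicting the source itself, and each level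
    multiplies by the factor of \<open>observe_bound\<close>.\<close>
  define c where "c j = sqrt (D K) ^ n * (\<Prod>i\<in>{j..<K}. (exp (- (1 / 2)) * sqrt (v i)) ^ n)" for j
  have v1: "v j \<ge> 1" if "j < K" for j
    using power_strict_mono[OF g[OF that], of 2] D0[of j] that by (simp add: v_def)
  have c0: "c j \<ge> 0" for j
    unfolding c_def using v1 D0[of K]
    by (intro mult_nonneg_nonneg prod_nonneg zero_le_power ballI)
       (auto intro!: zero_le_power mult_nonneg_nonneg intro: order_trans[OF zero_le_one])
  \<comment> \<open>\<open>B\<close> is the expected quadratic cost of the predictions still to
    come. Each of them accounts for at most n / 2, and from level \<open>j\<close> on there are
    \<open>K - j + 1\<close>, counting the final prediction of the source.\<close>
  define Q where "Q j B \<longleftrightarrow> B \<in> borel_measurable (vec_space n \<Otimes>\<^sub>M (vec_space n \<Otimes>\<^sub>M vec_space n)) \<and>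
     (\<forall>z \<in> space (vec_space n \<Otimes>\<^sub>M vec_space n).
       (\<integral>\<^sup>+s. ennreal (exp (sqnorm n s / 2)) * exp_neg (B (s, z)) \<partial>?\<mu>) \<le> ennreal (c j)) \<and>
     sideinfo_expectation n h f (g j) B \<le> ennreal (real n / 2 * (real (K - j) + 1))" for j B
  have base: "\<exists>B. Q K B"
  proof
    note e[of K, simplified, measurable]
    \<comment> \<open>At the finest level nothing is left to observe, so the source is predicted
      directly, with the estimate as mean and \<open>D K\<close> as variance.\<close>
    let ?B = "\<lambda>x. ennreal (1 / (2 * D K)) * sqerror n (e K) x"
    have DK: "D K > 0" using D0 by simp
    have m: "?B \<in> borel_measurable (vec_space n \<Otimes>\<^sub>M (vec_space n \<Otimes>\<^sub>M vec_space n))"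
      by measurable
    have b: "?B (s, z) = ennreal (sqnorm n (lincomb n 1 s (-1) (e K z)) / (2 * D K))" for s z
      unfolding sqerror_def prod.case using DK by (subst ennreal_mult'[symmetric]) auto
    have "sideinfo_expectation n h f (g K) ?B = ennreal (1 / (2 * D K)) * sideinfo_expectation n h f (g K) (sqerror n (e K))"
      by (rule sideinfo_expectation_cmult) measurable
    also have "\<dots> \<le> ennreal (1 / (2 * D K)) * ennreal (real n * D K)"
      by (intro mult_left_mono D) auto
    also have "\<dots> = ennreal (real n / 2)"
      using DK by (subst ennreal_mult'[symmetric]) auto
    finally have E: "sideinfo_expectation n h f (g K) ?B \<le> ennreal (real n / 2 * (real (K - K) + 1))" by simp
    have "(\<integral>\<^sup>+s. ennreal (exp (sqnorm n s / 2)) * exp_neg (?B (s, z)) \<partial>?\<mu>) = ennreal (c K)" for z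
    proof -
      have "(\<integral>\<^sup>+s. ennreal (exp (sqnorm n s / 2)) * exp_neg (?B (s, z)) \<partial>?\<mu>)
          = (\<integral>\<^sup>+s. ennreal (exp (sqnorm n s / 2) * exp (- (sqnorm n (lincomb n 1 s (-1) (e K z)) / (2 * D K)))) \<partial>?\<mu>)"
        unfolding b using DK by (intro nn_integral_cong) (simp add: ennreal_mult'[symmetric])
      then show ?thesis by (simp add: nn_integral_exp_quadratic_std_normal_vec[OF DK] c_def)
    qed
    then show "Q K ?B" unfolding Q_def using E m by simp
  qed
  have "\<exists>B. Q 0 B"
  proof (rule inc_induct[of 0 K "\<lambda>j. \<exists>B. Q j B"])
    fix j assume j: "j < K" and "\<exists>B. Q (Suc j) B"
    then obtain B where B [measurable]: "B \<in> borel_measurable (vec_space n \<Otimes>\<^sub>M (vec_space n \<Otimes>\<^sub>M vec_space n))"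
      and BK: "\<And>z. z \<in> space (vec_space n \<Otimes>\<^sub>M vec_space n) \<Longrightarrow>
       (\<integral>\<^sup>+s. ennreal (exp (sqnorm n s / 2)) * exp_neg (B (s, z)) \<partial>?\<mu>) \<le> ennreal (c (Suc j))"
      and BE: "sideinfo_expectation n h f (g (Suc j)) B \<le> ennreal (real n / 2 * (real (K - Suc j) + 1))"
      unfolding Q_def by blast
    have DD: "sideinfo_expectation n h f (g j) (sqerror n (e j)) \<le> ennreal (real n * D j)" "D j \<ge> 0"
      using D[of j] D0[of j] j by auto
    obtain B' where B': "B' \<in> borel_measurable (vec_space n \<Otimes>\<^sub>M (vec_space n \<Otimes>\<^sub>M vec_space n))"
      and BK': "\<And>z. z \<in> space (vec_space n \<Otimes>\<^sub>M vec_space n) \<Longrightarrow>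
       (\<integral>\<^sup>+s. ennreal (exp (sqnorm n s / 2)) * exp_neg (B' (s, z)) \<partial>?\<mu>)
         \<le> ennreal (c (Suc j) * (exp (- (1 / 2)) * sqrt (1 + ((g (Suc j))\<^sup>2 - (g j)\<^sup>2) * D j)) ^ n)"
      and BE': "sideinfo_expectation n h f (g j) B' \<le> ennreal (real n / 2) + sideinfo_expectation n h f (g (Suc j)) B"
      by (rule sideinfo_step[OF f e[OF less_imp_le[OF j]] B BK c0 g[OF j] DD]) blast+
    have cj: "c (Suc j) * (exp (- (1 / 2)) * sqrt (1 + ((g (Suc j))\<^sup>2 - (g j)\<^sup>2) * D j)) ^ n = c j"
      using j unfolding c_def v_def[symmetric] by (simp add: prod.atLeast_Suc_lessThan mult_ac)
    have "ennreal (real n / 2) + sideinfo_expectation n h f (g (Suc j)) B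
        \<le> ennreal (real n / 2) + ennreal (real n / 2 * (real (K - Suc j) + 1))"
      by (intro add_left_mono BE)
    also have "\<dots> = ennreal (real n / 2 + real n / 2 * (real (K - Suc j) + 1))"
      by (subst ennreal_plus) auto
    also have "real n / 2 + real n / 2 * (real (K - Suc j) + 1) = real n / 2 * (real (K - j) + 1)"
    proof -
      have "real (K - j) = real (K - Suc j) + 1" using j by (simp add: of_nat_diff)
      then show ?thesis by (simp only: distrib_left mult_1_right add_ac)
    qed
    finally have "sideinfo_expectation n h f (g j) B' \<le> ennreal (real n / 2 * (real (K - j) + 1))"
      using BE' by (rule order_trans[rotated])
    then show "\<exists>B. Q j B" unfolding Q_def using B' BK' cj by auto
  qed (use base in auto)
  then obtain B where B [measurable]: "B \<in> borel_measurable (vec_space n \<Otimes>\<^sub>M (vec_space n \<Otimes>\<^sub>M vec_space n))"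
    and BK: "\<And>z. z \<in> space (vec_space n \<Otimes>\<^sub>M vec_space n) \<Longrightarrow>
       (\<integral>\<^sup>+s. ennreal (exp (sqnorm n s / 2)) * exp_neg (B (s, z)) \<partial>?\<mu>) \<le> ennreal (c 0)"
    and BE: "sideinfo_expectation n h f (g 0) B \<le> ennreal (real n / 2 * (real K + 1))"
    unfolding Q_def by auto
  \<comment> \<open>The channel output is the very first observation. Before it the state is only
    side information of amplitude \<open>g 0 = 0\<close>, that is, the pure noise \<open>t\<close>;
    hence the prediction is 0.\<close>
  define m where "m = (\<lambda>s. lincomb n h (f s) 0 (f s))"
  define p where "p = (\<lambda>_::nat\<Rightarrow>real. restrict (\<lambda>_. 0::real) {..<n})"
  define \<tau> where "\<tau> = (\<lambda>(t::nat\<Rightarrow>real, u::nat\<Rightarrow>real). (u, t))"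
  have [measurable]: "m \<in> vec_space n \<rightarrow>\<^sub>M vec_space n" "p \<in> vec_space n \<rightarrow>\<^sub>M vec_space n"
    "\<tau> \<in> vec_space n \<Otimes>\<^sub>M vec_space n \<rightarrow>\<^sub>M vec_space n \<Otimes>\<^sub>M vec_space n"
    unfolding m_def p_def \<tau>_def by measurable
  \<comment> \<open>By the power constraint \<open>1 + h\<^sup>2\<close> bounds the mean power of
    the channel output per letter, so this prediction again costs at most n / 2.\<close>
  define w where "w = 1 + h\<^sup>2"
  have w0: "w > 0" by (simp add: w_def add_pos_nonneg)
  define B' where "B' = observe n m p w \<tau> B"
  have [measurable]: "B' \<in> borel_measurable (vec_space n \<Otimes>\<^sub>M vec_space n)"
    unfolding B'_def by measurable
  have fin: "(\<integral>\<^sup>+s. ennreal (exp (sqnorm n s / 2)) * exp_neg (B' (s, t)) \<partial>?\<mu>)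
     \<le> ennreal (c 0 * (exp (- (1 / 2)) * sqrt w) ^ n)" if "t \<in> space (vec_space n)" for t
    unfolding B'_def
    by (rule observe_bound[where Z = "vec_space n" and Y = "vec_space n \<Otimes>\<^sub>M vec_space n"])
       (use that w0 c0 BK in auto)
  have split: "B' (s, t) = ennreal (1 / (2 * w)) * (ennreal (h\<^sup>2) * ennreal (sqnorm n (f s)) + ennreal (real n))
      + (\<integral>\<^sup>+u. B (s, lincomb n h (f s) 1 u, t) \<partial>?\<mu>)"
    if st [measurable]: "s \<in> space (vec_space n)" "t \<in> space (vec_space n)" for s t
  proof -
    have [measurable]: "m s \<in> space (vec_space n)" "p t \<in> space (vec_space n)" "f s \<in> space (vec_space n)"
      using st by (auto simp: m_def p_def intro: measurable_space[OF f])
    have l: "lincomb n 1 (m s) 1 u = lincomb n h (f s) 1 u" for u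
      by (rule vec_space_eqI[of _ n]) (auto simp: m_def)
    have "B' (s, t) = (\<integral>\<^sup>+u. ennreal (sqnorm n (lincomb n 1 (lincomb n 1 (m s) 1 u) (-1) (p t)) / (2 * w)) \<partial>?\<mu>)
        + (\<integral>\<^sup>+u. B (s, lincomb n h (f s) 1 u, t) \<partial>?\<mu>)"
      unfolding B'_def observe_def Let_def prod.case \<tau>_def l[symmetric]
      by (subst nn_integral_add) measurable
    also have "sqnorm n (lincomb n 1 (m s) (-1) (p t)) = h\<^sup>2 * sqnorm n (f s)"
      by (auto simp: sqnorm_def m_def p_def sum_distrib_left power2_eq_square algebra_simps intro!: sum.cong)
    then have "(\<integral>\<^sup>+u. ennreal (sqnorm n (lincomb n 1 (lincomb n 1 (m s) 1 u) (-1) (p t)) / (2 * w)) \<partial>?\<mu>)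
       = ennreal (1 / (2 * w)) * (ennreal (h\<^sup>2) * ennreal (sqnorm n (f s)) + ennreal (real n))"
      by (subst nn_integral_sqnorm_shift_diff[OF w0]) (simp add: ennreal_mult')
    finally show ?thesis .
  qed
  interpret pair_sigma_finite ?\<mu> ?\<mu> ..
  interpret P: pair_prob_space ?\<mu> ?\<mu> ..
  have "(\<integral>\<^sup>+s. \<integral>\<^sup>+t. B' (s, t) \<partial>?\<mu> \<partial>?\<mu>)
     = (\<integral>\<^sup>+s. (\<integral>\<^sup>+t. ennreal (1 / (2 * w)) * (ennreal (h\<^sup>2) * ennreal (sqnorm n (f s)) + ennreal (real n))
         + (\<integral>\<^sup>+u. B (s, lincomb n h (f s) 1 u, t) \<partial>?\<mu>) \<partial>?\<mu>) \<partial>?\<mu>)"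
    by (intro nn_integral_cong split) auto
  also have "\<dots> = (\<integral>\<^sup>+s. ennreal (1 / (2 * w)) * (ennreal (h\<^sup>2) * ennreal (sqnorm n (f s)) + ennreal (real n))
         + (\<integral>\<^sup>+t. \<integral>\<^sup>+u. B (s, lincomb n h (f s) 1 u, t) \<partial>?\<mu> \<partial>?\<mu>) \<partial>?\<mu>)"
    by (intro nn_integral_cong, subst nn_integral_add) auto
  also have "\<dots> = (\<integral>\<^sup>+s. ennreal (1 / (2 * w)) * (ennreal (h\<^sup>2) * ennreal (sqnorm n (f s)) + ennreal (real n)) \<partial>?\<mu>)
      + (\<integral>\<^sup>+s. \<integral>\<^sup>+t. \<integral>\<^sup>+u. B (s, lincomb n h (f s) 1 u, t) \<partial>?\<mu> \<partial>?\<mu> \<partial>?\<mu>)"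
    by (subst nn_integral_add) measurable
  also have "(\<integral>\<^sup>+s. \<integral>\<^sup>+t. \<integral>\<^sup>+u. B (s, lincomb n h (f s) 1 u, t) \<partial>?\<mu> \<partial>?\<mu> \<partial>?\<mu>) = sideinfo_expectation n h f (g 0) B"
    unfolding sideinfo_expectation_def
  proof (rule nn_integral_cong)
    fix s assume "s \<in> space ?\<mu>"
    then have [measurable]: "s \<in> space (vec_space n)" by simp
    have "(\<integral>\<^sup>+t. \<integral>\<^sup>+u. B (s, lincomb n h (f s) 1 u, t) \<partial>?\<mu> \<partial>?\<mu>) = (\<integral>\<^sup>+u. \<integral>\<^sup>+t. B (s, lincomb n h (f s) 1 u, t) \<partial>?\<mu> \<partial>?\<mu>)"
      by (rule Fubini') measurable
    also have "\<dots> = (\<integral>\<^sup>+u. \<integral>\<^sup>+t. B (s, lincomb n h (f s) 1 u, lincomb n (g 0) s 1 t) \<partial>?\<mu> \<partial>?\<mu>)"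
      by (intro nn_integral_cong arg_cong[where f=B] arg_cong[where f="Pair _"] vec_space_eqI[of _ n]) (auto simp: g0)
    finally show "(\<integral>\<^sup>+t. \<integral>\<^sup>+u. B (s, lincomb n h (f s) 1 u, t) \<partial>?\<mu> \<partial>?\<mu>) = \<dots>" .
  qed
  also have "(\<integral>\<^sup>+s. ennreal (1 / (2 * w)) * (ennreal (h\<^sup>2) * ennreal (sqnorm n (f s)) + ennreal (real n)) \<partial>?\<mu>)
     = ennreal (1 / (2 * w)) * (ennreal (h\<^sup>2) * (\<integral>\<^sup>+s. ennreal (sqnorm n (f s)) \<partial>?\<mu>) + ennreal (real n))"
    by (simp add: nn_integral_cmult nn_integral_add)
  also have "\<dots> + sideinfo_expectation n h f (g 0) B \<le>
     ennreal (1 / (2 * w)) * (ennreal (h\<^sup>2) * ennreal (real n) + ennreal (real n)) + ennreal (real n / 2 * (real K + 1))"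
    by (intro add_mono mult_left_mono pow BE order_refl) auto
  also have "ennreal (1 / (2 * w)) * (ennreal (h\<^sup>2) * ennreal (real n) + ennreal (real n)) = ennreal (real n / 2)"
  proof -
    have "ennreal (h\<^sup>2) * ennreal (real n) + ennreal (real n) = ennreal (real n * w)"
      by (subst ennreal_mult'[symmetric], simp, subst ennreal_plus[symmetric], auto simp: w_def algebra_simps)
    then show ?thesis using w0 by (simp add: ennreal_mult''[symmetric])
  qed
  also have "ennreal (real n / 2) + ennreal (real n / 2 * (real K + 1)) = ennreal (real n / 2 * (real K + 2))"
    by (subst ennreal_plus[symmetric], simp, simp, rule arg_cong[where f = ennreal]) (simp add: field_simps)
  finally have EB: "(\<integral>\<^sup>+s. \<integral>\<^sup>+t. B' (s, t) \<partial>?\<mu> \<partial>?\<mu>) \<le> ennreal (real n / 2 * (real K + 2))" .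
  have half: "(\<integral>\<^sup>+x. ennreal (sqnorm n (fst x) / 2) \<partial>(?\<mu> \<Otimes>\<^sub>M ?\<mu>)) = ennreal (real n / 2)"
  proof -
    have "(\<integral>\<^sup>+x. ennreal (sqnorm n (fst x) / 2) \<partial>(?\<mu> \<Otimes>\<^sub>M ?\<mu>)) = (\<integral>\<^sup>+s. \<integral>\<^sup>+t. ennreal (1/2) * ennreal (sqnorm n s) \<partial>?\<mu> \<partial>?\<mu>)"
      by (subst std_normal_vec.nn_integral_fst[symmetric], measurable, intro nn_integral_cong, subst ennreal_mult'[symmetric]) auto
    also have "\<dots> = ennreal (1/2) * ennreal (real n)"
      by (simp add: nn_integral_cmult nn_integral_sqnorm)
    finally show ?thesis by (subst (asm) ennreal_mult'[symmetric]) auto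
  qed
  have sqrt_prod: "sqrt (\<Prod>i<k. v i) = (\<Prod>i<k. sqrt (v i))" for k
    by (induction k) (auto simp: real_sqrt_mult)
  \<comment> \<open>One last Jensen step over \<open>(s, t)\<close>, with the weight of the source.
    The factors \<open>exp (- (1 / 2))\<close> match: \<open>K + 2\<close> predictions less one for
    the weight on the left, \<open>K + 1\<close> observations on the right.\<close>
  have "ennreal (exp (real n / 2)) * ennreal (exp (- (real n / 2 * (real K + 2))))
     = ennreal (exp (real n / 2)) * exp_neg (ennreal (real n / 2 * (real K + 2)))" by simp
  also have "\<dots> \<le> ennreal (exp (real n / 2)) * exp_neg (\<integral>\<^sup>+x. B' x \<partial>(?\<mu> \<Otimes>\<^sub>M ?\<mu>))"
    by (intro mult_left_mono exp_neg_antimono) (use EB in \<open>auto simp: std_normal_vec.nn_integral_fst\<close>)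
  also have "\<dots> \<le> (\<integral>\<^sup>+x. ennreal (exp (sqnorm n (fst x) / 2)) * exp_neg (B' x) \<partial>(?\<mu> \<Otimes>\<^sub>M ?\<mu>))"
    by (rule P.P.jensen_exp_neg) (auto simp: half)
  also have "\<dots> = (\<integral>\<^sup>+t. \<integral>\<^sup>+s. ennreal (exp (sqnorm n s / 2)) * exp_neg (B' (s, t)) \<partial>?\<mu> \<partial>?\<mu>)"
    by (subst nn_integral_snd[symmetric]) auto
  also have "\<dots> \<le> (\<integral>\<^sup>+t. ennreal (c 0 * (exp (- (1 / 2)) * sqrt w) ^ n) \<partial>?\<mu>)"
    by (intro nn_integral_mono fin) simp
  also have "\<dots> = ennreal (c 0 * (exp (- (1 / 2)) * sqrt w) ^ n)" by simp
  finally have "exp (real n / 2) * exp (- (real n / 2 * (real K + 2))) \<le> c 0 * (exp (- (1 / 2)) * sqrt w) ^ n"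
    using c0 w0 by (subst (asm) ennreal_mult'[symmetric]) (auto simp: ennreal_le_iff)
  also have "exp (real n / 2) * exp (- (real n / 2 * (real K + 2))) = (exp (- (1/2)) ^ (K + 1)) ^ n"
    by (simp add: exp_add[symmetric] exp_of_nat_mult[symmetric] algebra_simps flip: power_mult)
  also have "c 0 * (exp (- (1 / 2)) * sqrt w) ^ n = (sqrt (D K) * (\<Prod>i<K. exp (- (1 / 2)) * sqrt (v i)) * (exp (- (1 / 2)) * sqrt w)) ^ n"
    by (simp add: c_def power_mult_distrib prod_power_distrib atLeast0LessThan)
  also have "sqrt (D K) * (\<Prod>i<K. exp (- (1 / 2)) * sqrt (v i)) * (exp (- (1 / 2)) * sqrt w)
      = exp (- (1/2)) ^ (K + 1) * sqrt (w * D K * (\<Prod>i<K. v i))"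
    by (simp add: prod.distrib real_sqrt_mult sqrt_prod mult_ac)
  also have "\<dots> ^ n = (exp (- (1/2)) ^ (K + 1)) ^ n * sqrt (w * D K * (\<Prod>i<K. v i)) ^ n"
    by (rule power_mult_distrib)
  finally have "1 \<le> sqrt (w * D K * (\<Prod>i<K. v i)) ^ n"
    by simp
  then have "1 \<le> sqrt (w * D K * (\<Prod>i<K. v i))"
  proof (rule contrapos_pp)
    assume "\<not> 1 \<le> sqrt (w * D K * (\<Prod>i<K. v i))"
    moreover have "0 \<le> w * D K * (\<Prod>i<K. v i)"
      using w0 D0[of K] v1 by (intro mult_nonneg_nonneg prod_nonneg) (auto intro: order_trans[OF zero_le_one])
    ultimately show "\<not> 1 \<le> sqrt (w * D K * (\<Prod>i<K. v i)) ^ n"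
      using n power_strict_mono[of "sqrt (w * D K * (\<Prod>i<K. v i))" 1 n] by auto
  qed
  then show ?thesis unfolding w_def v_def by simp
qed

section \<open>Concatenation of codes and existence of the limit\<close>

lemma fekete:
  fixes a :: "nat \<Rightarrow> real"
  assumes a0: "\<And>n. 0 \<le> a n" and sub: "\<And>m n. a (m + n) \<le> a m + a n"
  obtains L where "(\<lambda>n. a n / real n) \<longlonglongrightarrow> L" and "\<And>n. n \<ge> 1 \<Longrightarrow> L \<le> a n / real n"
proof
  define S where "S = (\<lambda>n. a n / real n) ` {1..}"
  have bdd: "bdd_below S" unfolding S_def by (rule bdd_belowI2[where m = 0]) (auto simp: a0)
  have ne: "S \<noteq> {}" by (auto simp: S_def)
  show low: "Inf S \<le> a n / real n" if "n \<ge> 1" for n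
    using that by (intro cInf_lower bdd) (auto simp: S_def)
  have mult: "a (q * k + r) \<le> real q * a k + a r" for q k r
  proof (induction q)
    case (Suc q)
    have "a (Suc q * k + r) = a (k + (q * k + r))" by (simp add: ac_simps)
    also have "\<dots> \<le> a k + a (q * k + r)" by (rule sub)
    finally show ?case using Suc by (simp add: algebra_simps)
  qed simp
  show "(\<lambda>n. a n / real n) \<longlonglongrightarrow> Inf S"
  proof (rule LIMSEQ_I)
    fix e :: real assume e: "e > 0"
    have "\<exists>x\<in>S. x < Inf S + e / 2" using ne bdd e by (intro cInf_lessD) auto
    then obtain k where k: "k \<ge> 1" "a k / real k < Inf S + e / 2" by (auto simp: S_def)
    define C where "C = (\<Sum>i<k. a i)"
    have C: "a r \<le> C" if "r < k" for r
      unfolding C_def using that a0 by (intro member_le_sum) auto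
    have C0: "C \<ge> 0" unfolding C_def by (intro sum_nonneg a0)
    obtain N :: nat where N: "2 * C / e < real N" using reals_Archimedean2 by blast
    show "\<exists>no. \<forall>n\<ge>no. norm (a n / real n - Inf S) < e"
    proof (intro exI allI impI)
      fix n assume n: "n \<ge> Suc N"
      then have n0: "real n > 0" by simp
      have "a n = a ((n div k) * k + n mod k)" by simp
      also have "\<dots> \<le> real (n div k) * a k + a (n mod k)" by (rule mult)
      also have "\<dots> \<le> real (n div k) * a k + C" using k by (intro add_left_mono C) simp
      also have "real (n div k) * a k = real (n div k * k) * (a k / real k)" using k by simp
      also have "\<dots> \<le> real n * (a k / real k)"
        using a0[of k] by (intro mult_right_mono) (auto simp: of_nat_le_iff simp del: of_nat_mult)
      finally have "a n \<le> real n * (a k / real k) + C" by simp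
      then have "a n / real n \<le> a k / real k + C / real n" using n0 by (simp add: field_simps)
      moreover have "C / real n < e / 2"
      proof -
        have "2 * C / e < real n" using N n by linarith
        then show ?thesis using e n0 by (simp add: field_simps)
      qed
      moreover have "Inf S \<le> a n / real n" using n by (intro low) auto
      ultimately show "norm (a n / real n - Inf S) < e" using k(2) unfolding real_norm_def by linarith
    qed
  qed
qed

definition decoder_at :: "((nat \<Rightarrow> real) \<times> (nat \<Rightarrow> real) \<times> real \<times> real \<Rightarrow> (nat \<Rightarrow> real)) \<Rightarrow> real \<Rightarrow> real \<Rightarrow>
   (nat \<Rightarrow> real) \<times> (nat \<Rightarrow> real) \<Rightarrow> (nat \<Rightarrow> real)" where
  "decoder_at d h g = (\<lambda>(y, t). d (y, t, h, g))"

text \<open>Summed over letters, so that concatenation adds it, and with the fading integrals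
  outermost, so that the converse can select fading states one at a time.\<close>

definition total_distortion ::
  "nat \<Rightarrow> real \<Rightarrow> real measure \<Rightarrow> real measure \<Rightarrow> ((nat \<Rightarrow> real) \<Rightarrow> (nat \<Rightarrow> real)) \<Rightarrow>
   ((nat \<Rightarrow> real) \<times> (nat \<Rightarrow> real) \<times> real \<times> real \<Rightarrow> (nat \<Rightarrow> real)) \<Rightarrow> ennreal" where
  "total_distortion n \<rho> \<mu>h \<mu>g f d = (\<integral>\<^sup>+h. \<integral>\<^sup>+g.
     sideinfo_expectation n (sqrt \<rho> * h) f (sqrt \<rho> * g) (sqerror n (decoder_at d (sqrt \<rho> * h) (sqrt \<rho> * g))) \<partial>\<mu>g \<partial>\<mu>h)"

lemma measurable_decoder_at [measurable]:
  assumes "admissible_decoder n d"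
  shows "decoder_at d h g \<in> vec_space n \<Otimes>\<^sub>M vec_space n \<rightarrow>\<^sub>M vec_space n"
proof -
  have [measurable]: "d \<in> vec_space n \<Otimes>\<^sub>M (vec_space n \<Otimes>\<^sub>M (borel \<Otimes>\<^sub>M borel)) \<rightarrow>\<^sub>M vec_space n"
    using assms by (simp add: admissible_decoder_def dec_input_space_def)
  show ?thesis unfolding decoder_at_def split_beta' by measurable
qed

lemma measurable_conditional_distortion:
  assumes f [measurable]: "f \<in> vec_space n \<rightarrow>\<^sub>M vec_space n" and d: "admissible_decoder n d"
  shows "(\<lambda>x. sideinfo_expectation n (c * fst x) f (c * snd x) (sqerror n (decoder_at d (c * fst x) (c * snd x))))
    \<in> borel_measurable (borel \<Otimes>\<^sub>M borel)"
proof -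
  have [measurable]: "d \<in> vec_space n \<Otimes>\<^sub>M (vec_space n \<Otimes>\<^sub>M (borel \<Otimes>\<^sub>M borel)) \<rightarrow>\<^sub>M vec_space n"
    using d by (simp add: admissible_decoder_def dec_input_space_def)
  show ?thesis
    unfolding sideinfo_expectation_def sqerror_def decoder_at_def prod.case
    by measurable
qed

lemma expected_distortion_eq_total:
  assumes f: "admissible_encoder n f" and d: "admissible_decoder n d"
    and h: "prob_space \<mu>h" "sets \<mu>h = sets borel" and g: "prob_space \<mu>g" "sets \<mu>g = sets borel"
  shows "expected_distortion n \<rho> \<mu>h \<mu>g f d = ennreal (1 / real n) * total_distortion n \<rho> \<mu>h \<mu>g f d"
proof -
  let ?\<mu> = "std_normal_vec n"
  note [measurable_cong] = h(2) g(2)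
  interpret H: prob_space \<mu>h by fact
  interpret G: prob_space \<mu>g by fact
  interpret HG: pair_prob_space \<mu>h \<mu>g ..
  have f' [measurable]: "f \<in> vec_space n \<rightarrow>\<^sub>M vec_space n" using f by (simp add: admissible_encoder_def)
  have [measurable]: "d \<in> vec_space n \<Otimes>\<^sub>M (vec_space n \<Otimes>\<^sub>M (borel \<Otimes>\<^sub>M borel)) \<rightarrow>\<^sub>M vec_space n"
    using d by (simp add: admissible_decoder_def dec_input_space_def)
  interpret p0: pair_prob_space ?\<mu> "\<mu>h \<Otimes>\<^sub>M \<mu>g" ..
  interpret p1: pair_prob_space ?\<mu> "?\<mu> \<Otimes>\<^sub>M (\<mu>h \<Otimes>\<^sub>M \<mu>g)" ..
  interpret p2: pair_prob_space ?\<mu> "?\<mu> \<Otimes>\<^sub>M (?\<mu> \<Otimes>\<^sub>M (\<mu>h \<Otimes>\<^sub>M \<mu>g))" ..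
  define F where "F s w z x = (sqerror n (decoder_at d (sqrt \<rho> * fst x) (sqrt \<rho> * snd x))
     (s, lincomb n (sqrt \<rho> * fst x) (f s) 1 w, lincomb n (sqrt \<rho> * snd x) s 1 z))" for s w z x
  have [measurable]: "(\<lambda>(s, w, z, x). F s w z x) \<in> borel_measurable (vec_space n \<Otimes>\<^sub>M (vec_space n \<Otimes>\<^sub>M (vec_space n \<Otimes>\<^sub>M (borel \<Otimes>\<^sub>M borel))))"
    unfolding F_def sqerror_def decoder_at_def prod.case split_beta' by measurable
  have [measurable (raw)]: "(\<lambda>x. F (a x) (b x) (c x) (e x)) \<in> borel_measurable M"
    if [measurable]: "a \<in> M \<rightarrow>\<^sub>M vec_space n" "b \<in> M \<rightarrow>\<^sub>M vec_space n" "c \<in> M \<rightarrow>\<^sub>M vec_space n" "e \<in> M \<rightarrow>\<^sub>M borel \<Otimes>\<^sub>M borel"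
    for a b c e and M :: "'m measure"
    using measurable_compose[OF _ \<open>(\<lambda>(s, w, z, x). F s w z x) \<in> _\<close>, of "\<lambda>x. (a x, b x, c x, e x)" M] by simp
  have y: "restrict (\<lambda>i. c * x i + w i) {..<n} = lincomb n c x 1 w" for c and x w :: "nat \<Rightarrow> real"
    by (simp add: lincomb_def)
  have eq: "ennreal (1 / real n * (\<Sum>i<n. (s i - u i)\<^sup>2)) = ennreal (1 / real n) * ennreal (sqnorm n (lincomb n 1 s (-1) u))" for s u
    by (subst ennreal_mult'[symmetric]) (auto simp: sqnorm_def)
  have "expected_distortion n \<rho> \<mu>h \<mu>g f d =
    (\<integral>\<^sup>+(s, w, z, x). ennreal (1 / real n) * F s w z x \<partial>(?\<mu> \<Otimes>\<^sub>M (?\<mu> \<Otimes>\<^sub>M (?\<mu> \<Otimes>\<^sub>M (\<mu>h \<Otimes>\<^sub>M \<mu>g)))))"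
    unfolding expected_distortion_def block_space_def Let_def y eq
    by (intro nn_integral_cong) (auto simp: F_def sqerror_def decoder_at_def split: prod.split)
  also have "\<dots> = ennreal (1 / real n) * (\<integral>\<^sup>+(s, w, z, x). F s w z x \<partial>(?\<mu> \<Otimes>\<^sub>M (?\<mu> \<Otimes>\<^sub>M (?\<mu> \<Otimes>\<^sub>M (\<mu>h \<Otimes>\<^sub>M \<mu>g)))))"
    by (subst nn_integral_cmult[symmetric]) (auto simp: split_beta')
  also have "(\<integral>\<^sup>+(s, w, z, x). F s w z x \<partial>(?\<mu> \<Otimes>\<^sub>M (?\<mu> \<Otimes>\<^sub>M (?\<mu> \<Otimes>\<^sub>M (\<mu>h \<Otimes>\<^sub>M \<mu>g)))))
     = (\<integral>\<^sup>+s. \<integral>\<^sup>+w. \<integral>\<^sup>+z. \<integral>\<^sup>+x. F s w z x \<partial>(\<mu>h \<Otimes>\<^sub>M \<mu>g) \<partial>?\<mu> \<partial>?\<mu> \<partial>?\<mu>)"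
    apply (subst p1.P.nn_integral_fst[symmetric], measurable)
    apply (rule nn_integral_cong)
    apply (subst p0.P.nn_integral_fst[symmetric], simp, measurable)
    apply (rule nn_integral_cong)
    apply (subst HG.P.nn_integral_fst[symmetric], simp, measurable)
    done
  also have "\<dots> = (\<integral>\<^sup>+s. \<integral>\<^sup>+w. \<integral>\<^sup>+x. \<integral>\<^sup>+z. F s w z x \<partial>?\<mu> \<partial>(\<mu>h \<Otimes>\<^sub>M \<mu>g) \<partial>?\<mu> \<partial>?\<mu>)"
    by (rule nn_integral_cong, rule nn_integral_cong, rule p0.Fubini'[symmetric]) measurable
  also have "\<dots> = (\<integral>\<^sup>+s. \<integral>\<^sup>+x. \<integral>\<^sup>+w. \<integral>\<^sup>+z. F s w z x \<partial>?\<mu> \<partial>?\<mu> \<partial>(\<mu>h \<Otimes>\<^sub>M \<mu>g) \<partial>?\<mu>)"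
    by (rule nn_integral_cong, rule p0.Fubini'[symmetric]) measurable
  also have "\<dots> = (\<integral>\<^sup>+x. \<integral>\<^sup>+s. \<integral>\<^sup>+w. \<integral>\<^sup>+z. F s w z x \<partial>?\<mu> \<partial>?\<mu> \<partial>?\<mu> \<partial>(\<mu>h \<Otimes>\<^sub>M \<mu>g))"
    by (rule p0.Fubini'[symmetric]) measurable
  also have "\<dots> = total_distortion n \<rho> \<mu>h \<mu>g f d"
    unfolding total_distortion_def
    using measurable_conditional_distortion[OF f' d, of "sqrt \<rho>"]
    by (subst G.nn_integral_fst[symmetric]) (auto simp: F_def sideinfo_expectation_def)
  finally show ?thesis .
qed

section \<open>Cutting blocks into sub-blocks and joining codes\<close>

definition pick :: "nat \<Rightarrow> nat \<Rightarrow> (nat \<Rightarrow> real) \<Rightarrow> (nat \<Rightarrow> real)" where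
  "pick n k x = restrict (\<lambda>i. x (k + i)) {..<n}"

definition join :: "nat \<Rightarrow> nat \<Rightarrow> (nat \<Rightarrow> real) \<Rightarrow> (nat \<Rightarrow> real) \<Rightarrow> (nat \<Rightarrow> real)" where
  "join n m u v = restrict (\<lambda>i. if i < n then u i else v (i - n)) {..<n + m}"

lemma pick_in_space [simp]: "pick n k x \<in> space (vec_space n)"
  by (simp add: pick_def)

lemma measurable_pick:
  assumes "k + n \<le> N" shows "pick n k \<in> vec_space N \<rightarrow>\<^sub>M vec_space n"
  unfolding pick_def by (rule measurable_vecI) (use assms in \<open>auto intro!: measurable_vec_component\<close>)

lemma measurable_join [measurable (raw)]:
  assumes "u \<in> M \<rightarrow>\<^sub>M vec_space n" "v \<in> M \<rightarrow>\<^sub>M vec_space m"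
  shows "(\<lambda>x. join n m (u x) (v x)) \<in> M \<rightarrow>\<^sub>M vec_space (n + m)"
  unfolding join_def
proof (rule measurable_vecI)
  fix i assume "i < n + m"
  then show "(\<lambda>x. if i < n then u x i else v x (i - n)) \<in> borel_measurable M"
    by (cases "i < n") (auto intro!: measurable_vec_component_compose[OF assms(1)] measurable_vec_component_compose[OF assms(2)])
qed

lemma nn_integral_pick:
  assumes "k + n \<le> N" and [measurable]: "G \<in> borel_measurable (vec_space n)"
  shows "(\<integral>\<^sup>+x. G (pick n k x) \<partial>std_normal_vec N) = (\<integral>\<^sup>+x. G x \<partial>std_normal_vec n)"
proof -
  have "distr (PiM {..<N} (\<lambda>_. std_normal)) (PiM {..<n} (\<lambda>i. std_normal)) (\<lambda>x. \<lambda>i\<in>{..<n}. x (k + i)) = PiM {..<n} (\<lambda>i. std_normal)"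
    by (rule distr_PiM_reindex) (use assms(1) in \<open>auto simp: prob_space_std_normal\<close>)
  then have *: "distr (std_normal_vec N) (std_normal_vec n) (pick n k) = std_normal_vec n"
    by (simp add: std_normal_vec_def pick_def[abs_def])
  have [measurable]: "pick n k \<in> vec_space N \<rightarrow>\<^sub>M vec_space n" by (rule measurable_pick) fact
  show ?thesis by (subst *[symmetric], subst nn_integral_distr) auto
qed

lemma sqnorm_join_pick: "sqnorm (n + m) x = sqnorm n (pick n 0 x) + sqnorm m (pick m n x)"
proof -
  have "(\<Sum>i<n + m. (x i)\<^sup>2) = (\<Sum>i<n. (x i)\<^sup>2) + (\<Sum>i<m. (x (n + i))\<^sup>2)"
    by (induction m) auto
  then show ?thesis by (simp add: sqnorm_def pick_def)
qed

lemma pick_lincomb: "k + n \<le> N \<Longrightarrow> pick n k (lincomb N a x b y) = lincomb n a (pick n k x) b (pick n k y)"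
  by (rule vec_space_eqI[of _ n]) (auto simp: pick_def)

lemma pick_join:
  assumes "u \<in> space (vec_space n)" "v \<in> space (vec_space m)"
  shows "pick n 0 (join n m u v) = u" "pick m n (join n m u v) = v"
  using assms by (auto intro!: vec_space_eqI simp: pick_def join_def)

lemma sideinfo_expectation_pick:
  assumes kn: "k + n \<le> N" and f [measurable]: "f \<in> vec_space n \<rightarrow>\<^sub>M vec_space n"
    and F [measurable]: "F \<in> borel_measurable (vec_space n \<Otimes>\<^sub>M (vec_space n \<Otimes>\<^sub>M vec_space n))"
  shows "(\<integral>\<^sup>+s. \<integral>\<^sup>+w. \<integral>\<^sup>+z. F (pick n k s, lincomb n h (f (pick n k s)) 1 (pick n k w), lincomb n g (pick n k s) 1 (pick n k z))
     \<partial>std_normal_vec N \<partial>std_normal_vec N \<partial>std_normal_vec N) = sideinfo_expectation n h f g F"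
proof -
  have z: "(\<integral>\<^sup>+z. F (s, y, lincomb n g s 1 (pick n k z)) \<partial>std_normal_vec N) = (\<integral>\<^sup>+z. F (s, y, lincomb n g s 1 z) \<partial>std_normal_vec n)"
    if [measurable]: "s \<in> space (vec_space n)" "y \<in> space (vec_space n)" for s y
    by (rule nn_integral_pick[OF kn, of "\<lambda>z. F (s, y, lincomb n g s 1 z)"]) measurable
  have w: "(\<integral>\<^sup>+w. \<integral>\<^sup>+z. F (s, lincomb n h (f s) 1 (pick n k w), lincomb n g s 1 z) \<partial>std_normal_vec n \<partial>std_normal_vec N)
    = (\<integral>\<^sup>+w. \<integral>\<^sup>+z. F (s, lincomb n h (f s) 1 w, lincomb n g s 1 z) \<partial>std_normal_vec n \<partial>std_normal_vec n)"
    if [measurable]: "s \<in> space (vec_space n)" for s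
    by (rule nn_integral_pick[OF kn, of "\<lambda>w. \<integral>\<^sup>+z. F (s, lincomb n h (f s) 1 w, lincomb n g s 1 z) \<partial>std_normal_vec n"]) measurable
  show ?thesis unfolding sideinfo_expectation_def
    by (subst z, simp, simp, subst w, simp,
       rule nn_integral_pick[OF kn, of "\<lambda>s. \<integral>\<^sup>+w. \<integral>\<^sup>+z. F (s, lincomb n h (f s) 1 w, lincomb n g s 1 z) \<partial>std_normal_vec n \<partial>std_normal_vec n"]) measurable
qed

text \<open>The blocks use disjoint coordinates of source and noises but share the fading state. The
  error is therefore split for each fixed state and integrated over the fading afterwards.\<close>

lemma concatenate_codes:
  assumes f: "admissible_encoder n f" and d: "admissible_decoder n d"
    and f': "admissible_encoder m f'" and d': "admissible_decoder m d'"
    and h: "prob_space \<mu>h" "sets \<mu>h = sets borel" and g: "prob_space \<mu>g" "sets \<mu>g = sets borel"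
  obtains f'' d'' where "admissible_encoder (n + m) f''" "admissible_decoder (n + m) d''"
    "total_distortion (n + m) \<rho> \<mu>h \<mu>g f'' d'' = total_distortion n \<rho> \<mu>h \<mu>g f d + total_distortion m \<rho> \<mu>h \<mu>g f' d'"
proof
  interpret H: prob_space \<mu>h by fact
  interpret G: prob_space \<mu>g by fact
  note [measurable_cong] = h(2) g(2)
  have [measurable]: "pick n 0 \<in> vec_space (n + m) \<rightarrow>\<^sub>M vec_space n" "pick m n \<in> vec_space (n + m) \<rightarrow>\<^sub>M vec_space m"
    by (auto intro: measurable_pick)
  have fm [measurable]: "f \<in> vec_space n \<rightarrow>\<^sub>M vec_space n" "f' \<in> vec_space m \<rightarrow>\<^sub>M vec_space m"
    using f f' by (auto simp: admissible_encoder_def)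
  have dm [measurable]: "d \<in> vec_space n \<Otimes>\<^sub>M (vec_space n \<Otimes>\<^sub>M (borel \<Otimes>\<^sub>M borel)) \<rightarrow>\<^sub>M vec_space n"
    "d' \<in> vec_space m \<Otimes>\<^sub>M (vec_space m \<Otimes>\<^sub>M (borel \<Otimes>\<^sub>M borel)) \<rightarrow>\<^sub>M vec_space m"
    using d d' by (auto simp: admissible_decoder_def dec_input_space_def)
  define f'' where "f'' s = join n m (f (pick n 0 s)) (f' (pick m n s))" for s
  define d'' where "d'' x = join n m (d (pick n 0 (fst x), pick n 0 (fst (snd x)), snd (snd x)))
      (d' (pick m n (fst x), pick m n (fst (snd x)), snd (snd x)))" for x :: "(nat \<Rightarrow> real) \<times> (nat \<Rightarrow> real) \<times> real \<times> real"
  have fs: "f s \<in> space (vec_space n)" if "s \<in> space (vec_space n)" for s using measurable_space[OF fm(1) that] .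
  have fs': "f' s \<in> space (vec_space m)" if "s \<in> space (vec_space m)" for s using measurable_space[OF fm(2) that] .
  have f''m [measurable]: "f'' \<in> vec_space (n + m) \<rightarrow>\<^sub>M vec_space (n + m)"
    unfolding f''_def by measurable
  have pf: "pick n 0 (f'' s) = f (pick n 0 s)" "pick m n (f'' s) = f' (pick m n s)" for s
    unfolding f''_def by (simp_all add: pick_join fs fs')
  have "(\<integral>\<^sup>+s. ennreal (sqnorm (n + m) (f'' s)) \<partial>std_normal_vec (n + m))
     = (\<integral>\<^sup>+s. ennreal (sqnorm n (f (pick n 0 s))) + ennreal (sqnorm m (f' (pick m n s))) \<partial>std_normal_vec (n + m))"
    by (simp add: sqnorm_join_pick pf)
  also have "\<dots> = (\<integral>\<^sup>+s. ennreal (sqnorm n (f (pick n 0 s))) \<partial>std_normal_vec (n + m)) + (\<integral>\<^sup>+s. ennreal (sqnorm m (f' (pick m n s))) \<partial>std_normal_vec (n + m))"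
    by (rule nn_integral_add) measurable
  also have "(\<integral>\<^sup>+s. ennreal (sqnorm n (f (pick n 0 s))) \<partial>std_normal_vec (n + m)) = (\<integral>\<^sup>+s. ennreal (sqnorm n (f s)) \<partial>std_normal_vec n)"
    by (rule nn_integral_pick[where G = "\<lambda>s. ennreal (sqnorm n (f s))"]) auto
  also have "(\<integral>\<^sup>+s. ennreal (sqnorm m (f' (pick m n s))) \<partial>std_normal_vec (n + m)) = (\<integral>\<^sup>+s. ennreal (sqnorm m (f' s)) \<partial>std_normal_vec m)"
    by (rule nn_integral_pick[where G = "\<lambda>s. ennreal (sqnorm m (f' s))"]) auto
  also have "(\<integral>\<^sup>+s. ennreal (sqnorm n (f s)) \<partial>std_normal_vec n) + (\<integral>\<^sup>+s. ennreal (sqnorm m (f' s)) \<partial>std_normal_vec m)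
      \<le> ennreal (real n) + ennreal (real m)"
    using f f' by (intro add_mono) (auto simp: admissible_encoder_def sqnorm_def)
  finally show "admissible_encoder (n + m) f''"
    using f''m by (simp add: admissible_encoder_def sqnorm_def)
  have d''m [measurable]: "d'' \<in> vec_space (n + m) \<Otimes>\<^sub>M (vec_space (n + m) \<Otimes>\<^sub>M (borel \<Otimes>\<^sub>M borel)) \<rightarrow>\<^sub>M vec_space (n + m)"
    unfolding d''_def by measurable
  then show d''a: "admissible_decoder (n + m) d''"
    by (simp add: admissible_decoder_def dec_input_space_def)
  have ds: "decoder_at d hh gg z \<in> space (vec_space n)" if "z \<in> space (vec_space n \<Otimes>\<^sub>M vec_space n)" for z hh gg
    using measurable_space[OF measurable_decoder_at[OF d] that] .
  have ds': "decoder_at d' hh gg z \<in> space (vec_space m)" if "z \<in> space (vec_space m \<Otimes>\<^sub>M vec_space m)" for z hh gg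
    using measurable_space[OF measurable_decoder_at[OF d'] that] .
  have split: "sideinfo_expectation (n + m) hh f'' gg (sqerror (n + m) (decoder_at d'' hh gg))
     = sideinfo_expectation n hh f gg (sqerror n (decoder_at d hh gg)) + sideinfo_expectation m hh f' gg (sqerror m (decoder_at d' hh gg))" for hh gg
  proof -
    let ?\<mu> = "std_normal_vec (n + m)"
    let ?A = "\<lambda>s w z. sqerror n (decoder_at d hh gg) (pick n 0 s, lincomb n hh (f (pick n 0 s)) 1 (pick n 0 w), lincomb n gg (pick n 0 s) 1 (pick n 0 z))"
    let ?B = "\<lambda>s w z. sqerror m (decoder_at d' hh gg) (pick m n s, lincomb m hh (f' (pick m n s)) 1 (pick m n w), lincomb m gg (pick m n s) 1 (pick m n z))"
    note measurable_decoder_at[OF d, measurable] measurable_decoder_at[OF d', measurable]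
    have pt: "sqerror (n + m) (decoder_at d'' hh gg) (s, lincomb (n + m) hh (f'' s) 1 w, lincomb (n + m) gg s 1 z) = ?A s w z + ?B s w z" for s w z
    proof -
      define y where "y = lincomb (n + m) hh (f'' s) 1 w"
      define t where "t = lincomb (n + m) gg s 1 z"
      have j: "decoder_at d'' hh gg (y, t) = join n m (decoder_at d hh gg (pick n 0 y, pick n 0 t)) (decoder_at d' hh gg (pick m n y, pick m n t))"
        by (simp add: decoder_at_def d''_def)
      have p1: "pick n 0 (decoder_at d'' hh gg (y, t)) = decoder_at d hh gg (pick n 0 y, pick n 0 t)"
        unfolding j by (intro pick_join ds ds') (auto simp: space_pair_measure)
      have p2: "pick m n (decoder_at d'' hh gg (y, t)) = decoder_at d' hh gg (pick m n y, pick m n t)"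
        unfolding j by (intro pick_join ds ds') (auto simp: space_pair_measure)
      show ?thesis
        unfolding sqerror_def prod.case y_def[symmetric] t_def[symmetric]
        by (simp add: sqnorm_join_pick pick_lincomb p1 p2) (simp add: y_def t_def pick_lincomb pf)
    qed
    interpret P2: pair_prob_space ?\<mu> ?\<mu> ..
    interpret P3: pair_prob_space ?\<mu> "?\<mu> \<Otimes>\<^sub>M ?\<mu>" ..
    have mA [measurable]: "(\<lambda>x. ?A (fst x) (fst (snd x)) (snd (snd x))) \<in> borel_measurable (?\<mu> \<Otimes>\<^sub>M (?\<mu> \<Otimes>\<^sub>M ?\<mu>))" by measurable
    have mB [measurable]: "(\<lambda>x. ?B (fst x) (fst (snd x)) (snd (snd x))) \<in> borel_measurable (?\<mu> \<Otimes>\<^sub>M (?\<mu> \<Otimes>\<^sub>M ?\<mu>))" by measurable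
    have iter: "(\<integral>\<^sup>+s. \<integral>\<^sup>+w. \<integral>\<^sup>+z. F s w z \<partial>?\<mu> \<partial>?\<mu> \<partial>?\<mu>) = (\<integral>\<^sup>+x. F (fst x) (fst (snd x)) (snd (snd x)) \<partial>(?\<mu> \<Otimes>\<^sub>M (?\<mu> \<Otimes>\<^sub>M ?\<mu>)))"
      if [measurable]: "(\<lambda>x. F (fst x) (fst (snd x)) (snd (snd x))) \<in> borel_measurable (?\<mu> \<Otimes>\<^sub>M (?\<mu> \<Otimes>\<^sub>M ?\<mu>))" for F :: "_ \<Rightarrow> _ \<Rightarrow> _ \<Rightarrow> ennreal"
    proof -
      have [measurable]: "(\<lambda>x. F s (fst x) (snd x)) \<in> borel_measurable (?\<mu> \<Otimes>\<^sub>M ?\<mu>)" if "s \<in> space ?\<mu>" for s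
        using measurable_compose[OF _ \<open>(\<lambda>x. F (fst x) (fst (snd x)) (snd (snd x))) \<in> _\<close>, of "\<lambda>x. (s, x)" "?\<mu> \<Otimes>\<^sub>M ?\<mu>"] that by simp
      show ?thesis
        by (subst P2.P.nn_integral_fst[symmetric], measurable, rule nn_integral_cong,
            subst std_normal_vec.nn_integral_fst[symmetric]) auto
    qed
    have "sideinfo_expectation (n + m) hh f'' gg (sqerror (n + m) (decoder_at d'' hh gg))
      = (\<integral>\<^sup>+s. \<integral>\<^sup>+w. \<integral>\<^sup>+z. ?A s w z + ?B s w z \<partial>?\<mu> \<partial>?\<mu> \<partial>?\<mu>)"
      unfolding sideinfo_expectation_def pt ..
    also have "\<dots> = (\<integral>\<^sup>+s. \<integral>\<^sup>+w. \<integral>\<^sup>+z. ?A s w z \<partial>?\<mu> \<partial>?\<mu> \<partial>?\<mu>) + (\<integral>\<^sup>+s. \<integral>\<^sup>+w. \<integral>\<^sup>+z. ?B s w z \<partial>?\<mu> \<partial>?\<mu> \<partial>?\<mu>)"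
      using mA mB by (subst (1 2 3) iter) (auto intro!: nn_integral_add borel_measurable_add)
    finally show ?thesis
      by (simp add: sideinfo_expectation_pick)
  qed
  have c1 [measurable]: "(\<lambda>x. sideinfo_expectation n (sqrt \<rho> * fst x) f (sqrt \<rho> * snd x) (sqerror n (decoder_at d (sqrt \<rho> * fst x) (sqrt \<rho> * snd x))))
    \<in> borel_measurable (borel \<Otimes>\<^sub>M borel)" by (rule measurable_conditional_distortion) fact+
  have c2 [measurable]: "(\<lambda>x. sideinfo_expectation m (sqrt \<rho> * fst x) f' (sqrt \<rho> * snd x) (sqerror m (decoder_at d' (sqrt \<rho> * fst x) (sqrt \<rho> * snd x))))
    \<in> borel_measurable (borel \<Otimes>\<^sub>M borel)" by (rule measurable_conditional_distortion) fact+
  have c1' [measurable]: "(\<lambda>y. sideinfo_expectation n (sqrt \<rho> * x) f (sqrt \<rho> * y) (sqerror n (decoder_at d (sqrt \<rho> * x) (sqrt \<rho> * y))))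
    \<in> borel_measurable borel" for x using measurable_compose[OF measurable_Pair1'[of x borel borel] c1] by simp
  have c2' [measurable]: "(\<lambda>y. sideinfo_expectation m (sqrt \<rho> * x) f' (sqrt \<rho> * y) (sqerror m (decoder_at d' (sqrt \<rho> * x) (sqrt \<rho> * y))))
    \<in> borel_measurable borel" for x using measurable_compose[OF measurable_Pair1'[of x borel borel] c2] by simp
  show "total_distortion (n + m) \<rho> \<mu>h \<mu>g f'' d'' = total_distortion n \<rho> \<mu>h \<mu>g f d + total_distortion m \<rho> \<mu>h \<mu>g f' d'"
    unfolding total_distortion_def split
    by (subst nn_integral_add[symmetric])
       (use c1 c2 c1' c2' in \<open>auto intro!: nn_integral_cong nn_integral_add simp: split_beta' measurable_cong_sets[OF g(2) refl]\<close>)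
qed

section \<open>The limit over block lengths and bounds for it\<close>

lemma admissible_zero:
  "admissible_encoder n (\<lambda>_. restrict (\<lambda>_. 0) {..<n})" "admissible_decoder n (\<lambda>_. restrict (\<lambda>_. 0) {..<n})"
  by (auto simp: admissible_encoder_def admissible_decoder_def)

lemma opt_distortion_le:
  assumes "admissible_encoder n f" "admissible_decoder n d"
  shows "opt_distortion n \<rho> \<mu>h \<mu>g \<le> expected_distortion n \<rho> \<mu>h \<mu>g f d"
  unfolding opt_distortion_def by (rule INF_lower2[of "(f, d)"]) (use assms in auto)

text \<open>The zero estimate costs the source variance. Finiteness of the optimum is the point:
  \<open>enn2real\<close> in \<open>EDstar\<close> then loses nothing.\<close>

lemma opt_distortion_le_1:
  assumes h: "prob_space \<mu>h" "sets \<mu>h = sets borel" and g: "prob_space \<mu>g" "sets \<mu>g = sets borel"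
  shows "opt_distortion n \<rho> \<mu>h \<mu>g \<le> 1"
proof -
  interpret H: prob_space \<mu>h by fact
  interpret G: prob_space \<mu>g by fact
  let ?z = "restrict (\<lambda>_. 0) {..<n} :: nat \<Rightarrow> real"
  have "total_distortion n \<rho> \<mu>h \<mu>g (\<lambda>_. ?z) (\<lambda>_. ?z) = (\<integral>\<^sup>+s. ennreal (sqnorm n s) \<partial>std_normal_vec n)"
    by (simp add: total_distortion_def sideinfo_expectation_def sqerror_def decoder_at_def sqnorm_def
        H.emeasure_space_1 G.emeasure_space_1)
  then have "expected_distortion n \<rho> \<mu>h \<mu>g (\<lambda>_. ?z) (\<lambda>_. ?z) = ennreal (1 / real n) * ennreal (real n)"
    using assms by (simp add: expected_distortion_eq_total[OF admissible_zero] nn_integral_sqnorm)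
  also have "\<dots> \<le> 1" by (cases "n = 0") (auto simp: ennreal_mult''[symmetric])
  finally show ?thesis using opt_distortion_le[OF admissible_zero] order_trans by blast
qed

lemma EDstar_is_limit:
  assumes h: "prob_space \<mu>h" "sets \<mu>h = sets borel" and g: "prob_space \<mu>g" "sets \<mu>g = sets borel"
  shows "(\<lambda>n. enn2real (opt_distortion n \<rho> \<mu>h \<mu>g)) \<longlonglongrightarrow> EDstar \<mu>h \<mu>g \<rho>"
    and "EDstar \<mu>h \<mu>g \<rho> \<le> enn2real (opt_distortion 1 \<rho> \<mu>h \<mu>g)"
proof -
  define c where "c n = enn2real (opt_distortion n \<rho> \<mu>h \<mu>g)" for n
  have opt: "opt_distortion n \<rho> \<mu>h \<mu>g = ennreal (c n)" for n
    unfolding c_def using opt_distortion_le_1[OF assms, of n \<rho>]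
    by (metis ennreal_enn2real ennreal_one_less_top le_less_trans)
  have c0: "c n \<ge> 0" for n by (simp add: c_def)
  \<comment> \<open>The infimum need not be attained, so codes within \<open>\<epsilon>\<close> of
    it are concatenated.\<close>
  have near: "\<exists>f d. admissible_encoder n f \<and> admissible_decoder n d \<and> total_distortion n \<rho> \<mu>h \<mu>g f d \<le> ennreal (real n * (c n + \<epsilon>))"
    if "n > 0" "\<epsilon> > 0" for n \<epsilon>
  proof -
    have "opt_distortion n \<rho> \<mu>h \<mu>g < ennreal (c n + \<epsilon>)" unfolding opt using that c0[of n] by (intro ennreal_lessI) auto
    then obtain f d where fd: "admissible_encoder n f" "admissible_decoder n d" "expected_distortion n \<rho> \<mu>h \<mu>g f d < ennreal (c n + \<epsilon>)"
      unfolding opt_distortion_def by (auto simp: INF_less_iff)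
    have "total_distortion n \<rho> \<mu>h \<mu>g f d = (ennreal (real n) * ennreal (1 / real n)) * total_distortion n \<rho> \<mu>h \<mu>g f d"
      using that by (subst ennreal_mult'[symmetric]) auto
    also have "\<dots> = ennreal (real n) * expected_distortion n \<rho> \<mu>h \<mu>g f d"
      by (simp add: expected_distortion_eq_total[OF fd(1,2) assms] mult.assoc)
    also have "\<dots> \<le> ennreal (real n) * ennreal (c n + \<epsilon>)" using fd(3) by (intro mult_left_mono) auto
    also have "\<dots> = ennreal (real n * (c n + \<epsilon>))" by (simp add: ennreal_mult')
    finally show ?thesis using fd by blast
  qed
  have sub: "real (m + n) * c (m + n) \<le> real m * c m + real n * c n" for m n
  proof (cases "m = 0 \<or> n = 0")
    case False
    show ?thesis
    proof (rule field_le_epsilon)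
      fix e :: real assume e: "e > 0"
      define \<epsilon> where "\<epsilon> = e / real (m + n)"
      have \<epsilon>: "\<epsilon> > 0" using e False by (simp add: \<epsilon>_def)
      obtain f d where fd: "admissible_encoder m f" "admissible_decoder m d" "total_distortion m \<rho> \<mu>h \<mu>g f d \<le> ennreal (real m * (c m + \<epsilon>))"
        using near[of m \<epsilon>] False \<epsilon> by auto
      obtain f' d' where fd': "admissible_encoder n f'" "admissible_decoder n d'" "total_distortion n \<rho> \<mu>h \<mu>g f' d' \<le> ennreal (real n * (c n + \<epsilon>))"
        using near[of n \<epsilon>] False \<epsilon> by auto
      obtain f'' d'' where fd'': "admissible_encoder (m + n) f''" "admissible_decoder (m + n) d''"
        "total_distortion (m + n) \<rho> \<mu>h \<mu>g f'' d'' = total_distortion m \<rho> \<mu>h \<mu>g f d + total_distortion n \<rho> \<mu>h \<mu>g f' d'"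
        by (rule concatenate_codes[OF fd(1,2) fd'(1,2) assms])
      have nn: "0 \<le> real m * (c m + \<epsilon>)" "0 \<le> real n * (c n + \<epsilon>)"
        using c0[of m] c0[of n] \<epsilon> by simp_all
      have "ennreal (c (m + n)) \<le> expected_distortion (m + n) \<rho> \<mu>h \<mu>g f'' d''"
        unfolding opt[symmetric] by (rule opt_distortion_le) fact+
      also have "\<dots> = ennreal (1 / real (m + n)) * (total_distortion m \<rho> \<mu>h \<mu>g f d + total_distortion n \<rho> \<mu>h \<mu>g f' d')"
        by (simp add: expected_distortion_eq_total[OF fd''(1,2) assms] fd''(3))
      also have "\<dots> \<le> ennreal (1 / real (m + n)) * (ennreal (real m * (c m + \<epsilon>)) + ennreal (real n * (c n + \<epsilon>)))"
        by (intro mult_left_mono add_mono fd(3) fd'(3)) auto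
      also have "\<dots> = ennreal (1 / real (m + n) * (real m * (c m + \<epsilon>) + real n * (c n + \<epsilon>)))"
        by (subst ennreal_plus[symmetric, OF nn], subst ennreal_mult'[symmetric], simp, rule refl)
      finally have "c (m + n) \<le> 1 / real (m + n) * (real m * (c m + \<epsilon>) + real n * (c n + \<epsilon>))"
        using c0 \<epsilon> by (subst (asm) ennreal_le_iff) (auto intro!: divide_nonneg_nonneg add_nonneg_nonneg mult_nonneg_nonneg less_imp_le)
      then have "real (m + n) * c (m + n) \<le> real m * (c m + \<epsilon>) + real n * (c n + \<epsilon>)"
        using False by (simp add: field_simps)
      also have "\<dots> = real m * c m + real n * c n + real (m + n) * \<epsilon>" by (simp add: algebra_simps)
      also have "real (m + n) * \<epsilon> = e" using False by (simp add: \<epsilon>_def)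
      finally show "real (m + n) * c (m + n) \<le> real m * c m + real n * c n + e" .
    qed
  qed auto
  obtain L where L: "(\<lambda>n. real n * c n / real n) \<longlonglongrightarrow> L" "\<And>n. n \<ge> 1 \<Longrightarrow> L \<le> real n * c n / real n"
    by (rule fekete[of "\<lambda>n. real n * c n"]) (use c0 sub in auto)
  have "c \<longlonglongrightarrow> L"
    by (rule Lim_transform_eventually[OF L(1)], rule eventually_sequentiallyI[of 1]) simp
  moreover have "EDstar \<mu>h \<mu>g \<rho> = L"
    using \<open>c \<longlonglongrightarrow> L\<close> unfolding EDstar_def c_def by (rule limI)
  ultimately show "(\<lambda>n. enn2real (opt_distortion n \<rho> \<mu>h \<mu>g)) \<longlonglongrightarrow> EDstar \<mu>h \<mu>g \<rho>"
    "EDstar \<mu>h \<mu>g \<rho> \<le> enn2real (opt_distortion 1 \<rho> \<mu>h \<mu>g)"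
    using L(2)[of 1] by (auto simp: c_def[abs_def])
qed

lemma EDstar_upper:
  assumes h: "prob_space \<mu>h" "sets \<mu>h = sets borel" and g: "prob_space \<mu>g" "sets \<mu>g = sets borel"
    and "admissible_encoder 1 f" "admissible_decoder 1 d"
    and le: "expected_distortion 1 \<rho> \<mu>h \<mu>g f d \<le> ennreal b" and "b \<ge> 0"
  shows "EDstar \<mu>h \<mu>g \<rho> \<le> b"
proof -
  have "opt_distortion 1 \<rho> \<mu>h \<mu>g \<le> ennreal b" using opt_distortion_le[OF assms(5,6)] le by (rule order_trans)
  then have "enn2real (opt_distortion 1 \<rho> \<mu>h \<mu>g) \<le> b" using \<open>b \<ge> 0\<close> by (rule enn2real_leI[rotated])
  then show ?thesis using EDstar_is_limit(2)[OF assms(1-4), of \<rho>] by simp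
qed

lemma EDstar_lower:
  assumes h: "prob_space \<mu>h" "sets \<mu>h = sets borel" and g: "prob_space \<mu>g" "sets \<mu>g = sets borel"
    and b: "\<And>n f d. n > 0 \<Longrightarrow> admissible_encoder n f \<Longrightarrow> admissible_decoder n d \<Longrightarrow>
        ennreal (real n * b) \<le> total_distortion n \<rho> \<mu>h \<mu>g f d"
  shows "b \<le> EDstar \<mu>h \<mu>g \<rho>"
proof (rule LIMSEQ_le_const[OF EDstar_is_limit(1)[OF assms(1-4)]])
  show "\<exists>N. \<forall>n\<ge>N. b \<le> enn2real (opt_distortion n \<rho> \<mu>h \<mu>g)"
  proof (intro exI[of _ 1] allI impI)
    fix n :: nat assume n: "n \<ge> 1"
    have "ennreal b \<le> opt_distortion n \<rho> \<mu>h \<mu>g"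
      unfolding opt_distortion_def
    proof (rule INF_greatest, clarsimp)
      fix f d assume fd: "admissible_encoder n f" "admissible_decoder n d"
      have "ennreal b = ennreal (1 / real n) * ennreal (real n * b)"
        using n by (subst ennreal_mult'[symmetric]) auto
      also have "\<dots> \<le> ennreal (1 / real n) * total_distortion n \<rho> \<mu>h \<mu>g f d"
        using n fd by (intro mult_left_mono b) auto
      finally show "ennreal b \<le> expected_distortion n \<rho> \<mu>h \<mu>g f d"
        by (simp add: expected_distortion_eq_total[OF fd assms(1-4)])
    qed
    moreover have "opt_distortion n \<rho> \<mu>h \<mu>g < \<top>"
      using opt_distortion_le_1[OF assms(1-4), of n \<rho>] by (simp add: le_less_trans)
    ultimately show "b \<le> enn2real (opt_distortion n \<rho> \<mu>h \<mu>g)"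
      by (cases "opt_distortion n \<rho> \<mu>h \<mu>g") (auto simp: ennreal_le_iff)
  qed
qed

section \<open>Nakagami fading\<close>

lemma nakagamiD:
  assumes "nakagami_amplitude_law L \<mu>"
  shows "prob_space \<mu>" "sets \<mu> = sets borel"
  using assms by (auto simp: nakagami_amplitude_law_def)

lemma measurable_gamma_density [measurable]: "gamma_density L \<theta> \<in> borel_measurable borel"
  unfolding gamma_density_def by measurable

lemma gamma_density_nonneg: "L > 0 \<Longrightarrow> \<theta> > 0 \<Longrightarrow> 0 \<le> gamma_density L \<theta> x"
  by (auto simp: gamma_density_def intro!: divide_nonneg_pos mult_pos_pos Gamma_real_pos)

lemma nakagami_nn_integral:
  assumes "nakagami_amplitude_law L \<mu>" and [measurable]: "f \<in> borel_measurable borel"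
  shows "(\<integral>\<^sup>+x. f (x\<^sup>2) \<partial>\<mu>) = (\<integral>\<^sup>+x. ennreal (gamma_density L (1 / L) x) * f x \<partial>lborel)"
proof -
  have [measurable_cong]: "sets \<mu> = sets borel" using nakagamiD[OF assms(1)] by simp
  have "(\<integral>\<^sup>+x. f (x\<^sup>2) \<partial>\<mu>) = (\<integral>\<^sup>+x. f x \<partial>distr \<mu> borel (\<lambda>x. x\<^sup>2))"
    by (subst nn_integral_distr) auto
  also have "\<dots> = (\<integral>\<^sup>+x. f x \<partial>gamma_measure L (1 / L))"
    using assms(1) by (simp add: nakagami_amplitude_law_def)
  also have "\<dots> = (\<integral>\<^sup>+x. ennreal (gamma_density L (1 / L) x) * f x \<partial>lborel)"
    unfolding gamma_measure_def by (rule nn_integral_density) auto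
  finally show ?thesis .
qed

text \<open>Since \<open>0 powr r\<close> is 0, bounds by negative powers of a gain can fail at gain
  zero; this null event is removed here.\<close>

lemma nakagami_nonzero_AE:
  assumes "nakagami_amplitude_law L \<mu>"
  shows "AE x in \<mu>. x \<noteq> 0"
proof -
  have [measurable_cong]: "sets \<mu> = sets borel" using nakagamiD[OF assms] by simp
  have "(\<integral>\<^sup>+x. indicator {0} (x\<^sup>2) \<partial>\<mu>) = (\<integral>\<^sup>+x. ennreal (gamma_density L (1 / L) x) * indicator {0} x \<partial>lborel)"
    by (rule nakagami_nn_integral[OF assms]) auto
  also have "\<dots> = 0"
  proof -
    have "AE x in lborel. x \<notin> {0::real}" by (intro AE_not_in) auto
    then show ?thesis by (subst nn_integral_0_iff_AE) (auto elim!: eventually_mono)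
  qed
  finally have "AE x in \<mu>. indicator {0} (x\<^sup>2) = (0::ennreal)"
    by (subst (asm) nn_integral_0_iff_AE) auto
  then show ?thesis by (rule eventually_mono) (auto split: split_indicator_asm)
qed

text \<open>Multiplying by the power \<open>- s\<close> turns the shape \<open>L\<close> into
  \<open>L - s > 0\<close>, so a Gamma integral remains. These moments replace outage probabilities:
  where a gain is below a threshold, any positive power of threshold over gain may be inserted as a
  factor of at least 1.\<close>

lemma nakagami_negative_moment:
  assumes "nakagami_amplitude_law L \<mu>" "L > 0" "s < L"
  obtains M where "M \<ge> 0" "(\<integral>\<^sup>+x. ennreal ((x\<^sup>2) powr (- s)) \<partial>\<mu>) = ennreal M"
proof
  define a where "a = L - s"
  have a: "a > 0" using assms by (simp add: a_def)
  define c where "c = (1 / L) powr L * Gamma L"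
  have c: "c > 0" unfolding c_def using assms by (intro mult_pos_pos Gamma_real_pos) auto
  define F where "F x = ennreal (indicator {0..} x * x powr (a - 1) / exp (L * x))" for x :: real
  have [measurable]: "F \<in> borel_measurable borel" unfolding F_def by measurable
  have "(\<integral>\<^sup>+x. ennreal ((x\<^sup>2) powr (- s)) \<partial>\<mu>) = (\<integral>\<^sup>+x. ennreal (gamma_density L (1 / L) x) * ennreal (x powr (- s)) \<partial>lborel)"
    by (rule nakagami_nn_integral[OF assms(1)]) measurable
  also have "\<dots> = (\<integral>\<^sup>+x. ennreal (1 / c) * F x \<partial>lborel)"
  proof (rule nn_integral_cong)
    fix x :: real
    have "gamma_density L (1 / L) x * x powr (- s) = 1 / c * (indicator {0..} x * x powr (a - 1) / exp (L * x))"
    proof (cases "x > 0")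
      case True
      have "x powr (a - 1) = x powr (L - 1) * x powr (- s)" by (simp add: a_def powr_add[symmetric] algebra_simps)
      then show ?thesis using True by (simp add: gamma_density_def c_def exp_minus field_simps)
    next
      case False
      then show ?thesis by (cases "x = 0") (auto simp: gamma_density_def)
    qed
    then show "ennreal (gamma_density L (1 / L) x) * ennreal (x powr (- s)) = ennreal (1 / c) * F x"
      unfolding F_def using c assms
      by (subst (1 2) ennreal_mult'[symmetric]) (auto intro!: gamma_density_nonneg)
  qed
  also have "\<dots> = ennreal (1 / c) * (\<integral>\<^sup>+x. F x \<partial>lborel)"
    by (rule nn_integral_cmult) measurable
  also have "(\<integral>\<^sup>+x. F x \<partial>lborel) = ennreal \<bar>1 / L\<bar> * (\<integral>\<^sup>+x. F (0 + 1 / L * x) \<partial>lborel)"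
    by (rule nn_integral_real_affine) (use assms in auto)
  also have "(\<integral>\<^sup>+x. F (0 + 1 / L * x) \<partial>lborel) = (\<integral>\<^sup>+x. ennreal ((1 / L) powr (a - 1)) * ennreal (indicator {0..} x * x powr (a - 1) / exp x) \<partial>lborel)"
    using assms by (intro nn_integral_cong)
      (auto simp: F_def ennreal_mult'[symmetric] indicator_def powr_divide zero_le_divide_iff intro!: arg_cong[where f = ennreal])
  also have "\<dots> = ennreal ((1 / L) powr (a - 1)) * ennreal (Gamma a)"
    by (subst nn_integral_cmult) (auto simp: Gamma_conv_nn_integral_real[OF a])
  finally show "(\<integral>\<^sup>+x. ennreal ((x\<^sup>2) powr (- s)) \<partial>\<mu>) = ennreal (1 / c * (\<bar>1 / L\<bar> * ((1 / L) powr (a - 1) * Gamma a)))"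
    using c by (simp only: ennreal_mult' powr_ge_zero abs_ge_zero zero_le_divide_1_iff less_imp_le)
  show "0 \<le> 1 / c * (\<bar>1 / L\<bar> * ((1 / L) powr (a - 1) * Gamma a))"
    using c Gamma_real_pos[OF a] by simp
qed

text \<open>The density on the shell is of order \<open>b powr (L - 1)\<close> and the shell has
  length \<open>b\<close>. A shell is used instead of all gains below a bound because the converse
  needs amplitudes controlled from both sides.\<close>

lemma nakagami_dyadic_probability:
  assumes "nakagami_amplitude_law L \<mu>" "L > 0"
  obtains c where "c > 0" "\<And>b. 0 < b \<Longrightarrow> b \<le> 1 \<Longrightarrow> ennreal (c * b powr L) \<le> emeasure \<mu> {x. x\<^sup>2 \<in> {b..2 * b}}"
proof
  have [measurable_cong]: "sets \<mu> = sets borel" using nakagamiD[OF assms(1)] by simp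
  then have sp: "space \<mu> = UNIV" by (auto dest: sets_eq_imp_space_eq)
  define k where "k = (1 / L) powr L * Gamma L"
  have k: "k > 0" unfolding k_def using assms by (intro mult_pos_pos Gamma_real_pos) auto
  \<comment> \<open>On the shell \<open>x powr (L - 1)\<close> is smallest at \<open>b\<close> if
    \<open>L \<ge> 1\<close> and at \<open>2 * b\<close> otherwise, which the \<open>min\<close>
    covers; the exponential factor is estimated using \<open>x \<le> 2\<close>.\<close>
  define c where "c = min 1 (2 powr (L - 1)) * exp (- 2 * L) / k"
  show "c > 0" unfolding c_def using k by simp
  fix b :: real assume b: "0 < b" "b \<le> 1"
  have low: "c * b powr (L - 1) \<le> gamma_density L (1 / L) x" if "x \<in> {b..2 * b}" for x
  proof -
    have x: "x > 0" "x \<le> 2" "b \<le> x" "x \<le> 2 * b" using that b by auto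
    have "min 1 (2 powr (L - 1)) * b powr (L - 1) \<le> x powr (L - 1)"
    proof (cases "L \<ge> 1")
      case True
      have "min 1 (2 powr (L - 1)) * b powr (L - 1) \<le> 1 * b powr (L - 1)" by (intro mult_right_mono) auto
      also have "\<dots> \<le> x powr (L - 1)" using True x b by (simp add: powr_mono2)
      finally show ?thesis .
    next
      case False
      have "min 1 (2 powr (L - 1)) * b powr (L - 1) \<le> 2 powr (L - 1) * b powr (L - 1)" by (intro mult_right_mono) auto
      also have "\<dots> = (2 * b) powr (L - 1)" using b by (simp add: powr_mult)
      also have "\<dots> \<le> x powr (L - 1)" using False x b by (intro powr_mono2') auto
      finally show ?thesis .
    qed
    moreover have "exp (- 2 * L) \<le> exp (- x / (1 / L))" using x assms(2) by (simp add: mult.commute)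
    ultimately have "(min 1 (2 powr (L - 1)) * b powr (L - 1)) * exp (- 2 * L) \<le> x powr (L - 1) * exp (- x / (1 / L))"
      by (intro mult_mono) auto
    then have "(min 1 (2 powr (L - 1)) * b powr (L - 1)) * exp (- 2 * L) / k \<le> x powr (L - 1) * exp (- x / (1 / L)) / k"
      using k by (intro divide_right_mono) auto
    then show ?thesis using x by (simp add: gamma_density_def c_def k_def mult_ac)
  qed
  have "ennreal (c * b powr L) = ennreal (c * b powr (L - 1)) * emeasure lborel {b..2 * b}"
  proof -
    have "b powr L = b powr (L - 1) * b" using b by (simp add: powr_diff)
    then show ?thesis using b \<open>c > 0\<close> by (simp add: ennreal_mult'[symmetric] mult_ac)
  qed
  also have "\<dots> = (\<integral>\<^sup>+x. ennreal (c * b powr (L - 1)) * indicator {b..2 * b} x \<partial>lborel)"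
    by (simp add: nn_integral_cmult)
  also have "\<dots> \<le> (\<integral>\<^sup>+x. ennreal (gamma_density L (1 / L) x) * indicator {b..2 * b} x \<partial>lborel)"
    by (intro nn_integral_mono) (auto split: split_indicator intro!: ennreal_leI low)
  also have "\<dots> = (\<integral>\<^sup>+x. indicator {b..2 * b} (x\<^sup>2) \<partial>\<mu>)"
    by (rule nakagami_nn_integral[OF assms(1), symmetric]) auto
  also have "\<dots> = (\<integral>\<^sup>+x. indicator {x. x\<^sup>2 \<in> {b..2 * b}} x \<partial>\<mu>)"
    by (intro nn_integral_cong) (auto split: split_indicator)
  also have "\<dots> = emeasure \<mu> {x. x\<^sup>2 \<in> {b..2 * b}}"
    by (rule nn_integral_indicator) (use sp in measurable)
  finally show "ennreal (c * b powr L) \<le> emeasure \<mu> {x. x\<^sup>2 \<in> {b..2 * b}}" .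
qed

section \<open>Lower bounds on the optimal distortion\<close>

text \<open>Markov's inequality read as existence: it extracts one good fading state from a set of
  known probability.\<close>

lemma ex_below_average:
  assumes "A \<in> sets M" "(\<integral>\<^sup>+x. f x \<partial>M) < t * emeasure M A"
  obtains x where "x \<in> A" "f x < t"
proof (rule ccontr)
  assume "\<not> thesis"
  with that have *: "\<And>x. x \<in> A \<Longrightarrow> t \<le> f x" by (meson not_le)
  have "t * emeasure M A = (\<integral>\<^sup>+x. t * indicator A x \<partial>M)" using assms(1) by (simp add: nn_integral_cmult)
  also have "\<dots> \<le> (\<integral>\<^sup>+x. f x \<partial>M)" by (intro nn_integral_mono) (auto split: split_indicator simp: *)
  finally show False using assms(2) by simp
qed

lemma eventually_powr_gt: "\<eta> > 0 \<Longrightarrow> eventually (\<lambda>\<rho>::real. c < \<rho> powr \<eta>) at_top"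
proof -
  assume \<eta>: "\<eta> > 0"
  have "eventually (\<lambda>\<rho>::real. max 1 ((max c 1 + 1) powr (1 / \<eta>)) \<le> \<rho>) at_top"
    by (rule eventually_ge_at_top)
  then show ?thesis
  proof eventually_elim
    case (elim \<rho>)
    have "c < max c 1 + 1" by simp
    also have "\<dots> = ((max c 1 + 1) powr (1 / \<eta>)) powr \<eta>" using \<eta> by (simp add: powr_powr)
    also have "\<dots> \<le> \<rho> powr \<eta>" using elim \<eta> by (intro powr_mono2) auto
    finally show ?case .
  qed
qed

locale nakagami_pair =
  fixes Lc Ls :: real and \<mu>h \<mu>g :: "real measure"
  assumes Lc: "Lc > 0" and Ls: "Ls > 0"
    and h_law: "nakagami_amplitude_law Lc \<mu>h" and g_law: "nakagami_amplitude_law Ls \<mu>g"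
begin

lemmas laws = nakagamiD[OF h_law] nakagamiD[OF g_law]

text \<open>A single channel state \<open>h\<close> is selected first, then one side information
  state per shell for this same \<open>h\<close>, because the converse compares decoders that share
  the channel output. Dividing by the shell probabilities gives the \<open>D j\<close>; index 0
  stands for decoding without side information, where the zero estimate has distortion 1.\<close>

lemma multilevel_converse:
  assumes ch: "ch > 0" "\<And>b. 0 < b \<Longrightarrow> b \<le> 1 \<Longrightarrow> ennreal (ch * b powr Lc) \<le> emeasure \<mu>h {x. x\<^sup>2 \<in> {b..2 * b}}"
    and cg: "cg > 0" "\<And>b. 0 < b \<Longrightarrow> b \<le> 1 \<Longrightarrow> ennreal (cg * b powr Ls) \<le> emeasure \<mu>g {x. x\<^sup>2 \<in> {b..2 * b}}"
    and n: "n > 0" and f: "admissible_encoder n f" and d: "admissible_decoder n d"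
    and K: "K > 0" and \<rho>: "\<rho> > 0" and bh: "0 < bh" "bh \<le> 1"
    and b: "\<And>j. 1 \<le> j \<Longrightarrow> j \<le> K \<Longrightarrow> 0 < b j \<and> b j \<le> 1" "\<And>j. 1 \<le> j \<Longrightarrow> j < K \<Longrightarrow> 2 * b j < b (Suc j)"
    and \<delta>: "\<delta> > 0" and tot: "total_distortion n \<rho> \<mu>h \<mu>g f d < ennreal (real n * \<delta>)"
    and D: "\<And>j. D j = (if j = 0 then 1 else \<delta> / (ch * bh powr Lc * (cg * b j powr Ls)))"
  shows "1 \<le> (1 + 2 * \<rho> * bh) * D K * (\<Prod>j<K. 1 + 2 * \<rho> * b (Suc j) * D j)"
proof -
  note [measurable_cong] = laws(2,4)
  have sp: "space \<mu>h = UNIV" "space \<mu>g = UNIV" using laws(2,4) by (auto dest: sets_eq_imp_space_eq)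
  have fm [measurable]: "f \<in> vec_space n \<rightarrow>\<^sub>M vec_space n" using f by (simp add: admissible_encoder_def)
  define V where "V h g = sideinfo_expectation n (sqrt \<rho> * h) f (sqrt \<rho> * g) (sqerror n (decoder_at d (sqrt \<rho> * h) (sqrt \<rho> * g)))" for h g
  have V: "(\<integral>\<^sup>+h. \<integral>\<^sup>+g. V h g \<partial>\<mu>g \<partial>\<mu>h) < ennreal (real n * \<delta>)"
    using tot by (simp add: total_distortion_def V_def)
  define ph where "ph = ch * bh powr Lc"
  have ph: "ph > 0" using ch bh by (simp add: ph_def)
  have "ennreal (real n * \<delta>) = ennreal (real n * \<delta> / ph) * ennreal ph"
    using ph \<delta> by (simp add: ennreal_mult'[symmetric])
  also have "\<dots> \<le> ennreal (real n * \<delta> / ph) * emeasure \<mu>h {x. x\<^sup>2 \<in> {bh..2 * bh}}"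
    unfolding ph_def by (intro mult_left_mono ch bh) auto
  finally have "(\<integral>\<^sup>+h. \<integral>\<^sup>+g. V h g \<partial>\<mu>g \<partial>\<mu>h) < ennreal (real n * \<delta> / ph) * emeasure \<mu>h {x. x\<^sup>2 \<in> {bh..2 * bh}}"
    using V by (rule order.strict_trans2[rotated])
  then obtain h where h: "h\<^sup>2 \<in> {bh..2 * bh}" "(\<integral>\<^sup>+g. V h g \<partial>\<mu>g) < ennreal (real n * \<delta> / ph)"
    by (rule ex_below_average[rotated]) (use sp in \<open>auto, measurable\<close>)
  have Dpos: "D j > 0" if "j \<le> K" for j
    using that D[of j] b(1)[of j] \<delta> ch cg bh by auto
  have "\<exists>g. g\<^sup>2 \<in> {b j..2 * b j} \<and> V h g < ennreal (real n * D j)" if j: "1 \<le> j" "j \<le> K" for j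
  proof -
    define pj where "pj = cg * b j powr Ls"
    have pj: "pj > 0" using cg b(1)[OF j] by (simp add: pj_def)
    have "ennreal (real n * \<delta> / ph) = ennreal (real n * D j) * ennreal pj"
      using pj \<delta> j by (subst ennreal_mult''[symmetric]) (auto simp: D ph_def pj_def)
    also have "\<dots> \<le> ennreal (real n * D j) * emeasure \<mu>g {x. x\<^sup>2 \<in> {b j..2 * b j}}"
      unfolding pj_def using b(1)[OF j] by (intro mult_left_mono cg) auto
    finally have "(\<integral>\<^sup>+g. V h g \<partial>\<mu>g) < ennreal (real n * D j) * emeasure \<mu>g {x. x\<^sup>2 \<in> {b j..2 * b j}}"
      using h(2) by (rule order.strict_trans2[rotated])
    then obtain g where "g\<^sup>2 \<in> {b j..2 * b j}" "V h g < ennreal (real n * D j)"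
      by (rule ex_below_average[rotated]) (use sp in \<open>auto, measurable\<close>)
    then show ?thesis by blast
  qed
  then obtain G where G: "\<And>j. 1 \<le> j \<Longrightarrow> j \<le> K \<Longrightarrow> (G j)\<^sup>2 \<in> {b j..2 * b j} \<and> V h (G j) < ennreal (real n * D j)"
    by metis
  define g where "g j = (if j = 0 then 0 else sqrt \<rho> * G j)" for j
  define e where "e j = (if j = 0 then (\<lambda>_. restrict (\<lambda>_. 0) {..<n}) else decoder_at d (sqrt \<rho> * h) (sqrt \<rho> * G j))" for j
  have g2: "\<rho> * b j \<le> (g j)\<^sup>2 \<and> (g j)\<^sup>2 \<le> 2 * \<rho> * b j" if "1 \<le> j" "j \<le> K" for j
    using G[OF that] that \<rho> by (auto simp: g_def power_mult_distrib mult.assoc mult.left_commute[of 2])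
  \<comment> \<open>The factor 2 in \<open>2 * b j < b (Suc j)\<close> keeps neighbouring shells
    apart, so the selected amplitudes increase with \<open>j\<close>.\<close>
  have nonneg: "0 \<le> 1 + ((g (Suc j))\<^sup>2 - (g j)\<^sup>2) * D j" if j: "j < K" for j
  proof -
    have "(g j)\<^sup>2 \<le> (g (Suc j))\<^sup>2"
    proof (cases "j = 0")
      case False
      have "(g j)\<^sup>2 \<le> 2 * \<rho> * b j" using g2[of j] False j by simp
      also have "\<dots> \<le> \<rho> * b (Suc j)" using b(2)[of j] False j \<rho> by simp
      also have "\<dots> \<le> (g (Suc j))\<^sup>2" using g2[of "Suc j"] j by simp
      finally show ?thesis .
    qed (simp add: g_def)
    then show ?thesis using Dpos[of j] j by simp
  qed
  have "1 \<le> (1 + (sqrt \<rho> * h)\<^sup>2) * D K * (\<Prod>j<K. 1 + ((g (Suc j))\<^sup>2 - (g j)\<^sup>2) * D j)"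
  proof (rule gaussian_sideinfo_converse[OF n fm, where e = e])
    show "(\<integral>\<^sup>+s. ennreal (sqnorm n (f s)) \<partial>std_normal_vec n) \<le> ennreal (real n)"
      using f by (simp add: admissible_encoder_def sqnorm_def)
    show "e j \<in> vec_space n \<Otimes>\<^sub>M vec_space n \<rightarrow>\<^sub>M vec_space n" if "j \<le> K" for j
      unfolding e_def using measurable_decoder_at[OF d] by auto
    show "D j > 0" if "j \<le> K" for j using Dpos that .
    show "g 0 = 0" by (simp add: g_def)
    show "\<bar>g j\<bar> < \<bar>g (Suc j)\<bar>" if "j < K" for j
    proof -
      have "(g j)\<^sup>2 < (g (Suc j))\<^sup>2"
      proof (cases "j = 0")
        case True
        have "0 < \<rho> * b 1" using b(1)[of 1] \<rho> that by simp
        also have "\<dots> \<le> (g 1)\<^sup>2" using g2[of 1] that by simp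
        finally show ?thesis using True by (simp add: g_def[of 0])
      next
        case False
        have "(g j)\<^sup>2 \<le> 2 * \<rho> * b j" using g2[of j] False that by simp
        also have "\<dots> < \<rho> * b (Suc j)" using b(2)[of j] False that \<rho> by simp
        also have "\<dots> \<le> (g (Suc j))\<^sup>2" using g2[of "Suc j"] that by simp
        finally show ?thesis .
      qed
      then show ?thesis by (simp add: abs_square_less_1 abs_le_square_iff flip: not_le)
    qed
    show "sideinfo_expectation n (sqrt \<rho> * h) f (g j) (sqerror n (e j)) \<le> ennreal (real n * D j)" if "j \<le> K" for j
    proof (cases "j = 0")
      case True
      have "sideinfo_expectation n (sqrt \<rho> * h) f (g 0) (sqerror n (e 0)) = (\<integral>\<^sup>+s. ennreal (sqnorm n s) \<partial>std_normal_vec n)"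
        by (simp add: sideinfo_expectation_def sqerror_def e_def sqnorm_def)
      then show ?thesis using True by (simp add: nn_integral_sqnorm D)
    next
      case False
      then show ?thesis using G[of j] that by (simp add: V_def g_def e_def less_imp_le)
    qed
  qed
  also have "\<dots> \<le> (1 + 2 * \<rho> * bh) * D K * (\<Prod>j<K. 1 + 2 * \<rho> * b (Suc j) * D j)"
  proof (intro mult_mono prod_mono conjI)
    show "1 + (sqrt \<rho> * h)\<^sup>2 \<le> 1 + 2 * \<rho> * bh" using h \<rho> by (simp add: power_mult_distrib mult.left_commute)
    fix j assume j: "j \<in> {..<K}"
    have D0: "D j > 0" using Dpos j by simp
    show "0 \<le> 1 + ((g (Suc j))\<^sup>2 - (g j)\<^sup>2) * D j" using nonneg j by simp
    have "(g (Suc j))\<^sup>2 - (g j)\<^sup>2 \<le> 2 * \<rho> * b (Suc j)" using g2[of "Suc j"] j by (smt (verit) Suc_leI le_add1 lessThan_iff plus_1_eq_Suc zero_le_power2)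
    then show "1 + ((g (Suc j))\<^sup>2 - (g j)\<^sup>2) * D j \<le> 1 + 2 * \<rho> * b (Suc j) * D j"
      using D0 by simp
  qed (use Dpos[of K] \<rho> bh in \<open>auto intro!: prod_nonneg mult_nonneg_nonneg nonneg\<close>)
  finally show ?thesis .
qed

text \<open>If both gains are of order \<open>1 / \<rho>\<close>, both received signals have bounded
  signal-to-noise ratio and the distortion stays bounded away from 0. This has probability of order
  \<open>\<rho> powr (- (Ls + Lc))\<close>.\<close>

lemma EDstar_lower_channel_outage:
  obtains c where "c > 0" "\<And>\<rho>. \<rho> \<ge> 1 \<Longrightarrow> c * \<rho> powr (- (Ls + Lc)) \<le> EDstar \<mu>h \<mu>g \<rho>"
proof -
  obtain ch where ch: "ch > 0" "\<And>b. 0 < b \<Longrightarrow> b \<le> 1 \<Longrightarrow> ennreal (ch * b powr Lc) \<le> emeasure \<mu>h {x. x\<^sup>2 \<in> {b..2 * b}}"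
    using nakagami_dyadic_probability[OF h_law Lc] by blast
  obtain cg where cg: "cg > 0" "\<And>b. 0 < b \<Longrightarrow> b \<le> 1 \<Longrightarrow> ennreal (cg * b powr Ls) \<le> emeasure \<mu>g {x. x\<^sup>2 \<in> {b..2 * b}}"
    using nakagami_dyadic_probability[OF g_law Ls] by blast
  show thesis
  proof
    \<comment> \<open>With one level, channel and side information contribute a factor 3 each; any
      constant above 9 contradicts the converse.\<close>
    show "ch * cg / 10 > 0" using ch cg by simp
    fix \<rho> :: real assume \<rho>: "\<rho> \<ge> 1"
    show "ch * cg / 10 * \<rho> powr (- (Ls + Lc)) \<le> EDstar \<mu>h \<mu>g \<rho>"
    proof (rule EDstar_lower[OF laws], rule ccontr)
      fix n f d assume n: "n > 0" and f: "admissible_encoder n f" and d: "admissible_decoder n d"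
      define \<delta> where "\<delta> = ch * cg / 10 * \<rho> powr (- (Ls + Lc))"
      assume "\<not> ennreal (real n * (ch * cg / 10 * \<rho> powr (- (Ls + Lc)))) \<le> total_distortion n \<rho> \<mu>h \<mu>g f d"
      then have tot: "total_distortion n \<rho> \<mu>h \<mu>g f d < ennreal (real n * \<delta>)" by (simp add: \<delta>_def)
      have \<delta>: "\<delta> > 0" using ch cg \<rho> by (simp add: \<delta>_def)
      define D where "D j = (if j = 0 then 1 else \<delta> / (ch * (1 / \<rho>) powr Lc * (cg * (1 / \<rho>) powr Ls)))" for j :: nat
      have "1 \<le> (1 + 2 * \<rho> * (1 / \<rho>)) * D 1 * (\<Prod>j<1. 1 + 2 * \<rho> * (1 / \<rho>) * D j)"
        by (rule multilevel_converse[OF ch cg n f d, where b = "\<lambda>_. 1 / \<rho>" and \<delta> = \<delta>]) (use \<rho> \<delta> tot in \<open>auto simp: D_def\<close>)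
      moreover have "D 1 = 1 / 10"
      proof -
        have "\<rho> powr (- (Ls + Lc)) = (1 / \<rho>) powr Lc * (1 / \<rho>) powr Ls"
          using \<rho> unfolding powr_minus_divide by (simp add: powr_add powr_divide mult.commute)
        then show ?thesis using ch cg \<rho> by (simp add: D_def \<delta>_def)
      qed
      ultimately show False using \<rho> \<delta> by (simp add: D_def)
    qed
  qed
qed

lemma EDstar_lower_sideinfo:
  assumes \<epsilon>: "\<epsilon> > 0" and \<beta>: "\<beta> = min 1 (1 / Ls)"
  shows "eventually (\<lambda>\<rho>. \<rho> powr (- (2 - \<beta> + \<epsilon>)) \<le> EDstar \<mu>h \<mu>g \<rho>) at_top"
proof -
  obtain ch where ch: "ch > 0" "\<And>b. 0 < b \<Longrightarrow> b \<le> 1 \<Longrightarrow> ennreal (ch * b powr Lc) \<le> emeasure \<mu>h {x. x\<^sup>2 \<in> {b..2 * b}}"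
    using nakagami_dyadic_probability[OF h_law Lc] by blast
  obtain cg where cg: "cg > 0" "\<And>b. 0 < b \<Longrightarrow> b \<le> 1 \<Longrightarrow> ennreal (cg * b powr Ls) \<le> emeasure \<mu>g {x. x\<^sup>2 \<in> {b..2 * b}}"
    using nakagami_dyadic_probability[OF g_law Ls] by blast
  have \<beta>0: "\<beta> > 0" "\<beta> \<le> 1" "Ls * \<beta> \<le> 1" using Ls by (auto simp: \<beta> min_def field_simps)
  \<comment> \<open>The left side is affine in \<open>x\<close>, so the endpoints decide:
    \<open>\<beta> \<le> 1\<close> is needed at 0 and \<open>Ls * \<beta> \<le> 1\<close> at
    \<open>\<beta>\<close>. These two conditions are the origin of
    \<open>min 1 (1 / Ls)\<close>.\<close>
  have \<beta>1: "\<beta> - 1 + (Ls - 1) * x \<le> 0" if "0 \<le> x" "x \<le> \<beta>" for x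
  proof (cases "Ls \<ge> 1")
    case True
    have "(Ls - 1) * x \<le> (Ls - 1) * \<beta>" using True that by (intro mult_left_mono) auto
    then show ?thesis using \<beta>0(3) by (simp add: algebra_simps)
  next
    case False
    then have "(Ls - 1) * x \<le> 0" using that by (simp add: mult_nonpos_nonneg)
    then show ?thesis using \<beta>0 by simp
  qed
  obtain m0 :: nat where m0: "\<beta> / \<epsilon> < real m0" using reals_Archimedean2 by blast
  define m where "m = Suc m0"
  \<comment> \<open>Passing to the next grid point loses \<open>\<eta>\<close> in the exponent,
    which the margin \<open>\<epsilon>\<close> has to absorb; \<open>m\<close> is a successor, so
    the division is harmless.\<close>
  define \<eta> where "\<eta> = \<beta> / real m"
  have \<eta>: "\<eta> > 0" "\<eta> \<le> \<epsilon>" "real m * \<eta> = \<beta>"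
  proof -
    have "\<beta> / \<epsilon> < real m" using m0 by (simp add: m_def)
    then show "\<eta> \<le> \<epsilon>" using \<epsilon> by (simp add: \<eta>_def m_def field_simps)
  qed (use \<beta>0 in \<open>auto simp: \<eta>_def m_def\<close>)
  define C where "C = 1 / (ch * cg)"
  have C: "C > 0" using ch cg by (simp add: C_def)
  define E where "E = 2 - \<beta> + \<epsilon>"
  have "eventually (\<lambda>\<rho>. \<rho> \<ge> 1 \<and> 2 < \<rho> powr \<eta> \<and> 9 * C * (1 + 2 * C) ^ m < \<rho> powr \<epsilon>) at_top"
    using eventually_ge_at_top[of "1::real"] eventually_powr_gt[OF \<eta>(1)] eventually_powr_gt[OF \<epsilon>]
    by (auto intro!: eventually_conj)
  then show ?thesis
  proof eventually_elim
    case (elim \<rho>)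
    then have \<rho>: "\<rho> \<ge> 1" "2 < \<rho> powr \<eta>" "9 * C * (1 + 2 * C) ^ m < \<rho> powr \<epsilon>" by auto
    show ?case
    proof (rule EDstar_lower[OF laws], rule ccontr)
      fix n f d assume n: "n > 0" and f: "admissible_encoder n f" and d: "admissible_decoder n d"
      define \<delta> where "\<delta> = \<rho> powr (- E)"
      assume "\<not> ennreal (real n * \<rho> powr (- (2 - \<beta> + \<epsilon>))) \<le> total_distortion n \<rho> \<mu>h \<mu>g f d"
      then have tot: "total_distortion n \<rho> \<mu>h \<mu>g f d < ennreal (real n * \<delta>)" by (simp add: \<delta>_def E_def)
      have \<delta>: "\<delta> > 0" using \<rho> by (simp add: \<delta>_def)
      \<comment> \<open>\<open>B 1 = \<beta>\<close> is the weakest level used and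
        \<open>B (Suc m) = 0\<close> the typical one.\<close>
      define B where "B j = \<eta> * (real (Suc m) - real j)" for j
      define b where "b j = \<rho> powr (- B j)" for j
      define D where "D j = (if j = 0 then 1 else \<delta> / (ch * 1 powr Lc * (cg * b j powr Ls)))" for j :: nat
      have B: "0 \<le> B j" "B j \<le> \<beta>" if "1 \<le> j" "j \<le> Suc m" for j
      proof -
        show "0 \<le> B j" using that \<eta> by (simp add: B_def)
        have "B j \<le> \<eta> * real m" unfolding B_def using that \<eta> by (intro mult_left_mono) auto
        then show "B j \<le> \<beta>" using \<eta>(3) by (simp add: mult.commute)
      qed
      have BS: "B (Suc j) = B j - \<eta>" for j by (simp add: B_def algebra_simps)
      \<comment> \<open>The channel gain is taken from the typical shell
        \<open>bh = 1\<close>.\<close>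
      have "1 \<le> (1 + 2 * \<rho> * 1) * D (Suc m) * (\<Prod>j<Suc m. 1 + 2 * \<rho> * b (Suc j) * D j)"
      proof (rule multilevel_converse[OF ch cg n f d, where \<delta> = \<delta>])
        show "0 < b j \<and> b j \<le> 1" if "1 \<le> j" "j \<le> Suc m" for j
        proof -
          have "b j \<le> \<rho> powr 0" unfolding b_def using B[OF that] \<rho> by (intro powr_mono) auto
          then show ?thesis using \<rho> by (simp add: b_def)
        qed
        show "2 * b j < b (Suc j)" if "1 \<le> j" "j < Suc m" for j
        proof -
          have "b (Suc j) = \<rho> powr \<eta> * b j" by (simp add: b_def BS powr_add[symmetric])
          moreover have "b j > 0" using \<rho> by (simp add: b_def)
          ultimately show ?thesis using \<rho> by simp
        qed
      qed (use \<rho> \<delta> tot in \<open>auto simp: D_def\<close>)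
      \<comment> \<open>The jump from no side information to the weakest level gives the power of
        \<rho> with exponent \<open>1 - \<beta>\<close>; each of the \<open>m\<close> later factors
        is bounded by \<open>1 + 2 * C\<close>.\<close>
      also have "\<dots> \<le> (3 * \<rho>) * (C * \<rho> powr (- E)) * ((3 * \<rho> powr (1 - \<beta>)) * (1 + 2 * C) ^ m)"
      proof (intro mult_mono)
        have Dj: "D j = C * \<rho> powr (Ls * B j - E)" if "j \<ge> 1" for j
        proof -
          have "b j powr Ls = \<rho> powr (- (Ls * B j))" by (simp add: b_def powr_powr mult.commute)
          then have "D j = C * (\<rho> powr (- E) / \<rho> powr (- (Ls * B j)))"
            using that \<rho> by (simp add: D_def \<delta>_def C_def)
          then show ?thesis using \<rho> by (simp add: powr_diff[symmetric])
        qed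
        show "D (Suc m) \<le> C * \<rho> powr (- E)" by (simp add: Dj B_def)
        have "(\<Prod>j<Suc m. 1 + 2 * \<rho> * b (Suc j) * D j) = (1 + 2 * \<rho> * b 1 * D 0) * (\<Prod>j<m. 1 + 2 * \<rho> * b (Suc (Suc j)) * D (Suc j))"
          by (subst prod.lessThan_Suc_shift) simp
        also have "\<dots> \<le> (3 * \<rho> powr (1 - \<beta>)) * (\<Prod>j<m. 1 + 2 * C)"
        proof (intro mult_mono prod_mono conjI)
          have "B 1 = \<beta>" using \<eta>(3) by (simp add: B_def mult.commute)
          then have "\<rho> * b 1 = \<rho> powr (1 - \<beta>)" using \<rho> by (simp add: b_def powr_diff powr_minus field_simps)
          moreover have "1 \<le> \<rho> powr (1 - \<beta>)" using \<rho> \<beta>0 by (intro ge_one_powr_ge_zero) auto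
          ultimately show "1 + 2 * \<rho> * b 1 * D 0 \<le> 3 * \<rho> powr (1 - \<beta>)" by (simp add: D_def mult.assoc)
          fix j assume j: "j \<in> {..<m}"
          have "\<rho> * b (Suc (Suc j)) * D (Suc j) = C * \<rho> powr (1 - B (Suc (Suc j)) + (Ls * B (Suc j) - E))"
            using \<rho> by (simp add: Dj b_def powr_add powr_diff powr_minus field_simps)
          \<comment> \<open>\<open>\<beta>1\<close> makes the first bracket nonpositive and the
            fineness of the grid the second.\<close>
          also have "1 - B (Suc (Suc j)) + (Ls * B (Suc j) - E) = (\<beta> - 1 + (Ls - 1) * B (Suc j)) + (\<eta> - \<epsilon>)"
            by (simp add: BS[of "Suc j"] E_def algebra_simps)
          also have "C * \<rho> powr ((\<beta> - 1 + (Ls - 1) * B (Suc j)) + (\<eta> - \<epsilon>)) \<le> C * \<rho> powr 0"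
            using \<beta>1[of "B (Suc j)"] B[of "Suc j"] j \<eta> \<rho> C by (intro mult_left_mono powr_mono) auto
          finally show "1 + 2 * \<rho> * b (Suc (Suc j)) * D (Suc j) \<le> 1 + 2 * C" using \<rho> by (simp add: mult.assoc)
          show "0 \<le> 1 + 2 * \<rho> * b (Suc (Suc j)) * D (Suc j)"
            using \<rho> C by (auto simp: Dj b_def intro!: add_nonneg_nonneg mult_nonneg_nonneg)
        qed (use C \<rho> in \<open>auto simp: Dj b_def intro!: prod_nonneg add_nonneg_nonneg mult_nonneg_nonneg\<close>)
        finally show "(\<Prod>j<Suc m. 1 + 2 * \<rho> * b (Suc j) * D j) \<le> (3 * \<rho> powr (1 - \<beta>)) * (1 + 2 * C) ^ m" by simp
        show "0 \<le> (\<Prod>j<Suc m. 1 + 2 * \<rho> * b (Suc j) * D j)"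
          using \<rho> C \<delta> ch cg by (intro prod_nonneg) (auto simp: D_def b_def intro!: add_nonneg_nonneg mult_nonneg_nonneg divide_nonneg_nonneg)
        show "0 \<le> D (Suc m)" using C by (simp add: Dj)
      qed (use \<rho> C in auto)
      also have "\<dots> = 9 * C * (1 + 2 * C) ^ m * (\<rho> * \<rho> powr (- E) * \<rho> powr (1 - \<beta>))" by simp
      also have "\<rho> * \<rho> powr (- E) * \<rho> powr (1 - \<beta>) = \<rho> powr (1 + (- E) + (1 - \<beta>))"
      proof -
        have "\<rho> powr 1 = \<rho>" using \<rho> by simp
        then show ?thesis by (simp only: powr_add)
      qed
      also have "1 + (- E) + (1 - \<beta>) = - \<epsilon>" by (simp add: E_def)
      also have "9 * C * (1 + 2 * C) ^ m * \<rho> powr (- \<epsilon>) < \<rho> powr \<epsilon> * \<rho> powr (- \<epsilon>)"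
        using \<rho> by (intro mult_strict_right_mono) auto
      also have "\<rho> powr \<epsilon> * \<rho> powr (- \<epsilon>) = 1" using \<rho> by (simp add: powr_add[symmetric])
      finally show False by simp
    qed
  qed
qed

end

section \<open>Scalar codes\<close>

declare One_nat_def [simp del]

lemma lessThan_1: "{..<1} = {0::nat}"
  by auto

text \<open>Polynomial moments of every order take the place of Gaussian tail bounds: a failure that
  forces the noise energy above a threshold may be charged any power of their ratio.\<close>

lemma nn_integral_polynomial_noise_finite:
  "(\<integral>\<^sup>+s. \<integral>\<^sup>+w. \<integral>\<^sup>+z. ennreal ((1 + (s 0)\<^sup>2 + (w 0)\<^sup>2 + (z 0)\<^sup>2) ^ q)
      \<partial>std_normal_vec 1 \<partial>std_normal_vec 1 \<partial>std_normal_vec 1) < \<top>"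
proof -
  let ?\<mu> = "std_normal_vec 1"
  have c0 [measurable]: "(\<lambda>x. x 0) \<in> borel_measurable (vec_space 1)" by (rule measurable_vec_component) simp
  have bound: "(1 + a\<^sup>2 + b\<^sup>2 + c\<^sup>2) ^ q \<le> 4 ^ q * (1 + a ^ (2 * q) + b ^ (2 * q) + c ^ (2 * q))" for a b c :: real
  proof -
    define m where "m = max (max 1 (a\<^sup>2)) (max (b\<^sup>2) (c\<^sup>2))"
    have m: "1 \<le> m" "a\<^sup>2 \<le> m" "b\<^sup>2 \<le> m" "c\<^sup>2 \<le> m" by (auto simp: m_def)
    have "(1 + a\<^sup>2 + b\<^sup>2 + c\<^sup>2) ^ q \<le> (4 * m) ^ q" using m by (intro power_mono) auto
    also have "\<dots> = 4 ^ q * m ^ q" by (simp add: power_mult_distrib)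
    also have "m ^ q \<le> 1 + a ^ (2 * q) + b ^ (2 * q) + c ^ (2 * q)"
    proof -
      have "m = 1 \<or> m = a\<^sup>2 \<or> m = b\<^sup>2 \<or> m = c\<^sup>2" by (auto simp: m_def max_def)
      moreover have "0 \<le> a ^ (2 * q)" "0 \<le> b ^ (2 * q)" "0 \<le> c ^ (2 * q)" by (simp_all add: power_mult)
      ultimately show ?thesis by (auto simp: power_mult)
    qed
    finally show ?thesis by simp
  qed
  define M where "M = (fact (2 * q) / (2 ^ q * fact q) :: real)"
  have mom: "(\<integral>\<^sup>+x. ennreal ((x 0) ^ (2 * q)) \<partial>?\<mu>) = ennreal M"
    unfolding M_def nn_integral_std_normal_even_moment[symmetric]
    by (rule nn_integral_std_normal_vec_component[where f = "\<lambda>x. ennreal (x ^ (2 * q))"]) auto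
  have pos: "0 \<le> x ^ (2 * q)" for x :: real by (simp add: power_mult)
  have "(\<integral>\<^sup>+s. \<integral>\<^sup>+w. \<integral>\<^sup>+z. ennreal ((1 + (s 0)\<^sup>2 + (w 0)\<^sup>2 + (z 0)\<^sup>2) ^ q) \<partial>?\<mu> \<partial>?\<mu> \<partial>?\<mu>)
     \<le> (\<integral>\<^sup>+s. \<integral>\<^sup>+w. \<integral>\<^sup>+z. ennreal (4 ^ q) * (1 + ennreal ((s 0) ^ (2 * q)) + ennreal ((w 0) ^ (2 * q)) + ennreal ((z 0) ^ (2 * q))) \<partial>?\<mu> \<partial>?\<mu> \<partial>?\<mu>)"
  proof (intro nn_integral_mono)
    fix s w z :: "nat \<Rightarrow> real"
    have "ennreal ((1 + (s 0)\<^sup>2 + (w 0)\<^sup>2 + (z 0)\<^sup>2) ^ q) \<le> ennreal (4 ^ q * (1 + (s 0) ^ (2 * q) + (w 0) ^ (2 * q) + (z 0) ^ (2 * q)))"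
      by (intro ennreal_leI bound)
    also have "\<dots> = ennreal (4 ^ q) * (1 + ennreal ((s 0) ^ (2 * q)) + ennreal ((w 0) ^ (2 * q)) + ennreal ((z 0) ^ (2 * q)))"
      using pos by (simp add: ennreal_mult' add_nonneg_nonneg)
    finally show "ennreal ((1 + (s 0)\<^sup>2 + (w 0)\<^sup>2 + (z 0)\<^sup>2) ^ q)
       \<le> ennreal (4 ^ q) * (1 + ennreal ((s 0) ^ (2 * q)) + ennreal ((w 0) ^ (2 * q)) + ennreal ((z 0) ^ (2 * q)))" .
  qed
  also have "\<dots> = ennreal (4 ^ q) * (1 + ennreal M + ennreal M + ennreal M)"
    using emeasure_std_normal_vec_space[of 1]
    by (simp add: nn_integral_cmult nn_integral_add mom)
  also have "\<dots> < \<top>" by (simp add: ennreal_mult_less_top)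
  finally show ?thesis .
qed

definition scalar_encoder :: "(real \<Rightarrow> real) \<Rightarrow> (nat \<Rightarrow> real) \<Rightarrow> (nat \<Rightarrow> real)" where
  "scalar_encoder F s = restrict (\<lambda>_. F (s 0)) {..<1}"

definition scalar_decoder :: "(real \<times> real \<times> real \<times> real \<Rightarrow> real) \<Rightarrow>
    (nat \<Rightarrow> real) \<times> (nat \<Rightarrow> real) \<times> real \<times> real \<Rightarrow> (nat \<Rightarrow> real)" where
  "scalar_decoder G = (\<lambda>(y, t, h, g). restrict (\<lambda>_. G (y 0, t 0, h, g)) {..<1})"

lemma admissible_scalar:
  assumes [measurable]: "F \<in> borel_measurable borel" "G \<in> borel_measurable (borel \<Otimes>\<^sub>M (borel \<Otimes>\<^sub>M (borel \<Otimes>\<^sub>M borel)))"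
    and "(\<integral>\<^sup>+x. ennreal ((F x)\<^sup>2) \<partial>std_normal) \<le> 1"
  shows "admissible_encoder 1 (scalar_encoder F)" "admissible_decoder 1 (scalar_decoder G)"
proof -
  have c0 [measurable]: "(\<lambda>x. x 0) \<in> borel_measurable (vec_space 1)" by (rule measurable_vec_component) simp
  have "(\<integral>\<^sup>+s. ennreal ((F (s 0))\<^sup>2) \<partial>std_normal_vec 1) = (\<integral>\<^sup>+x. ennreal ((F x)\<^sup>2) \<partial>std_normal)"
    by (rule nn_integral_std_normal_vec_component[where f = "\<lambda>x. ennreal ((F x)\<^sup>2)"]) auto
  moreover have "scalar_encoder F \<in> vec_space 1 \<rightarrow>\<^sub>M vec_space 1"
    unfolding scalar_encoder_def by (rule measurable_vecI) measurable
  ultimately show "admissible_encoder 1 (scalar_encoder F)"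
    using assms(3) by (simp add: admissible_encoder_def scalar_encoder_def lessThan_1)
  show "admissible_decoder 1 (scalar_decoder G)"
    unfolding admissible_decoder_def dec_input_space_def scalar_decoder_def split_beta'
    by (rule measurable_vecI) measurable
qed

context nakagami_pair
begin

text \<open>Template for all upper bounds: by independence, a pointwise error bound of this product
  form integrates to products of finite moments. \<open>C\<close> is fixed before
  \<open>\<rho>\<close>, the code and the coefficients, so the whole dependence on the
  signal-to-noise ratio sits in the \<open>c k\<close>.\<close>

lemma EDstar_upper_scalar:
  fixes a b :: "nat \<Rightarrow> real" and q N :: nat
  assumes ab: "\<And>k. k < N \<Longrightarrow> a k < Lc" "\<And>k. k < N \<Longrightarrow> b k < Ls"
  obtains C where "C \<ge> 0"
    "\<And>\<rho> c F G. F \<in> borel_measurable borel \<Longrightarrow> G \<in> borel_measurable (borel \<Otimes>\<^sub>M (borel \<Otimes>\<^sub>M (borel \<Otimes>\<^sub>M borel))) \<Longrightarrow>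
       (\<integral>\<^sup>+x. ennreal ((F x)\<^sup>2) \<partial>std_normal) \<le> 1 \<Longrightarrow> (\<And>k. k < N \<Longrightarrow> 0 \<le> c k) \<Longrightarrow>
       (\<And>s w z h g. h \<noteq> 0 \<Longrightarrow> g \<noteq> 0 \<Longrightarrow>
         (s - G (sqrt \<rho> * h * F s + w, sqrt \<rho> * g * s + z, sqrt \<rho> * h, sqrt \<rho> * g))\<^sup>2
           \<le> (1 + s\<^sup>2 + w\<^sup>2 + z\<^sup>2) ^ q * (\<Sum>k<N. c k * ((h\<^sup>2) powr (- a k) * (g\<^sup>2) powr (- b k)))) \<Longrightarrow>
       EDstar \<mu>h \<mu>g \<rho> \<le> C * (\<Sum>k<N. c k)"
proof -
  let ?\<mu> = "std_normal_vec 1"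
  note [measurable_cong] = laws(2,4)
  interpret H: prob_space \<mu>h by (rule laws)
  interpret G: prob_space \<mu>g by (rule laws)
  define R where "R s w z = (1 + s\<^sup>2 + w\<^sup>2 + z\<^sup>2) ^ q" for s w z :: real
  define M0 where "M0 = enn2real (\<integral>\<^sup>+s. \<integral>\<^sup>+w. \<integral>\<^sup>+z. ennreal (R (s 0) (w 0) (z 0)) \<partial>?\<mu> \<partial>?\<mu> \<partial>?\<mu>)"
  have M0: "M0 \<ge> 0" "(\<integral>\<^sup>+s. \<integral>\<^sup>+w. \<integral>\<^sup>+z. ennreal (R (s 0) (w 0) (z 0)) \<partial>?\<mu> \<partial>?\<mu> \<partial>?\<mu>) = ennreal M0"
    using nn_integral_polynomial_noise_finite[of q] by (auto simp: M0_def R_def)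
  have "\<exists>M\<ge>0. (\<integral>\<^sup>+x. ennreal ((x\<^sup>2) powr (- a k)) \<partial>\<mu>h) = ennreal M" if "k < N" for k
    using nakagami_negative_moment[OF h_law Lc ab(1)[OF that]] by blast
  then obtain mh where mh: "\<And>k. k < N \<Longrightarrow> mh k \<ge> 0 \<and> (\<integral>\<^sup>+x. ennreal ((x\<^sup>2) powr (- a k)) \<partial>\<mu>h) = ennreal (mh k)"
    by metis
  have "\<exists>M\<ge>0. (\<integral>\<^sup>+x. ennreal ((x\<^sup>2) powr (- b k)) \<partial>\<mu>g) = ennreal M" if "k < N" for k
    using nakagami_negative_moment[OF g_law Ls ab(2)[OF that]] by blast
  then obtain mg where mg: "\<And>k. k < N \<Longrightarrow> mg k \<ge> 0 \<and> (\<integral>\<^sup>+x. ennreal ((x\<^sup>2) powr (- b k)) \<partial>\<mu>g) = ennreal (mg k)"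
    by metis
  define S where "S = (\<Sum>k<N. mh k * mg k)"
  have S: "mh k * mg k \<le> S" if "k < N" for k
    unfolding S_def using that mh mg by (intro member_le_sum) auto
  have S0: "S \<ge> 0" unfolding S_def using mh mg by (intro sum_nonneg) auto
  show thesis
  proof
    show "0 \<le> M0 * S" using M0 S0 by simp
    fix \<rho> c F G
    assume F [measurable]: "F \<in> borel_measurable borel" and G [measurable]: "G \<in> borel_measurable (borel \<Otimes>\<^sub>M (borel \<Otimes>\<^sub>M (borel \<Otimes>\<^sub>M borel)))"
      and pow: "(\<integral>\<^sup>+x. ennreal ((F x)\<^sup>2) \<partial>std_normal) \<le> 1" and c: "\<And>k. k < N \<Longrightarrow> 0 \<le> c k"
      and err: "\<And>s w z h g. h \<noteq> 0 \<Longrightarrow> g \<noteq> 0 \<Longrightarrow>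
         (s - G (sqrt \<rho> * h * F s + w, sqrt \<rho> * g * s + z, sqrt \<rho> * h, sqrt \<rho> * g))\<^sup>2
           \<le> (1 + s\<^sup>2 + w\<^sup>2 + z\<^sup>2) ^ q * (\<Sum>k<N. c k * ((h\<^sup>2) powr (- a k) * (g\<^sup>2) powr (- b k)))"
    define Q where "Q h g = (\<Sum>k<N. c k * ((h\<^sup>2) powr (- a k) * (g\<^sup>2) powr (- b k)))" for h g :: real
    have Q0: "Q h g \<ge> 0" for h g unfolding Q_def by (intro sum_nonneg mult_nonneg_nonneg c) auto
    note adm = admissible_scalar[OF F G pow]
    have V: "sideinfo_expectation 1 (sqrt \<rho> * h) (scalar_encoder F) (sqrt \<rho> * g)
        (sqerror 1 (decoder_at (scalar_decoder G) (sqrt \<rho> * h) (sqrt \<rho> * g))) \<le> ennreal M0 * ennreal (Q h g)"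
      if "h \<noteq> 0" "g \<noteq> 0" for h g
    proof -
      have c0 [measurable]: "(\<lambda>x. x 0) \<in> borel_measurable (vec_space 1)" by (rule measurable_vec_component) simp
      have "sideinfo_expectation 1 (sqrt \<rho> * h) (scalar_encoder F) (sqrt \<rho> * g)
        (sqerror 1 (decoder_at (scalar_decoder G) (sqrt \<rho> * h) (sqrt \<rho> * g)))
        \<le> (\<integral>\<^sup>+s. \<integral>\<^sup>+w. \<integral>\<^sup>+z. ennreal (R (s 0) (w 0) (z 0)) * ennreal (Q h g) \<partial>?\<mu> \<partial>?\<mu> \<partial>?\<mu>)"
        unfolding sideinfo_expectation_def
      proof (intro nn_integral_mono)
        fix s w z :: "nat \<Rightarrow> real"
        have "(s 0 - G (sqrt \<rho> * h * F (s 0) + w 0, sqrt \<rho> * g * s 0 + z 0, sqrt \<rho> * h, sqrt \<rho> * g))\<^sup>2 \<le> R (s 0) (w 0) (z 0) * Q h g"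
          unfolding R_def Q_def by (rule err) fact+
        then show "sqerror 1 (decoder_at (scalar_decoder G) (sqrt \<rho> * h) (sqrt \<rho> * g))
           (s, lincomb 1 (sqrt \<rho> * h) (scalar_encoder F s) 1 w, lincomb 1 (sqrt \<rho> * g) s 1 z) \<le> ennreal (R (s 0) (w 0) (z 0)) * ennreal (Q h g)"
          using Q0 by (simp add: sqerror_def sqnorm_def decoder_at_def scalar_decoder_def scalar_encoder_def lessThan_1
             ennreal_mult''[symmetric] ennreal_leI)
      qed
      also have "\<dots> = ennreal M0 * ennreal (Q h g)"
        unfolding M0(2)[symmetric] by (simp add: nn_integral_multc R_def)
      finally show ?thesis .
    qed
    have "total_distortion 1 \<rho> \<mu>h \<mu>g (scalar_encoder F) (scalar_decoder G) \<le> (\<integral>\<^sup>+h. \<integral>\<^sup>+g. ennreal M0 * ennreal (Q h g) \<partial>\<mu>g \<partial>\<mu>h)"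
      unfolding total_distortion_def
      using nakagami_nonzero_AE[OF h_law] nakagami_nonzero_AE[OF g_law]
      by (intro nn_integral_mono_AE; elim eventually_mono) (auto intro!: nn_integral_mono_AE V elim!: eventually_mono)
    also have "\<dots> = (\<integral>\<^sup>+h. \<integral>\<^sup>+g. (\<Sum>k<N. ennreal (M0 * c k) * (ennreal ((h\<^sup>2) powr (- a k)) * ennreal ((g\<^sup>2) powr (- b k)))) \<partial>\<mu>g \<partial>\<mu>h)"
    proof (intro nn_integral_cong)
      fix h g
      have "M0 * Q h g = (\<Sum>k<N. M0 * c k * ((h\<^sup>2) powr (- a k) * (g\<^sup>2) powr (- b k)))"
        by (simp add: Q_def sum_distrib_left mult.assoc)
      then have "ennreal M0 * ennreal (Q h g) = ennreal (\<Sum>k<N. M0 * c k * ((h\<^sup>2) powr (- a k) * (g\<^sup>2) powr (- b k)))"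
        using M0 by (simp add: ennreal_mult'[symmetric])
      also have "\<dots> = (\<Sum>k<N. ennreal (M0 * c k * ((h\<^sup>2) powr (- a k) * (g\<^sup>2) powr (- b k))))"
        using M0 c by (intro sum_ennreal[symmetric]) auto
      also have "\<dots> = (\<Sum>k<N. ennreal (M0 * c k) * (ennreal ((h\<^sup>2) powr (- a k)) * ennreal ((g\<^sup>2) powr (- b k))))"
        using M0 c by (intro sum.cong refl) (auto simp: ennreal_mult')
      finally show "ennreal M0 * ennreal (Q h g) = \<dots>" .
    qed
    also have "\<dots> = (\<Sum>k<N. ennreal (M0 * c k) * (ennreal (mh k) * ennreal (mg k)))"
      using mh mg by (simp add: nn_integral_sum nn_integral_cmult nn_integral_multc)
    also have "\<dots> = ennreal (\<Sum>k<N. M0 * c k * (mh k * mg k))"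
      using M0 c mh mg by (subst sum_ennreal[symmetric]) (auto intro!: sum.cong simp: ennreal_mult')
    finally have "expected_distortion 1 \<rho> \<mu>h \<mu>g (scalar_encoder F) (scalar_decoder G) \<le> ennreal (\<Sum>k<N. M0 * c k * (mh k * mg k))"
      by (simp add: expected_distortion_eq_total[OF adm laws])
    then have "EDstar \<mu>h \<mu>g \<rho> \<le> (\<Sum>k<N. M0 * c k * (mh k * mg k))"
      using M0 c mh mg by (intro EDstar_upper[OF laws adm]) (auto intro!: sum_nonneg)
    also have "\<dots> \<le> (\<Sum>k<N. M0 * c k * S)"
      using M0 c by (intro sum_mono mult_left_mono S) auto
    also have "\<dots> = M0 * S * (\<Sum>k<N. c k)" by (simp add: sum_distrib_left mult_ac)
    finally show "EDstar \<mu>h \<mu>g \<rho> \<le> M0 * S * (\<Sum>k<N. c k)" .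
  qed
qed

end

section \<open>Decoding errors of the modulo and joint decoding schemes\<close>

text \<open>Irrationality of the square root of 2 by infinite descent: \<open>p\<close> is even,
  hence \<open>m\<close> is even, and halving both gives a smaller solution.\<close>

lemma two_times_square_neq_square:
  "(m::nat) > 0 \<Longrightarrow> 2 * m\<^sup>2 \<noteq> p\<^sup>2"
proof (induction m arbitrary: p rule: less_induct)
  case (less m)
  show ?case
  proof
    assume eq: "2 * m\<^sup>2 = p\<^sup>2"
    then have "even (p\<^sup>2)" by (metis dvd_triv_left)
    then obtain q where q: "p = 2 * q" by auto
    then have m: "m\<^sup>2 = 2 * q\<^sup>2" using eq by (simp add: power2_eq_square)
    then have "q > 0" using less.prems by (cases q) auto
    moreover have "even (m\<^sup>2)" using m by simp
    then obtain r where r: "m = 2 * r" by auto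
    then have "2 * r\<^sup>2 = q\<^sup>2" using m by (simp add: power2_eq_square)
    moreover have "r > 0" "r < m" using r less.prems by auto
    ultimately show False using less.IH[of r q] by simp
  qed
qed

text \<open>\<open>2 * m\<^sup>2 - p\<^sup>2\<close> is a nonzero integer and factors into
  \<open>sqrt 2 * m - p\<close> and its conjugate. If the first factor is below 1 in absolute value,
  the conjugate is at most \<open>3 * \<bar>m\<bar> + 1 \<le> 4 * \<bar>m\<bar>\<close>.\<close>

lemma sqrt2_badly_approximable:
  fixes m p :: int
  assumes "m \<noteq> 0"
  shows "1 / (4 * \<bar>real_of_int m\<bar>) \<le> \<bar>sqrt 2 * real_of_int m - real_of_int p\<bar>"
proof -
  have m1: "\<bar>real_of_int m\<bar> \<ge> 1" using assms by linarith
  show ?thesis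
  proof (cases "\<bar>sqrt 2 * real_of_int m - real_of_int p\<bar> \<ge> 1")
    case True
    have "1 / (4 * \<bar>real_of_int m\<bar>) \<le> 1" using m1 by simp
    then show ?thesis using True by linarith
  next
    case False
    have s2: "sqrt 2 \<le> 3 / 2" by (rule real_le_lsqrt) (auto simp: power2_eq_square)
    have "\<bar>sqrt 2 * real_of_int m\<bar> \<le> 3 / 2 * \<bar>real_of_int m\<bar>"
      unfolding abs_mult using s2 by (intro mult_right_mono) auto
    then have plus: "\<bar>sqrt 2 * real_of_int m + real_of_int p\<bar> \<le> 4 * \<bar>real_of_int m\<bar>"
      using False m1 by linarith
    have "2 * (nat \<bar>m\<bar>)\<^sup>2 \<noteq> (nat \<bar>p\<bar>)\<^sup>2" using assms by (intro two_times_square_neq_square) auto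
    then have "int (2 * (nat \<bar>m\<bar>)\<^sup>2) \<noteq> int ((nat \<bar>p\<bar>)\<^sup>2)" by (simp only: of_nat_eq_iff not_False_eq_True)
    then have "2 * m\<^sup>2 \<noteq> p\<^sup>2" by simp
    then have "1 \<le> \<bar>2 * m\<^sup>2 - p\<^sup>2\<bar>" by linarith
    then have "1 \<le> \<bar>real_of_int (2 * m\<^sup>2 - p\<^sup>2)\<bar>" by linarith
    also have "real_of_int (2 * m\<^sup>2 - p\<^sup>2) = (sqrt 2 * real_of_int m - real_of_int p) * (sqrt 2 * real_of_int m + real_of_int p)"
      by (simp add: algebra_simps power2_eq_square)
    also have "\<bar>\<dots>\<bar> \<le> \<bar>sqrt 2 * real_of_int m - real_of_int p\<bar> * (4 * \<bar>real_of_int m\<bar>)"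
      unfolding abs_mult using plus by (intro mult_left_mono) auto
    finally show ?thesis using m1 by (simp add: field_simps)
  qed
qed

text \<open>Taking fractional parts only changes the integer \<open>p\<close> of the approximation
  bound. The separation depends on the index distance alone, so one encoder serves every quality of
  side information, which it does not know.\<close>

lemma frac_sqrt2_separated:
  fixes i j :: int
  assumes "i \<noteq> j"
  shows "1 / (4 * \<bar>real_of_int (i - j)\<bar>) \<le> \<bar>frac (sqrt 2 * real_of_int i) - frac (sqrt 2 * real_of_int j)\<bar>"
proof -
  have "frac (sqrt 2 * real_of_int i) - frac (sqrt 2 * real_of_int j)
     = sqrt 2 * real_of_int (i - j) - real_of_int (\<lfloor>sqrt 2 * real_of_int i\<rfloor> - \<lfloor>sqrt 2 * real_of_int j\<rfloor>)"
    by (simp add: frac_def algebra_simps)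
  then show ?thesis using sqrt2_badly_approximable[of "i - j"] assms by (simp only: right_minus_eq not_False_eq_True)
qed

text \<open>The rounded quantity is the integer part of \<open>\<xi> * s\<close> plus
  \<open>u = \<xi> * z / g - w / h\<close>. If \<open>u\<close> is below 1/2 in absolute value,
  rounding is exact and only channel noise remains, scaled down by \<open>\<xi>\<close>; otherwise
  the noises are at least of order \<open>sqrt \<tau>\<close>.\<close>

lemma modulo_decoding_error:
  fixes s w z h g \<xi> \<tau> :: real
  assumes \<xi>: "\<xi> \<ge> 1" and \<tau>: "\<tau> \<ge> 1" and h: "\<tau> \<le> h\<^sup>2" and g: "\<xi>\<^sup>2 * \<tau> \<le> g\<^sup>2"
  defines "y \<equiv> h * frac (\<xi> * s) + w" and "t \<equiv> g * s + z"
  defines "e \<equiv> s - (of_int (round (\<xi> * t / g - y / h)) + y / h) / \<xi>"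
  shows "e\<^sup>2 \<le> w\<^sup>2 / (h\<^sup>2 * \<xi>\<^sup>2) \<or> (e\<^sup>2 \<le> 18 * (z\<^sup>2 + w\<^sup>2) \<and> \<tau> \<le> 8 * (z\<^sup>2 + w\<^sup>2))"
proof -
  have h0: "h \<noteq> 0" using h \<tau> by auto
  have "\<xi>\<^sup>2 * \<tau> > 0" using \<tau> \<xi> by simp
  then have g0: "g \<noteq> 0" using g by auto
  define u where "u = \<xi> * z / g - w / h"
  have "\<xi> * t / g - y / h = of_int \<lfloor>\<xi> * s\<rfloor> + u"
    using h0 g0 by (simp add: u_def t_def y_def frac_def field_simps)
  moreover have "round (of_int \<lfloor>\<xi> * s\<rfloor> + u) = \<lfloor>\<xi> * s\<rfloor> + round u"
    using floor_add_int[of "u + 1 / 2" "\<lfloor>\<xi> * s\<rfloor>"] by (simp add: round_def add_ac)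
  ultimately have r: "real_of_int (round (\<xi> * t / g - y / h)) = real_of_int \<lfloor>\<xi> * s\<rfloor> + real_of_int (round u)" by simp
  have "e * \<xi> = - (real_of_int (round u) + w / h)"
    unfolding e_def r using \<xi> h0 by (simp add: y_def frac_def field_simps)
  then have e: "e = - (real_of_int (round u) + w / h) / \<xi>" using \<xi> by (simp add: field_simps)
  show ?thesis
  proof (cases "\<bar>u\<bar> < 1 / 2")
    case True
    then have "0 \<le> u + 1 / 2" "u + 1 / 2 < 1" by linarith+
    then have "round u = 0" by (simp add: round_def floor_eq_iff)
    then have "e\<^sup>2 = w\<^sup>2 / (h\<^sup>2 * \<xi>\<^sup>2)" by (simp add: e power_divide power_mult_distrib)
    then show ?thesis by simp
  next
    case False
    define k where "k = sqrt \<tau>"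
    have k: "k \<ge> 1" "k\<^sup>2 = \<tau>" using \<tau> by (auto simp: k_def)
    have hk: "k \<le> \<bar>h\<bar>" using h \<tau> unfolding k_def by (metis real_sqrt_abs real_sqrt_le_iff)
    have gk: "\<xi> * k \<le> \<bar>g\<bar>"
    proof -
      have "sqrt (\<xi>\<^sup>2 * \<tau>) \<le> sqrt (g\<^sup>2)" using g by (rule real_sqrt_le_mono)
      then show ?thesis using \<xi> by (simp add: real_sqrt_mult k_def)
    qed
    have zg: "\<xi> * \<bar>z / g\<bar> \<le> \<bar>z\<bar> / k"
    proof -
      have "\<xi> * \<bar>z\<bar> * k \<le> \<bar>z\<bar> * \<bar>g\<bar>" using mult_left_mono[OF gk, of "\<bar>z\<bar>"] by (simp add: mult_ac)
      then show ?thesis using k g0 by (simp add: abs_divide field_simps)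
    qed
    have wh: "\<bar>w / h\<bar> \<le> \<bar>w\<bar> / k"
      unfolding abs_divide using hk k h0 by (intro divide_left_mono) auto
    have "\<bar>u\<bar> \<le> \<xi> * \<bar>z / g\<bar> + \<bar>w / h\<bar>"
    proof -
      have "\<bar>\<xi> * z / g\<bar> = \<xi> * \<bar>z / g\<bar>" using \<xi> by (simp add: abs_mult abs_divide)
      then show ?thesis unfolding u_def by linarith
    qed
    then have u: "\<bar>u\<bar> \<le> (\<bar>z\<bar> + \<bar>w\<bar>) / k" using zg wh by (simp add: add_divide_distrib)
    have sq: "(\<bar>z\<bar> + \<bar>w\<bar>)\<^sup>2 \<le> 2 * (z\<^sup>2 + w\<^sup>2)"
      using sum_squares_bound[of "\<bar>z\<bar>" "\<bar>w\<bar>"] by (simp add: power2_sum)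
    have f2: "(2 * x)\<^sup>2 = 4 * x\<^sup>2" "(3 * x)\<^sup>2 = 9 * x\<^sup>2" for x :: real
      by (simp_all add: power_mult_distrib)
    have "1 / 2 \<le> (\<bar>z\<bar> + \<bar>w\<bar>) / k" using u False by linarith
    then have "k \<le> 2 * (\<bar>z\<bar> + \<bar>w\<bar>)" using k by (simp add: field_simps)
    then have "k\<^sup>2 \<le> (2 * (\<bar>z\<bar> + \<bar>w\<bar>))\<^sup>2" using k by (intro power_mono) auto
    then have tau: "\<tau> \<le> 8 * (z\<^sup>2 + w\<^sup>2)" using sq k(2) unfolding f2 by linarith
    \<comment> \<open>Here \<open>\<bar>u\<bar> + 1 / 2 \<le> 2 * \<bar>u\<bar>\<close>; this leads
      to the factor 3, and to 18 after squaring.\<close>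
    have "\<bar>real_of_int (round u)\<bar> \<le> \<bar>u\<bar> + 1 / 2" using of_int_round_abs_le[of u] by linarith
    then have "\<bar>real_of_int (round u) + w / h\<bar> \<le> 2 * ((\<bar>z\<bar> + \<bar>w\<bar>) / k) + \<bar>w\<bar> / k"
      using u False wh by linarith
    also have "\<dots> \<le> 3 * (\<bar>z\<bar> + \<bar>w\<bar>) / k" using k by (simp add: field_simps)
    also have "\<dots> \<le> 3 * (\<bar>z\<bar> + \<bar>w\<bar>) / 1" using k by (intro divide_left_mono) auto
    finally have n: "\<bar>real_of_int (round u) + w / h\<bar> \<le> 3 * (\<bar>z\<bar> + \<bar>w\<bar>)" by simp
    have "\<bar>e\<bar> = \<bar>real_of_int (round u) + w / h\<bar> / \<xi>" using \<xi> by (simp add: e abs_divide)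
    also have "\<dots> \<le> \<bar>real_of_int (round u) + w / h\<bar> / 1" using \<xi> by (intro divide_left_mono) auto
    finally have "\<bar>e\<bar> \<le> 3 * (\<bar>z\<bar> + \<bar>w\<bar>)" using n by simp
    then have "\<bar>e\<bar>\<^sup>2 \<le> (3 * (\<bar>z\<bar> + \<bar>w\<bar>))\<^sup>2" by (intro power_mono) auto
    then have "e\<^sup>2 \<le> 18 * (z\<^sup>2 + w\<^sup>2)"
      using sq unfolding power2_abs f2 by linarith
    then show ?thesis using tau by simp
  qed
qed

text \<open>If both noises are at most \<open>k\<close>, the true index passes the test
  \<open>ok\<close>. Any other passing index is close to it by the side information, hence well
  separated at the channel by \<open>frac_sqrt2_separated\<close>, which \<open>good\<close> makes
  incompatible with the channel tolerance. If a noise exceeds \<open>k\<close>, even a wrong output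
  stays near \<open>t / g\<close>. The choice among passing indices is left open so that a
  measurable one can be made later.\<close>

lemma joint_decoding_error:
  fixes s w z h g \<Delta> k :: real
  assumes \<Delta>: "\<Delta> > 0" and k: "k > 0" and h0: "h \<noteq> 0" and g0: "g \<noteq> 0"
    and good: "16 * k * (1 + k / (\<Delta> * \<bar>g\<bar>)) < \<bar>h\<bar>"
  defines "X \<equiv> (\<lambda>i::int. frac (sqrt 2 * of_int i))"
  defines "y \<equiv> h * X (round (s / \<Delta>)) + w" and "t \<equiv> g * s + z"
  defines "ok \<equiv> (\<lambda>i::int. \<bar>\<Delta> * of_int i - t / g\<bar> \<le> \<Delta> + k / \<bar>g\<bar> \<and> \<bar>X i - y / h\<bar> \<le> k / \<bar>h\<bar>)"
  assumes r: "(\<exists>i. ok i \<and> r = \<Delta> * of_int i) \<or> ((\<nexists>i. ok i) \<and> r = t / g)"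
  shows "(s - r)\<^sup>2 \<le> \<Delta>\<^sup>2 \<or> ((s - r)\<^sup>2 \<le> 3 * (\<Delta>\<^sup>2 + (k\<^sup>2 + z\<^sup>2) / g\<^sup>2) \<and> k\<^sup>2 \<le> z\<^sup>2 + w\<^sup>2)"
proof -
  define i0 where "i0 = round (s / \<Delta>)"
  have i0: "\<bar>\<Delta> * of_int i0 - s\<bar> \<le> \<Delta>"
  proof -
    have "\<bar>of_int i0 - s / \<Delta>\<bar> \<le> 1 / 2" unfolding i0_def by (rule of_int_round_abs_le)
    then have "\<Delta> * \<bar>of_int i0 - s / \<Delta>\<bar> \<le> \<Delta> * 1" using \<Delta> by (intro mult_left_mono) auto
    then have "\<bar>\<Delta> * (of_int i0 - s / \<Delta>)\<bar> \<le> \<Delta>" using \<Delta> by (simp add: abs_mult)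
    then show ?thesis using \<Delta> by (simp add: right_diff_distrib)
  qed
  have tg: "t / g = s + z / g" using g0 by (simp add: t_def field_simps)
  have yh: "y / h = X i0 + w / h" using h0 by (simp add: y_def i0_def field_simps)
  show ?thesis
  proof (cases "\<bar>z\<bar> \<le> k \<and> \<bar>w\<bar> \<le> k")
    case True
    have zg: "\<bar>z / g\<bar> \<le> k / \<bar>g\<bar>" unfolding abs_divide using True by (intro divide_right_mono) auto
    have wh: "\<bar>w / h\<bar> \<le> k / \<bar>h\<bar>" unfolding abs_divide using True by (intro divide_right_mono) auto
    have ok0: "ok i0" unfolding ok_def tg yh using zg wh i0 by (intro conjI) linarith+
    have tri: "\<bar>a - b\<bar> \<le> 2 * c" if "\<bar>a - d\<bar> \<le> c" "\<bar>b - d\<bar> \<le> c" for a b c d :: real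
      using that by linarith
    have uniq: "i = i0" if "ok i" for i
    proof (rule ccontr)
      assume "i \<noteq> i0"
      define d where "d = \<bar>real_of_int (i - i0)\<bar>"
      have d1: "d \<ge> 1" using \<open>i \<noteq> i0\<close> unfolding d_def by linarith
      have "\<bar>\<Delta> * of_int i - \<Delta> * of_int i0\<bar> \<le> 2 * (\<Delta> + k / \<bar>g\<bar>)"
        using conjunct1[OF that[unfolded ok_def]] conjunct1[OF ok0[unfolded ok_def]] by (rule tri)
      then have "\<Delta> * d \<le> 2 * (\<Delta> + k / \<bar>g\<bar>)"
        using \<Delta> by (simp add: d_def abs_mult right_diff_distrib[symmetric])
      then have d2: "d \<le> 2 * (1 + k / (\<Delta> * \<bar>g\<bar>))" using \<Delta> g0 by (simp add: field_simps)
      have "1 / (4 * d) \<le> \<bar>X i - X i0\<bar>" unfolding d_def X_def by (rule frac_sqrt2_separated) fact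
      also have "\<dots> \<le> 2 * (k / \<bar>h\<bar>)"
        using conjunct2[OF that[unfolded ok_def]] conjunct2[OF ok0[unfolded ok_def]] by (rule tri)
      \<comment> \<open>The 4 of the separation bound times two tolerances; the bound on
        \<open>d\<close> doubles this to the 16 in \<open>good\<close>.\<close>
      finally have "\<bar>h\<bar> \<le> 8 * k * d" using d1 h0 by (simp add: field_simps)
      also have "\<dots> \<le> 8 * k * (2 * (1 + k / (\<Delta> * \<bar>g\<bar>)))" using k d2 by (intro mult_left_mono) auto
      also have "\<dots> = 16 * k * (1 + k / (\<Delta> * \<bar>g\<bar>))" by simp
      finally show False using good by linarith
    qed
    have "r = \<Delta> * of_int i0" using r
    proof
      assume "\<exists>i. ok i \<and> r = \<Delta> * of_int i"
      then obtain i where "ok i" "r = \<Delta> * of_int i" by blast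
      then show ?thesis using uniq by simp
    next
      assume "(\<nexists>i. ok i) \<and> r = t / g"
      then show ?thesis using ok0 by blast
    qed
    then have "\<bar>s - r\<bar> \<le> \<Delta>" using i0 by (simp add: abs_minus_commute)
    then have "\<bar>s - r\<bar>\<^sup>2 \<le> \<Delta>\<^sup>2" by (intro power_mono) auto
    then show ?thesis by simp
  next
    case False
    have "k\<^sup>2 \<le> z\<^sup>2 + w\<^sup>2"
    proof -
      consider "k \<le> \<bar>z\<bar>" | "k \<le> \<bar>w\<bar>" using False by linarith
      then show ?thesis
      proof cases
        case 1
        then have "k\<^sup>2 \<le> \<bar>z\<bar>\<^sup>2" using k by (intro power_mono) simp_all
        then show ?thesis by (simp add: add_increasing2)
      next
        case 2
        then have "k\<^sup>2 \<le> \<bar>w\<bar>\<^sup>2" using k by (intro power_mono) simp_all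
        then show ?thesis by (simp add: add_increasing)
      qed
    qed
    moreover have "\<bar>r - t / g\<bar> \<le> \<Delta> + k / \<bar>g\<bar>"
      using r
    proof
      assume "\<exists>i. ok i \<and> r = \<Delta> * of_int i"
      then show ?thesis unfolding ok_def by blast
    next
      assume "(\<nexists>i. ok i) \<and> r = t / g"
      then show ?thesis using k \<Delta> by simp
    qed
    then have "\<bar>s - r\<bar> \<le> \<Delta> + k / \<bar>g\<bar> + \<bar>z / g\<bar>" unfolding tg by linarith
    then have "\<bar>s - r\<bar>\<^sup>2 \<le> (\<Delta> + k / \<bar>g\<bar> + \<bar>z / g\<bar>)\<^sup>2" by (intro power_mono) auto
    moreover have "(a + b + c)\<^sup>2 \<le> 3 * (a\<^sup>2 + b\<^sup>2 + c\<^sup>2)" for a b c :: real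
      using sum_squares_bound[of a b] sum_squares_bound[of b c] sum_squares_bound[of a c]
      by (simp add: power2_eq_square algebra_simps)
    then have "(\<Delta> + k / \<bar>g\<bar> + \<bar>z / g\<bar>)\<^sup>2 \<le> 3 * (\<Delta>\<^sup>2 + (k / \<bar>g\<bar>)\<^sup>2 + \<bar>z / g\<bar>\<^sup>2)" .
    then have "(\<Delta> + k / \<bar>g\<bar> + \<bar>z / g\<bar>)\<^sup>2 \<le> 3 * (\<Delta>\<^sup>2 + (k\<^sup>2 + z\<^sup>2) / g\<^sup>2)"
      by (simp add: power_divide add_divide_distrib)
    ultimately show ?thesis by simp
  qed
qed

section \<open>Upper bounds on the optimal distortion\<close>

context nakagami_pair
begin

lemma EDstar_upper_scalar4:
  fixes a1 a2 a3 a4 b1 b2 b3 b4 :: real and q :: nat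
  assumes "a1 < Lc" "a2 < Lc" "a3 < Lc" "a4 < Lc" "b1 < Ls" "b2 < Ls" "b3 < Ls" "b4 < Ls"
  obtains C where "C \<ge> 0"
    "\<And>\<rho> c1 c2 c3 c4 F G. F \<in> borel_measurable borel \<Longrightarrow> G \<in> borel_measurable (borel \<Otimes>\<^sub>M (borel \<Otimes>\<^sub>M (borel \<Otimes>\<^sub>M borel))) \<Longrightarrow>
       (\<integral>\<^sup>+x. ennreal ((F x)\<^sup>2) \<partial>std_normal) \<le> 1 \<Longrightarrow> 0 \<le> c1 \<Longrightarrow> 0 \<le> c2 \<Longrightarrow> 0 \<le> c3 \<Longrightarrow> 0 \<le> c4 \<Longrightarrow>
       (\<And>s w z h g. h \<noteq> 0 \<Longrightarrow> g \<noteq> 0 \<Longrightarrow>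
         (s - G (sqrt \<rho> * h * F s + w, sqrt \<rho> * g * s + z, sqrt \<rho> * h, sqrt \<rho> * g))\<^sup>2
           \<le> (1 + s\<^sup>2 + w\<^sup>2 + z\<^sup>2) ^ q * (c1 * ((h\<^sup>2) powr (- a1) * (g\<^sup>2) powr (- b1)) + c2 * ((h\<^sup>2) powr (- a2) * (g\<^sup>2) powr (- b2))
              + c3 * ((h\<^sup>2) powr (- a3) * (g\<^sup>2) powr (- b3)) + c4 * ((h\<^sup>2) powr (- a4) * (g\<^sup>2) powr (- b4)))) \<Longrightarrow>
       EDstar \<mu>h \<mu>g \<rho> \<le> C * (c1 + c2 + c3 + c4)"
proof -
  have less4: "k < 4 \<longleftrightarrow> k = 0 \<or> k = 1 \<or> k = 2 \<or> k = (3::nat)" for k by auto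
  have sum4: "(\<Sum>k<4. f k) = f 0 + f 1 + f 2 + f (3::nat)" for f :: "nat \<Rightarrow> real"
    by (simp add: eval_nat_numeral One_nat_def)
  define sel where "sel x0 x1 x2 x3 k = (if k = 0 then x0 else if k = 1 then x1 else if k = 2 then x2 else x3)"
    for x0 x1 x2 x3 :: real and k :: nat
  have sel: "sel x0 x1 x2 x3 0 = x0" "sel x0 x1 x2 x3 1 = x1" "sel x0 x1 x2 x3 2 = x2" "sel x0 x1 x2 x3 3 = x3" for x0 x1 x2 x3
    by (auto simp: sel_def)
  have A: "\<And>k. k < 4 \<Longrightarrow> sel a1 a2 a3 a4 k < Lc" and B: "\<And>k. k < 4 \<Longrightarrow> sel b1 b2 b3 b4 k < Ls"
    using assms by (auto simp: less4 sel)
  obtain C where C: "C \<ge> 0"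
    "\<And>\<rho> c F G. F \<in> borel_measurable borel \<Longrightarrow> G \<in> borel_measurable (borel \<Otimes>\<^sub>M (borel \<Otimes>\<^sub>M (borel \<Otimes>\<^sub>M borel))) \<Longrightarrow>
       (\<integral>\<^sup>+x. ennreal ((F x)\<^sup>2) \<partial>std_normal) \<le> 1 \<Longrightarrow> (\<And>k. k < 4 \<Longrightarrow> 0 \<le> c k) \<Longrightarrow>
       (\<And>s w z h g. h \<noteq> 0 \<Longrightarrow> g \<noteq> 0 \<Longrightarrow>
         (s - G (sqrt \<rho> * h * F s + w, sqrt \<rho> * g * s + z, sqrt \<rho> * h, sqrt \<rho> * g))\<^sup>2
           \<le> (1 + s\<^sup>2 + w\<^sup>2 + z\<^sup>2) ^ q * (\<Sum>k<4. c k * ((h\<^sup>2) powr (- sel a1 a2 a3 a4 k) * (g\<^sup>2) powr (- sel b1 b2 b3 b4 k)))) \<Longrightarrow>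
       EDstar \<mu>h \<mu>g \<rho> \<le> C * (\<Sum>k<4. c k)"
    using EDstar_upper_scalar[of 4 "sel a1 a2 a3 a4" "sel b1 b2 b3 b4" q, OF A B] by blast
  show thesis
  proof (rule that[OF C(1)])
    fix \<rho> c1 c2 c3 c4 F G
    assume *: "F \<in> borel_measurable borel" "G \<in> borel_measurable (borel \<Otimes>\<^sub>M (borel \<Otimes>\<^sub>M (borel \<Otimes>\<^sub>M borel)))"
       "(\<integral>\<^sup>+x. ennreal ((F x)\<^sup>2) \<partial>std_normal) \<le> 1" "0 \<le> c1" "0 \<le> c2" "0 \<le> c3" "0 \<le> c4"
       "\<And>s w z h g. h \<noteq> 0 \<Longrightarrow> g \<noteq> 0 \<Longrightarrow>
         (s - G (sqrt \<rho> * h * F s + w, sqrt \<rho> * g * s + z, sqrt \<rho> * h, sqrt \<rho> * g))\<^sup>2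
           \<le> (1 + s\<^sup>2 + w\<^sup>2 + z\<^sup>2) ^ q * (c1 * ((h\<^sup>2) powr (- a1) * (g\<^sup>2) powr (- b1)) + c2 * ((h\<^sup>2) powr (- a2) * (g\<^sup>2) powr (- b2))
              + c3 * ((h\<^sup>2) powr (- a3) * (g\<^sup>2) powr (- b3)) + c4 * ((h\<^sup>2) powr (- a4) * (g\<^sup>2) powr (- b4)))"
    show "EDstar \<mu>h \<mu>g \<rho> \<le> C * (c1 + c2 + c3 + c4)"
    proof -
      have c: "0 \<le> sel c1 c2 c3 c4 k" if "k < 4" for k using that *(4-7) by (auto simp: less4 sel)
      show ?thesis using C(2)[where \<rho> = \<rho> and c = "sel c1 c2 c3 c4", OF *(1-3) c] *(8) by (simp add: sum4 sel)
    qed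
  qed
qed

text \<open>The linear minimum mean square error estimate leaves an error of order
  \<open>1 / T\<close>, where \<open>T\<close> is 1 plus the two scaled gains. Since
  \<open>e \<le> 1\<close> and \<open>T \<ge> 1\<close>, this is at most
  \<open>T powr (- e)\<close>, which splits into a monomial in the gains.\<close>

lemma EDstar_upper_uncoded:
  assumes e: "0 \<le> e" "e \<le> 1" "e < Lc + Ls"
  obtains C where "\<And>\<rho>. \<rho> \<ge> 1 \<Longrightarrow> EDstar \<mu>h \<mu>g \<rho> \<le> C * \<rho> powr (- e)"
proof -
  \<comment> \<open>Splitting \<open>e\<close> in proportion to \<open>Lc\<close> and
    \<open>Ls\<close> keeps both orders below the finite moment thresholds as soon as
    \<open>e < Lc + Ls\<close>.\<close>
  define a where "a = e * Lc / (Lc + Ls)"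
  define b where "b = e * Ls / (Lc + Ls)"
  have L: "Lc + Ls > 0" using Lc Ls by simp
  have ab: "a \<ge> 0" "b \<ge> 0" using e Lc Ls by (auto simp: a_def b_def)
  have eab: "a + b = e" using L by (simp add: a_def b_def add_divide_distrib[symmetric] distrib_left[symmetric])
  have "a < Lc" unfolding a_def using L e Lc by (simp add: divide_less_eq mult.commute)
  moreover have "b < Ls" unfolding b_def using L e Ls by (simp add: divide_less_eq mult.commute)
  ultimately obtain C where C: "C \<ge> 0"
    "\<And>\<rho> c1 c2 c3 c4 F G. F \<in> borel_measurable borel \<Longrightarrow> G \<in> borel_measurable (borel \<Otimes>\<^sub>M (borel \<Otimes>\<^sub>M (borel \<Otimes>\<^sub>M borel))) \<Longrightarrow>
       (\<integral>\<^sup>+x. ennreal ((F x)\<^sup>2) \<partial>std_normal) \<le> 1 \<Longrightarrow> 0 \<le> c1 \<Longrightarrow> 0 \<le> c2 \<Longrightarrow> 0 \<le> c3 \<Longrightarrow> 0 \<le> c4 \<Longrightarrow>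
       (\<And>s w z h g. h \<noteq> 0 \<Longrightarrow> g \<noteq> 0 \<Longrightarrow>
         (s - G (sqrt \<rho> * h * F s + w, sqrt \<rho> * g * s + z, sqrt \<rho> * h, sqrt \<rho> * g))\<^sup>2
           \<le> (1 + s\<^sup>2 + w\<^sup>2 + z\<^sup>2) ^ 1 * (c1 * ((h\<^sup>2) powr (- a) * (g\<^sup>2) powr (- b)) + c2 * ((h\<^sup>2) powr (- a) * (g\<^sup>2) powr (- b))
              + c3 * ((h\<^sup>2) powr (- a) * (g\<^sup>2) powr (- b)) + c4 * ((h\<^sup>2) powr (- a) * (g\<^sup>2) powr (- b)))) \<Longrightarrow>
       EDstar \<mu>h \<mu>g \<rho> \<le> C * (c1 + c2 + c3 + c4)"
    using EDstar_upper_scalar4[of a a a a b b b b 1] by blast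
  show thesis
  proof
    fix \<rho> :: real assume \<rho>: "\<rho> \<ge> 1"
    define G where "G = (\<lambda>(y, t, h, g). (h * y + g * t) / (1 + h\<^sup>2 + g\<^sup>2) :: real)"
    have "EDstar \<mu>h \<mu>g \<rho> \<le> C * (\<rho> powr (- e) + 0 + 0 + 0)"
    proof (rule C(2)[of "\<lambda>x. x" G])
      show "G \<in> borel_measurable (borel \<Otimes>\<^sub>M (borel \<Otimes>\<^sub>M (borel \<Otimes>\<^sub>M borel)))"
        unfolding G_def split_beta' by measurable
      show "(\<integral>\<^sup>+x. ennreal (x\<^sup>2) \<partial>std_normal) \<le> 1"
        using nn_integral_std_normal_even_moment[of 1] by (simp add: fact_numeral)
      fix s w z h g :: real assume h: "h \<noteq> 0" and g: "g \<noteq> 0"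
      define hc where "hc = sqrt \<rho> * h"
      define gc where "gc = sqrt \<rho> * g"
      define T where "T = 1 + hc\<^sup>2 + gc\<^sup>2"
      have T: "T \<ge> 1" by (simp add: T_def)
      have "s - G (hc * s + w, gc * s + z, hc, gc) = (s - hc * w - gc * z) / T"
      proof -
        have "T * s - (hc * (hc * s + w) + gc * (gc * s + z)) = s - hc * w - gc * z"
          by (simp add: T_def power2_eq_square algebra_simps)
        moreover have "s - X / T = (T * s - X) / T" for X using T by (simp add: field_simps)
        ultimately show ?thesis by (simp add: G_def T_def[symmetric])
      qed
      then have "(s - G (hc * s + w, gc * s + z, hc, gc))\<^sup>2 = (s - hc * w - gc * z)\<^sup>2 / T\<^sup>2"
        by (simp add: power_divide)
      also have "(s - hc * w - gc * z)\<^sup>2 \<le> T * (s\<^sup>2 + w\<^sup>2 + z\<^sup>2)"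
      proof -
        \<comment> \<open>Lagrange's identity, proving the Cauchy-Schwarz inequality for
          \<open>(1, -hc, -gc)\<close> and \<open>(s, w, z)\<close>.\<close>
        have "T * (s\<^sup>2 + w\<^sup>2 + z\<^sup>2) - (s - hc * w - gc * z)\<^sup>2 = (hc * s + w)\<^sup>2 + (gc * s + z)\<^sup>2 + (hc * z - gc * w)\<^sup>2"
          by (simp add: T_def power2_eq_square algebra_simps)
        then show ?thesis by (metis add_nonneg_nonneg diff_ge_0_iff_ge zero_le_power2)
      qed
      then have "(s - hc * w - gc * z)\<^sup>2 / T\<^sup>2 \<le> (T * (s\<^sup>2 + w\<^sup>2 + z\<^sup>2)) / T\<^sup>2" by (intro divide_right_mono) auto
      also have "\<dots> = (s\<^sup>2 + w\<^sup>2 + z\<^sup>2) * (1 / T)" using T by (simp add: power2_eq_square)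
      also have "\<dots> \<le> (1 + s\<^sup>2 + w\<^sup>2 + z\<^sup>2) * (\<rho> powr (- e) * ((h\<^sup>2) powr (- a) * (g\<^sup>2) powr (- b)))"
      proof (intro mult_mono)
        have "(hc\<^sup>2) powr a * (gc\<^sup>2) powr b \<le> T powr a * T powr b"
          using ab by (intro mult_mono powr_mono2) (auto simp: T_def)
        also have "\<dots> = T powr e" by (simp add: powr_add[symmetric] eab)
        also have "\<dots> \<le> T powr 1" using T e by (intro powr_mono) auto
        finally have le: "(hc\<^sup>2) powr a * (gc\<^sup>2) powr b \<le> T" using T by simp
        have pos: "0 < (hc\<^sup>2) powr a * (gc\<^sup>2) powr b" using h g \<rho> by (simp add: hc_def gc_def)
        have "1 / T \<le> 1 / ((hc\<^sup>2) powr a * (gc\<^sup>2) powr b)" using le pos T by (intro divide_left_mono) auto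
        also have "\<dots> = (hc\<^sup>2) powr (- a) * (gc\<^sup>2) powr (- b)" by (simp add: powr_minus field_simps)
        also have "\<dots> = (\<rho> powr (- a) * (h\<^sup>2) powr (- a)) * (\<rho> powr (- b) * (g\<^sup>2) powr (- b))"
          using \<rho> by (simp add: hc_def gc_def power_mult_distrib powr_mult)
        also have "\<dots> = (\<rho> powr (- a) * \<rho> powr (- b)) * ((h\<^sup>2) powr (- a) * (g\<^sup>2) powr (- b))" by (simp add: mult_ac)
        also have "\<rho> powr (- a) * \<rho> powr (- b) = \<rho> powr (- e)" by (simp add: powr_add[symmetric] eab[symmetric])
        finally show "1 / T \<le> \<rho> powr (- e) * ((h\<^sup>2) powr (- a) * (g\<^sup>2) powr (- b))" .
      qed (use T in auto)
      finally show "(s - G (sqrt \<rho> * h * s + w, sqrt \<rho> * g * s + z, sqrt \<rho> * h, sqrt \<rho> * g))\<^sup>2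
           \<le> (1 + s\<^sup>2 + w\<^sup>2 + z\<^sup>2) ^ 1 * (\<rho> powr (- e) * ((h\<^sup>2) powr (- a) * (g\<^sup>2) powr (- b)) + 0 * ((h\<^sup>2) powr (- a) * (g\<^sup>2) powr (- b))
              + 0 * ((h\<^sup>2) powr (- a) * (g\<^sup>2) powr (- b)) + 0 * ((h\<^sup>2) powr (- a) * (g\<^sup>2) powr (- b)))"
        by (simp add: hc_def gc_def)
    qed auto
    then show "EDstar \<mu>h \<mu>g \<rho> \<le> C * \<rho> powr (- e)" by simp
  qed
qed

lemma powr_scaled_square:
  "\<rho> \<ge> 1 \<Longrightarrow> ((sqrt \<rho> * h)\<^sup>2) powr r = \<rho> powr r * (h\<^sup>2) powr r" for \<rho> h r :: real
  by (simp add: power_mult_distrib powr_mult)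

text \<open>Four sources of error: \<open>c1\<close> weak side information, \<open>c2\<close> weak
  channel, \<open>c3\<close> channel noise after correct rounding, \<open>c4\<close> wrong rounding
  although both gains are good. With a bad gain the decoder falls back to
  \<open>t / g\<close>.\<close>

lemma EDstar_upper_modulo:
  assumes "Lc \<ge> 1" "Ls > 1" "\<kappa> > 0"
  obtains C where "C \<ge> 0" "\<And>\<rho>. \<rho> \<ge> 1 \<Longrightarrow> EDstar \<mu>h \<mu>g \<rho> \<le> C * \<rho> powr (- (2 - 1 / Ls - \<kappa>))"
proof -
  \<comment> \<open>The exponent of \<open>\<xi>\<^sup>2\<close>. It balances weak side information,
    of exponent \<open>Ls - x * (Ls - 1)\<close>, against residual channel noise, of exponent
    \<open>1 + x\<close>.\<close>
  define x where "x = 1 - 1 / Ls"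
  have x: "0 < x" "x < 1" "x * Ls = Ls - 1" using assms by (auto simp: x_def field_simps)
  \<comment> \<open>The three bounds keep \<open>a\<close> positive, keep \<open>b\<close> above 1,
    and keep the total loss in the exponents below \<open>\<kappa>\<close>.\<close>
  define \<epsilon> where "\<epsilon> = min (min (1 / 2) ((Ls - 1) / 2)) (\<kappa> / (1 + Ls))"
  have \<epsilon>: "\<epsilon> > 0" "\<epsilon> \<le> 1 / 2" "\<epsilon> \<le> (Ls - 1) / 2" "\<epsilon> * (1 + Ls) \<le> \<kappa>"
  proof -
    have "\<epsilon> \<le> \<kappa> / (1 + Ls)" by (simp add: \<epsilon>_def)
    then show "\<epsilon> * (1 + Ls) \<le> \<kappa>" using assms by (simp add: field_simps)
    show "\<epsilon> \<le> 1 / 2" "\<epsilon> \<le> (Ls - 1) / 2"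
      unfolding \<epsilon>_def by (simp_all only: min_le_iff_disj order_refl simp_thms)
  qed (use assms in \<open>auto simp: \<epsilon>_def\<close>)
  have \<epsilon>\<kappa>: "2 * \<epsilon> \<le> \<kappa>"
  proof -
    have "\<epsilon> * 2 \<le> \<epsilon> * (1 + Ls)" using \<epsilon> assms by (intro mult_left_mono) auto
    then show ?thesis using \<epsilon>(4) by linarith
  qed
  \<comment> \<open>Makes \<open>\<tau> ^ p\<close> at least \<open>\<rho>\<^sup>2\<close>, beyond
    the target exponent, which is below 2.\<close>
  define p where "p = nat \<lceil>2 / \<epsilon>\<rceil>"
  have p: "2 \<le> \<epsilon> * real p"
  proof -
    have "2 / \<epsilon> \<le> real p" unfolding p_def by linarith
    then show ?thesis using \<epsilon> by (simp add: field_simps)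
  qed
  \<comment> \<open>An order close to 1 for the channel gain is admissible because
    \<open>Lc \<ge> 1\<close>.\<close>
  define a where "a = 1 - \<epsilon>"
  define b where "b = Ls - \<epsilon>"
  have a: "0 < a" "a < 1" "a < Lc" using \<epsilon> assms by (auto simp: a_def)
  have b: "1 < b" "b < Ls" using \<epsilon> assms by (auto simp: b_def field_simps)
  define E where "E = 2 - 1 / Ls - \<kappa>"
  have E: "E = 1 + x - \<kappa>" by (simp add: E_def x_def)
  obtain C where C: "C \<ge> 0"
    "\<And>\<rho> c1 c2 c3 c4 F G. F \<in> borel_measurable borel \<Longrightarrow> G \<in> borel_measurable (borel \<Otimes>\<^sub>M (borel \<Otimes>\<^sub>M (borel \<Otimes>\<^sub>M borel))) \<Longrightarrow>
       (\<integral>\<^sup>+x. ennreal ((F x)\<^sup>2) \<partial>std_normal) \<le> 1 \<Longrightarrow> 0 \<le> c1 \<Longrightarrow> 0 \<le> c2 \<Longrightarrow> 0 \<le> c3 \<Longrightarrow> 0 \<le> c4 \<Longrightarrow>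
       (\<And>s w z h g. h \<noteq> 0 \<Longrightarrow> g \<noteq> 0 \<Longrightarrow>
         (s - G (sqrt \<rho> * h * F s + w, sqrt \<rho> * g * s + z, sqrt \<rho> * h, sqrt \<rho> * g))\<^sup>2
           \<le> (1 + s\<^sup>2 + w\<^sup>2 + z\<^sup>2) ^ Suc p * (c1 * ((h\<^sup>2) powr (- 0) * (g\<^sup>2) powr (- b)) + c2 * ((h\<^sup>2) powr (- a) * (g\<^sup>2) powr (- 1))
              + c3 * ((h\<^sup>2) powr (- a) * (g\<^sup>2) powr (- 0)) + c4 * ((h\<^sup>2) powr (- 0) * (g\<^sup>2) powr (- 0)))) \<Longrightarrow>
       EDstar \<mu>h \<mu>g \<rho> \<le> C * (c1 + c2 + c3 + c4)"
    using EDstar_upper_scalar4[of 0 a a 0 b 1 0 0 "Suc p"] a b Lc Ls assms by blast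
  show thesis
  proof
    show "0 \<le> C * (3 + 18 * 8 ^ p)" using C by simp
    fix \<rho> :: real assume \<rho>: "\<rho> \<ge> 1"
    define \<xi> where "\<xi> = \<rho> powr (x / 2)"
    define \<tau> where "\<tau> = \<rho> powr \<epsilon>"
    have \<xi>1: "\<xi> \<ge> 1" unfolding \<xi>_def using \<rho> x by (intro ge_one_powr_ge_zero) auto
    have \<tau>1: "\<tau> \<ge> 1" unfolding \<tau>_def using \<rho> \<epsilon> by (intro ge_one_powr_ge_zero) auto
    have \<xi>2: "\<xi>\<^sup>2 = \<rho> powr x" unfolding \<xi>_def by (simp add: power2_eq_square powr_add[symmetric])
    define c1 where "c1 = \<rho> powr (- b) * (\<xi>\<^sup>2 * \<tau>) powr (b - 1)"
    define c2 where "c2 = \<rho> powr (- 1 - a) * \<tau> powr a"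
    define c3 where "c3 = \<rho> powr (- a) / \<xi>\<^sup>2"
    define c4 where "c4 = 18 * 8 ^ p / \<tau> ^ p"
    have c0: "0 \<le> c1" "0 \<le> c2" "0 \<le> c3" "0 \<le> c4" using \<xi>1 \<tau>1 by (auto simp: c1_def c2_def c3_def c4_def)
    define F where "F s = frac (\<xi> * s)" for s
    define G where "G = (\<lambda>(y, t, h, g). if \<tau> \<le> h\<^sup>2 \<and> \<xi>\<^sup>2 * \<tau> \<le> g\<^sup>2 then (of_int (round (\<xi> * t / g - y / h)) + y / h) / \<xi> else t / g :: real)"
    have "EDstar \<mu>h \<mu>g \<rho> \<le> C * (c1 + c2 + c3 + c4)"
    proof (rule C(2)[of F G, OF _ _ _ c0])
      show "F \<in> borel_measurable borel" unfolding F_def frac_def by measurable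
      show "G \<in> borel_measurable (borel \<Otimes>\<^sub>M (borel \<Otimes>\<^sub>M (borel \<Otimes>\<^sub>M borel)))"
        unfolding G_def split_beta' round_def by measurable
      have "(F y)\<^sup>2 \<le> 1" for y unfolding F_def by (simp add: power_le_one frac_ge_0 less_imp_le[OF frac_lt_1])
      then have "(\<integral>\<^sup>+y. ennreal ((F y)\<^sup>2) \<partial>std_normal) \<le> (\<integral>\<^sup>+y. 1 \<partial>std_normal)"
        by (intro nn_integral_mono) (metis ennreal_1 ennreal_leI)
      then show "(\<integral>\<^sup>+y. ennreal ((F y)\<^sup>2) \<partial>std_normal) \<le> 1" using std_normal.emeasure_space_1 by simp
      fix s w z h g :: real assume h: "h \<noteq> 0" and g: "g \<noteq> 0"
      define hc where "hc = sqrt \<rho> * h"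
      define gc where "gc = sqrt \<rho> * g"
      define S where "S = 1 + s\<^sup>2 + w\<^sup>2 + z\<^sup>2"
      have S: "1 \<le> S" "z\<^sup>2 \<le> S" "w\<^sup>2 \<le> S" "z\<^sup>2 + w\<^sup>2 \<le> S" by (auto simp: S_def)
      have SS: "S \<le> S ^ Suc p" using S(1) by (intro self_le_power) auto
      have zS: "z\<^sup>2 \<le> S ^ Suc p" and wS: "w\<^sup>2 \<le> S ^ Suc p" using S SS by linarith+
      have hc0: "hc\<^sup>2 > 0" and gc0: "gc\<^sup>2 > 0" using h g \<rho> by (auto simp: hc_def gc_def)
      define T1 where "T1 = c1 * (g\<^sup>2) powr (- b)"
      define T2 where "T2 = c2 * ((h\<^sup>2) powr (- a) * (g\<^sup>2) powr (- 1))"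
      define T3 where "T3 = c3 * (h\<^sup>2) powr (- a)"
      have T0: "0 \<le> T1" "0 \<le> T2" "0 \<le> T3" using c0 by (auto simp: T1_def T2_def T3_def)
      define e where "e = s - G (hc * F s + w, gc * s + z, hc, gc)"
      have "e\<^sup>2 \<le> S ^ Suc p * T1 \<or> e\<^sup>2 \<le> S ^ Suc p * T2 \<or> e\<^sup>2 \<le> S ^ Suc p * T3 \<or> e\<^sup>2 \<le> S ^ Suc p * c4"
      proof (cases "\<tau> \<le> hc\<^sup>2 \<and> \<xi>\<^sup>2 * \<tau> \<le> gc\<^sup>2")
        case True
        have "e = s - (of_int (round (\<xi> * (gc * s + z) / gc - (hc * frac (\<xi> * s) + w) / hc)) + (hc * frac (\<xi> * s) + w) / hc) / \<xi>"
          using True by (simp add: e_def G_def F_def)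
        then have "e\<^sup>2 \<le> w\<^sup>2 / (hc\<^sup>2 * \<xi>\<^sup>2) \<or> (e\<^sup>2 \<le> 18 * (z\<^sup>2 + w\<^sup>2) \<and> \<tau> \<le> 8 * (z\<^sup>2 + w\<^sup>2))"
          using modulo_decoding_error[OF \<xi>1 \<tau>1, of hc gc s z w] True by simp
        then show ?thesis
        proof
          assume "e\<^sup>2 \<le> w\<^sup>2 / (hc\<^sup>2 * \<xi>\<^sup>2)"
          also have "\<dots> = w\<^sup>2 * (1 / hc\<^sup>2 / \<xi>\<^sup>2)" by simp
          also have "\<dots> \<le> S ^ Suc p * ((hc\<^sup>2) powr (- a) / \<xi>\<^sup>2)"
          proof (intro mult_mono divide_right_mono)
            have "1 / hc\<^sup>2 = (hc\<^sup>2) powr (- 1)" using hc0 by (simp add: powr_minus_divide)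
            also have "\<dots> \<le> (hc\<^sup>2) powr (- a)" using True \<tau>1 a by (intro powr_mono) auto
            finally show "1 / hc\<^sup>2 \<le> (hc\<^sup>2) powr (- a)" .
          qed (use S wS in auto)
          also have "(hc\<^sup>2) powr (- a) / \<xi>\<^sup>2 = T3"
            unfolding hc_def powr_scaled_square[OF \<rho>] by (simp add: T3_def c3_def)
          finally show ?thesis by blast
        next
          assume as: "e\<^sup>2 \<le> 18 * (z\<^sup>2 + w\<^sup>2) \<and> \<tau> \<le> 8 * (z\<^sup>2 + w\<^sup>2)"
          \<comment> \<open>The noise energy exceeds a multiple of \<open>\<tau>\<close>, so any
            power of this ratio may be inserted.\<close>
          have "1 \<le> 8 * (z\<^sup>2 + w\<^sup>2) / \<tau>" using as \<tau>1 by (simp add: field_simps)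
          then have "1 \<le> (8 * (z\<^sup>2 + w\<^sup>2) / \<tau>) ^ p" by (rule one_le_power)
          then have "18 * (z\<^sup>2 + w\<^sup>2) * 1 \<le> 18 * (z\<^sup>2 + w\<^sup>2) * (8 * (z\<^sup>2 + w\<^sup>2) / \<tau>) ^ p"
            by (intro mult_left_mono) auto
          also have "\<dots> = (z\<^sup>2 + w\<^sup>2) ^ Suc p * c4"
          proof -
            have "18 * v * (8 * v / \<tau>) ^ p = v ^ Suc p * c4" for v
              by (simp add: c4_def power_divide power_mult_distrib)
            then show ?thesis .
          qed
          also have "\<dots> \<le> S ^ Suc p * c4" using S c0 by (intro mult_right_mono power_mono) auto
          finally show ?thesis using as by auto
        qed
      next
        case False
        have "gc \<noteq> 0" using gc0 by auto
        then have "e = - (z / gc)" using False by (auto simp: e_def G_def field_simps)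
        then have ez: "e\<^sup>2 = z\<^sup>2 * (gc\<^sup>2) powr (- 1)" using gc0 by (simp add: power_divide powr_minus_divide)
        consider "gc\<^sup>2 < \<xi>\<^sup>2 * \<tau>" | "hc\<^sup>2 < \<tau>" using False by linarith
        then show ?thesis
        proof cases
          case 1
          have "(gc\<^sup>2) powr (- 1) = (gc\<^sup>2) powr (- b) * (gc\<^sup>2) powr (b - 1)" by (simp add: powr_add[symmetric])
          also have "\<dots> \<le> (gc\<^sup>2) powr (- b) * (\<xi>\<^sup>2 * \<tau>) powr (b - 1)"
            using 1 b gc0 by (intro mult_left_mono powr_mono2) auto
          also have "\<dots> = T1" unfolding gc_def powr_scaled_square[OF \<rho>] by (simp add: T1_def c1_def mult_ac)
          finally have "z\<^sup>2 * (gc\<^sup>2) powr (- 1) \<le> S ^ Suc p * T1" using S zS by (intro mult_mono) auto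
          then show ?thesis using ez by simp
        next
          case 2
          have "(hc\<^sup>2) powr a \<le> \<tau> powr a" using 2 a by (intro powr_mono2) auto
          then have "1 \<le> \<tau> powr a * (hc\<^sup>2) powr (- a)" using hc0 h \<rho> by (simp add: powr_minus_divide hc_def field_simps)
          then have "(gc\<^sup>2) powr (- 1) * 1 \<le> (gc\<^sup>2) powr (- 1) * (\<tau> powr a * (hc\<^sup>2) powr (- a))" by (intro mult_left_mono) auto
          also have "\<dots> = T2"
            unfolding gc_def hc_def powr_scaled_square[OF \<rho>] using \<rho>
            by (simp add: T2_def c2_def powr_diff powr_minus mult_ac divide_inverse)
          finally have "z\<^sup>2 * (gc\<^sup>2) powr (- 1) \<le> S ^ Suc p * T2" using S zS by (intro mult_mono) auto
          then show ?thesis using ez by simp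
        qed
      qed
      moreover have "S ^ Suc p * T \<le> S ^ Suc p * (T1 + T2 + T3 + c4)" if "T = T1 \<or> T = T2 \<or> T = T3 \<or> T = c4" for T
        using that T0 c0 S by (intro mult_left_mono) auto
      ultimately have "e\<^sup>2 \<le> S ^ Suc p * (T1 + T2 + T3 + c4)" by (metis order_trans)
      then show "(s - G (sqrt \<rho> * h * F s + w, sqrt \<rho> * g * s + z, sqrt \<rho> * h, sqrt \<rho> * g))\<^sup>2
           \<le> (1 + s\<^sup>2 + w\<^sup>2 + z\<^sup>2) ^ Suc p * (c1 * ((h\<^sup>2) powr (- 0) * (g\<^sup>2) powr (- b)) + c2 * ((h\<^sup>2) powr (- a) * (g\<^sup>2) powr (- 1))
              + c3 * ((h\<^sup>2) powr (- a) * (g\<^sup>2) powr (- 0)) + c4 * ((h\<^sup>2) powr (- 0) * (g\<^sup>2) powr (- 0)))"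
        using h g by (simp add: e_def hc_def gc_def S_def T1_def T2_def T3_def)
    qed
    also have "\<dots> \<le> C * (\<rho> powr (- E) + \<rho> powr (- E) + \<rho> powr (- E) + 18 * 8 ^ p * \<rho> powr (- E))"
    proof (intro mult_left_mono add_mono C)
      have "\<xi>\<^sup>2 * \<tau> = \<rho> powr (x + \<epsilon>)" by (simp add: \<xi>2 \<tau>_def powr_add)
      then have "c1 = \<rho> powr (- b + (x + \<epsilon>) * (b - 1))" by (simp add: c1_def powr_powr powr_add[symmetric])
      also have "\<dots> \<le> \<rho> powr (- E)"
      proof (rule powr_mono)
        have "- b + (x + \<epsilon>) * (b - 1) = - (1 + x) + (\<epsilon> - x * \<epsilon>) + \<epsilon> * (Ls - 1 - \<epsilon>)"
          using x(3) by (simp add: b_def algebra_simps)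
        also have "\<dots> \<le> - (1 + x) + \<epsilon> + \<epsilon> * Ls"
          using \<epsilon> x by (intro add_mono mult_left_mono) auto
        finally show "- b + (x + \<epsilon>) * (b - 1) \<le> - E" using \<epsilon>(4) by (simp add: E algebra_simps)
      qed fact
      finally show "c1 \<le> \<rho> powr (- E)" .
      have "c2 = \<rho> powr (- 1 - a + \<epsilon> * a)" by (simp add: c2_def \<tau>_def powr_powr powr_add[symmetric])
      also have "\<dots> \<le> \<rho> powr (- E)"
      proof (rule powr_mono)
        have "\<epsilon> * a \<le> \<epsilon> * 1" using a \<epsilon> by (intro mult_left_mono) auto
        then show "- 1 - a + \<epsilon> * a \<le> - E" using \<epsilon>\<kappa> x by (simp add: E a_def)
      qed fact
      finally show "c2 \<le> \<rho> powr (- E)" .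
      have "c3 = \<rho> powr (- a - x)" by (simp add: c3_def \<xi>2 powr_diff)
      also have "\<dots> \<le> \<rho> powr (- E)" using \<rho> \<epsilon>\<kappa> \<epsilon> by (intro powr_mono) (auto simp: E a_def)
      finally show "c3 \<le> \<rho> powr (- E)" .
      have "\<tau> ^ p = \<rho> powr (\<epsilon> * real p)" using \<rho> by (simp add: \<tau>_def powr_powr[symmetric] powr_realpow)
      then have "1 / \<tau> ^ p = \<rho> powr (- (\<epsilon> * real p))" by (simp only: powr_minus_divide)
      also have "\<dots> \<le> \<rho> powr (- E)" using \<rho> p x assms by (intro powr_mono) (auto simp: E)
      finally have "18 * 8 ^ p * (1 / \<tau> ^ p) \<le> 18 * 8 ^ p * \<rho> powr (- E)" by (intro mult_left_mono) auto
      then show "c4 \<le> 18 * 8 ^ p * \<rho> powr (- E)" by (simp add: c4_def)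
    qed
    finally show "EDstar \<mu>h \<mu>g \<rho> \<le> C * (3 + 18 * 8 ^ p) * \<rho> powr (- (2 - 1 / Ls - \<kappa>))"
      by (simp add: E_def algebra_simps)
  qed
qed

end

text \<open>A measurable choice of an integer needs a well-ordered enumeration, which
  \<open>int_decode\<close> supplies.\<close>

lemma measurable_least_index:
  fixes P :: "int \<Rightarrow> 'a \<Rightarrow> bool"
  assumes [measurable]: "\<And>i. Measurable.pred M (P i)"
  shows "(\<lambda>x. real_of_int (int_decode (LEAST k. P (int_decode k) x))) \<in> borel_measurable M"
proof -
  have [measurable]: "(\<lambda>x. LEAST k. P (int_decode k) x) \<in> M \<rightarrow>\<^sub>M count_space UNIV"
    by (rule measurable_Least) measurable
  show ?thesis by measurable
qed

context nakagami_pair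
begin

text \<open>\<open>c1\<close> is the quantization error and \<open>c2\<close> a noise beyond
  \<open>k\<close>. The test is unreliable either because the channel is weak (\<open>c3\<close>) or
  because the product of both gains is small (\<open>c4\<close>); side information and channel can
  compensate each other, so neither needs to be good alone.\<close>

lemma EDstar_upper_joint_decoding:
  assumes "Ls > 1" "Ls \<le> 1 + Lc" "\<kappa> > 0"
  obtains C where "C \<ge> 0" "\<And>\<rho>. \<rho> \<ge> 1 \<Longrightarrow> EDstar \<mu>h \<mu>g \<rho> \<le> C * \<rho> powr (- (2 - 1 / Ls - \<kappa>))"
proof -
  define x where "x = 1 - 1 / Ls"
  have x: "0 < x" "x < 1" "x * Ls = Ls - 1" using assms by (auto simp: x_def field_simps)
  \<comment> \<open>Keeps \<open>a\<close> positive and the loss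
    \<open>\<epsilon> + 2 * \<epsilon> * Ls\<close> in the exponents below
    \<open>\<kappa>\<close>.\<close>
  define \<epsilon> where "\<epsilon> = min ((Ls - 1) / 2) (\<kappa> / (1 + 2 * Ls))"
  have \<epsilon>: "\<epsilon> > 0" "\<epsilon> \<le> (Ls - 1) / 2" "\<epsilon> * (1 + 2 * Ls) \<le> \<kappa>"
  proof -
    have "\<epsilon> \<le> \<kappa> / (1 + 2 * Ls)" by (simp add: \<epsilon>_def)
    then show "\<epsilon> * (1 + 2 * Ls) \<le> \<kappa>" using assms by (simp add: field_simps)
    show "\<epsilon> \<le> (Ls - 1) / 2"
      unfolding \<epsilon>_def by (simp only: min_le_iff_disj order_refl simp_thms)
  qed (use assms in \<open>auto simp: \<epsilon>_def\<close>)
  \<comment> \<open>The extra power pays for the factor \<open>\<tau>\<close> lost in estimating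
    \<open>k\<^sup>2 + z\<^sup>2\<close> by \<open>\<tau> * (1 + z\<^sup>2)\<close>.\<close>
  define p where "p = Suc (nat \<lceil>1 / \<epsilon>\<rceil>)"
  have p: "1 \<le> \<epsilon> * real p - \<epsilon>"
  proof -
    have "1 / \<epsilon> \<le> real p - 1" unfolding p_def by (simp add: of_nat_ceiling)
    then show ?thesis using \<epsilon> by (simp add: field_simps)
  qed
  \<comment> \<open>The fallback error already uses one power of the side information gain, which
    leaves orders below \<open>Ls - 1\<close>. That this is below \<open>Lc\<close> is where
    \<open>Ls \<le> 1 + Lc\<close> enters.\<close>
  define a where "a = Ls - 1 - \<epsilon>"
  have a: "0 < a" "a < Lc" "1 + a < Ls" "a \<le> Ls" using \<epsilon> assms by (auto simp: a_def field_simps)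
  \<comment> \<open>The target exponent \<open>2 - 1 / Ls\<close>; the quantizer step
    \<open>\<Delta>\<close> is the square root of the target distortion.\<close>
  define \<delta> where "\<delta> = 1 + x"
  define E where "E = 2 - 1 / Ls - \<kappa>"
  have E: "E = \<delta> - \<kappa>" by (simp add: E_def x_def \<delta>_def)
  obtain C where C: "C \<ge> 0"
    "\<And>\<rho> c1 c2 c3 c4 F G. F \<in> borel_measurable borel \<Longrightarrow> G \<in> borel_measurable (borel \<Otimes>\<^sub>M (borel \<Otimes>\<^sub>M (borel \<Otimes>\<^sub>M borel))) \<Longrightarrow>
       (\<integral>\<^sup>+x. ennreal ((F x)\<^sup>2) \<partial>std_normal) \<le> 1 \<Longrightarrow> 0 \<le> c1 \<Longrightarrow> 0 \<le> c2 \<Longrightarrow> 0 \<le> c3 \<Longrightarrow> 0 \<le> c4 \<Longrightarrow>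
       (\<And>s w z h g. h \<noteq> 0 \<Longrightarrow> g \<noteq> 0 \<Longrightarrow>
         (s - G (sqrt \<rho> * h * F s + w, sqrt \<rho> * g * s + z, sqrt \<rho> * h, sqrt \<rho> * g))\<^sup>2
           \<le> (1 + s\<^sup>2 + w\<^sup>2 + z\<^sup>2) ^ Suc p * (c1 * ((h\<^sup>2) powr (- 0) * (g\<^sup>2) powr (- 0)) + c2 * ((h\<^sup>2) powr (- 0) * (g\<^sup>2) powr (- 1))
              + c3 * ((h\<^sup>2) powr (- a) * (g\<^sup>2) powr (- 1)) + c4 * ((h\<^sup>2) powr (- a) * (g\<^sup>2) powr (- (1 + a))))) \<Longrightarrow>
       EDstar \<mu>h \<mu>g \<rho> \<le> C * (c1 + c2 + c3 + c4)"
    using EDstar_upper_scalar4[of 0 0 a a 0 1 1 "1 + a" "Suc p"] a Lc Ls assms(1) by blast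
  show thesis
  proof
    show "0 \<le> C * (6 + 2 * 1024 powr a)" using C by simp
    fix \<rho> :: real assume \<rho>: "\<rho> \<ge> 1"
    define \<Delta> where "\<Delta> = \<rho> powr (- \<delta> / 2)"
    define k where "k = \<rho> powr (\<epsilon> / 2)"
    define \<tau> where "\<tau> = \<rho> powr \<epsilon>"
    have \<Delta>0: "\<Delta> > 0" using \<rho> by (simp add: \<Delta>_def)
    have k0: "k > 0" using \<rho> by (simp add: k_def)
    have k2: "k\<^sup>2 = \<tau>" unfolding k_def \<tau>_def by (simp add: power2_eq_square powr_add[symmetric])
    have \<Delta>2: "\<Delta>\<^sup>2 = \<rho> powr (- \<delta>)" unfolding \<Delta>_def by (simp add: power2_eq_square powr_add[symmetric])
    have \<tau>1: "\<tau> \<ge> 1" unfolding \<tau>_def using \<rho> \<epsilon> by (intro ge_one_powr_ge_zero) auto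
    define c1 where "c1 = 3 * \<Delta>\<^sup>2"
    define c2 where "c2 = 3 * (\<tau> / \<tau> ^ p) * \<rho> powr (- 1)"
    define c3 where "c3 = (1024 * \<tau>) powr a * \<rho> powr (- 1 - a)"
    define c4 where "c4 = (1024 * \<tau>\<^sup>2 / \<Delta>\<^sup>2) powr a * \<rho> powr (- 1 - 2 * a)"
    have c0: "0 \<le> c1" "0 \<le> c2" "0 \<le> c3" "0 \<le> c4" using \<tau>1 by (auto simp: c1_def c2_def c3_def c4_def)
    define X where "X = (\<lambda>i::int. frac (sqrt 2 * real_of_int i))"
    define F where "F s = X (round (s / \<Delta>))" for s
    define ok where "ok = (\<lambda>(i::int) (y, t, h, g). \<bar>\<Delta> * real_of_int i - t / g\<bar> \<le> \<Delta> + k / \<bar>g\<bar> \<and> \<bar>X i - y / h\<bar> \<le> k / \<bar>h\<bar>)"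
    define good where "good h g \<longleftrightarrow> 16 * k * (1 + k / (\<Delta> * \<bar>g\<bar>)) < \<bar>h\<bar>" for h g :: real
    define G where "G = (\<lambda>v. if good (fst (snd (snd v))) (snd (snd (snd v))) \<and> (\<exists>j. ok (int_decode j) v)
        then \<Delta> * real_of_int (int_decode (LEAST j. ok (int_decode j) v)) else fst (snd v) / snd (snd (snd v)))"
    have G_cases: "(\<exists>i. ok i v \<and> G v = \<Delta> * real_of_int i) \<or> ((\<nexists>i. ok i v) \<and> G v = fst (snd v) / snd (snd (snd v)))"
      if "good (fst (snd (snd v))) (snd (snd (snd v)))" for v
    proof (cases "\<exists>j. ok (int_decode j) v")
      case True
      then have "ok (int_decode (LEAST j. ok (int_decode j) v)) v" by (rule LeastI_ex)
      then show ?thesis using True that by (auto simp: G_def)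
    next
      case False
      then have "\<nexists>i. ok i v" by (metis int_encode_inverse)
      then show ?thesis using False by (auto simp: G_def)
    qed
    have "EDstar \<mu>h \<mu>g \<rho> \<le> C * (c1 + c2 + c3 + c4)"
    proof (rule C(2)[of F G, OF _ _ _ c0])
      show "F \<in> borel_measurable borel" unfolding F_def X_def frac_def round_def by measurable
      have [measurable]: "Measurable.pred (borel \<Otimes>\<^sub>M (borel \<Otimes>\<^sub>M (borel \<Otimes>\<^sub>M borel))) (ok i)" for i
        unfolding ok_def split_beta' by measurable
      have "(\<lambda>v. real_of_int (int_decode (LEAST j. ok (int_decode j) v))) \<in> borel_measurable (borel \<Otimes>\<^sub>M (borel \<Otimes>\<^sub>M (borel \<Otimes>\<^sub>M borel)))"
        by (rule measurable_least_index) measurable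
      then show "G \<in> borel_measurable (borel \<Otimes>\<^sub>M (borel \<Otimes>\<^sub>M (borel \<Otimes>\<^sub>M borel)))"
        unfolding G_def good_def by measurable
      have "(F y)\<^sup>2 \<le> 1" for y unfolding F_def X_def by (simp add: power_le_one frac_ge_0 less_imp_le[OF frac_lt_1])
      then have "(\<integral>\<^sup>+y. ennreal ((F y)\<^sup>2) \<partial>std_normal) \<le> (\<integral>\<^sup>+y. 1 \<partial>std_normal)"
        by (intro nn_integral_mono) (metis ennreal_1 ennreal_leI)
      then show "(\<integral>\<^sup>+y. ennreal ((F y)\<^sup>2) \<partial>std_normal) \<le> 1" using std_normal.emeasure_space_1 by simp
      fix s w z h g :: real assume h: "h \<noteq> 0" and g: "g \<noteq> 0"
      define hc where "hc = sqrt \<rho> * h"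
      define gc where "gc = sqrt \<rho> * g"
      define S where "S = 1 + s\<^sup>2 + w\<^sup>2 + z\<^sup>2"
      have S: "1 \<le> S" "z\<^sup>2 \<le> S" "1 + z\<^sup>2 \<le> S" "z\<^sup>2 + w\<^sup>2 \<le> S" by (auto simp: S_def)
      have SS: "S \<le> S ^ Suc p" using S(1) by (intro self_le_power) auto
      have zS: "z\<^sup>2 \<le> S ^ Suc p" and S1: "1 \<le> S ^ Suc p" using S SS by linarith+
      have hc0: "hc\<^sup>2 > 0" and gc0: "gc\<^sup>2 > 0" using h g \<rho> by (auto simp: hc_def gc_def)
      then have hn: "hc \<noteq> 0" and gn: "gc \<noteq> 0" by auto
      define T2 where "T2 = c2 * (g\<^sup>2) powr (- 1)"
      define T3 where "T3 = c3 * ((h\<^sup>2) powr (- a) * (g\<^sup>2) powr (- 1))"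
      define T4 where "T4 = c4 * ((h\<^sup>2) powr (- a) * (g\<^sup>2) powr (- (1 + a)))"
      have T0: "0 \<le> T2" "0 \<le> T3" "0 \<le> T4" using c0 by (auto simp: T2_def T3_def T4_def)
      define v where "v = (hc * F s + w, gc * s + z, hc, gc)"
      define e where "e = s - G v"
      have "e\<^sup>2 \<le> S ^ Suc p * (c1 + T2) \<or> e\<^sup>2 \<le> S ^ Suc p * T3 \<or> e\<^sup>2 \<le> S ^ Suc p * T4"
      proof (cases "good hc gc")
        case True
        have "(\<exists>i. ok i v \<and> G v = \<Delta> * real_of_int i) \<or> ((\<nexists>i. ok i v) \<and> G v = (gc * s + z) / gc)"
          using G_cases[of v] True by (simp add: v_def)
        then have "e\<^sup>2 \<le> \<Delta>\<^sup>2 \<or> (e\<^sup>2 \<le> 3 * (\<Delta>\<^sup>2 + (k\<^sup>2 + z\<^sup>2) / gc\<^sup>2) \<and> k\<^sup>2 \<le> z\<^sup>2 + w\<^sup>2)"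
          unfolding e_def using True
          by (intro joint_decoding_error[OF \<Delta>0 k0 hn gn]) (auto simp: good_def ok_def v_def F_def X_def)
        then show ?thesis
        proof
          assume "e\<^sup>2 \<le> \<Delta>\<^sup>2"
          also have "\<dots> \<le> 1 * (c1 + T2)" using T0 by (simp add: c1_def)
          also have "\<dots> \<le> S ^ Suc p * (c1 + T2)" using S1 T0 c0 by (intro mult_right_mono) auto
          finally show ?thesis by blast
        next
          assume as: "e\<^sup>2 \<le> 3 * (\<Delta>\<^sup>2 + (k\<^sup>2 + z\<^sup>2) / gc\<^sup>2) \<and> k\<^sup>2 \<le> z\<^sup>2 + w\<^sup>2"
          have "1 \<le> (z\<^sup>2 + w\<^sup>2) / \<tau>" using as \<tau>1 by (simp add: k2)
          then have one: "1 \<le> ((z\<^sup>2 + w\<^sup>2) / \<tau>) ^ p" by (rule one_le_power)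
          have "(k\<^sup>2 + z\<^sup>2) * 1 \<le> (\<tau> * (1 + z\<^sup>2)) * ((z\<^sup>2 + w\<^sup>2) / \<tau>) ^ p"
          proof (intro mult_mono one)
            have "1 * z\<^sup>2 \<le> \<tau> * z\<^sup>2" using \<tau>1 by (intro mult_right_mono) auto
            then show "k\<^sup>2 + z\<^sup>2 \<le> \<tau> * (1 + z\<^sup>2)" by (simp add: k2 distrib_left)
          qed (use \<tau>1 in auto)
          also have "\<dots> = \<tau> / \<tau> ^ p * ((1 + z\<^sup>2) * (z\<^sup>2 + w\<^sup>2) ^ p)" by (simp add: power_divide)
          also have "\<dots> \<le> \<tau> / \<tau> ^ p * (S * S ^ p)"
            using S \<tau>1 by (intro mult_left_mono mult_mono power_mono) auto
          finally have "(k\<^sup>2 + z\<^sup>2) \<le> \<tau> / \<tau> ^ p * S ^ Suc p" by simp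
          then have "(k\<^sup>2 + z\<^sup>2) * (gc\<^sup>2) powr (- 1) \<le> (\<tau> / \<tau> ^ p * S ^ Suc p) * (gc\<^sup>2) powr (- 1)"
            by (intro mult_right_mono) auto
          moreover have "S ^ Suc p * T2 = 3 * ((\<tau> / \<tau> ^ p * S ^ Suc p) * (gc\<^sup>2) powr (- 1))"
            unfolding gc_def powr_scaled_square[OF \<rho>] by (simp only: T2_def c2_def mult_ac)
          ultimately have "3 * ((k\<^sup>2 + z\<^sup>2) * (gc\<^sup>2) powr (- 1)) \<le> S ^ Suc p * T2" by linarith
          moreover have "(k\<^sup>2 + z\<^sup>2) / gc\<^sup>2 = (k\<^sup>2 + z\<^sup>2) * (gc\<^sup>2) powr (- 1)" using gc0 by (simp add: powr_minus_divide)
          moreover have "3 * \<Delta>\<^sup>2 \<le> S ^ Suc p * c1" using mult_right_mono[OF S1 c0(1)] by (simp add: c1_def)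
          ultimately have "e\<^sup>2 \<le> S ^ Suc p * (c1 + T2)" using as unfolding distrib_left by linarith
          then show ?thesis by blast
        qed
      next
        case False
        have "G v = (gc * s + z) / gc" using False by (simp add: G_def v_def)
        then have "e = - (z / gc)" using gn by (simp add: e_def field_simps)
        then have ez: "e\<^sup>2 = z\<^sup>2 * (gc\<^sup>2) powr (- 1)" using gc0 by (simp add: power_divide powr_minus_divide)
        \<comment> \<open>Which summand of \<open>1 + k / (\<Delta> * \<bar>gc\<bar>)\<close>
          dominates decides between a weak channel and a small product of gains. The constant 1024
          is the square of 32.\<close>
        have bad: "\<bar>hc\<bar> \<le> 16 * k * (1 + k / (\<Delta> * \<bar>gc\<bar>))" using False by (simp add: good_def)
        show ?thesis
        proof (cases "k / (\<Delta> * \<bar>gc\<bar>) \<le> 1")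
          case True
          have "16 * k * (1 + k / (\<Delta> * \<bar>gc\<bar>)) \<le> 16 * k * 2" using True k0 by (intro mult_left_mono) auto
          then have "\<bar>hc\<bar> \<le> 32 * k" using bad by simp
          then have "\<bar>hc\<bar>\<^sup>2 \<le> (32 * k)\<^sup>2" by (intro power_mono) auto
          then have "hc\<^sup>2 \<le> 1024 * \<tau>" by (simp add: power_mult_distrib k2)
          then have "(hc\<^sup>2) powr a \<le> (1024 * \<tau>) powr a" using a by (intro powr_mono2) auto
          then have "1 \<le> (1024 * \<tau>) powr a * (hc\<^sup>2) powr (- a)" using hc0 hn by (simp add: powr_minus_divide field_simps)
          then have "(gc\<^sup>2) powr (- 1) * 1 \<le> (gc\<^sup>2) powr (- 1) * ((1024 * \<tau>) powr a * (hc\<^sup>2) powr (- a))" by (intro mult_left_mono) auto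
          also have "\<dots> = (1024 * \<tau>) powr a * (\<rho> powr (- 1) * \<rho> powr (- a)) * ((h\<^sup>2) powr (- a) * (g\<^sup>2) powr (- 1))"
            unfolding gc_def hc_def powr_scaled_square[OF \<rho>] by (simp only: mult_ac)
          also have "\<rho> powr (- 1) * \<rho> powr (- a) = \<rho> powr (- 1 - a)"
            unfolding powr_add[symmetric] by (rule arg_cong[where f = "\<lambda>r. _ powr r"]) simp
          finally have "(gc\<^sup>2) powr (- 1) \<le> T3" by (simp add: T3_def c3_def)
          then have "z\<^sup>2 * (gc\<^sup>2) powr (- 1) \<le> S ^ Suc p * T3" using S zS by (intro mult_mono) auto
          then show ?thesis using ez by simp
        next
          case False
          have "16 * k * (1 + k / (\<Delta> * \<bar>gc\<bar>)) \<le> 16 * k * (2 * (k / (\<Delta> * \<bar>gc\<bar>)))" using False k0 by (intro mult_left_mono) auto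
          then have "\<bar>hc\<bar> \<le> 32 * k\<^sup>2 / (\<Delta> * \<bar>gc\<bar>)" using bad by (simp add: power2_eq_square)
          then have "\<bar>hc\<bar> * \<bar>gc\<bar> * \<Delta> \<le> 32 * \<tau>" using \<Delta>0 gn by (simp add: k2 field_simps)
          then have "(\<bar>hc\<bar> * \<bar>gc\<bar> * \<Delta>)\<^sup>2 \<le> (32 * \<tau>)\<^sup>2" using \<Delta>0 by (intro power_mono) auto
          then have "hc\<^sup>2 * gc\<^sup>2 * \<Delta>\<^sup>2 \<le> 1024 * \<tau>\<^sup>2" by (simp add: power_mult_distrib)
          then have "hc\<^sup>2 * gc\<^sup>2 \<le> 1024 * \<tau>\<^sup>2 / \<Delta>\<^sup>2" using \<Delta>0 by (simp add: field_simps)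
          then have "(hc\<^sup>2 * gc\<^sup>2) powr a \<le> (1024 * \<tau>\<^sup>2 / \<Delta>\<^sup>2) powr a" using a by (intro powr_mono2) auto
          then have "1 \<le> (1024 * \<tau>\<^sup>2 / \<Delta>\<^sup>2) powr a * (hc\<^sup>2 * gc\<^sup>2) powr (- a)"
            using hc0 gc0 hn gn by (simp add: powr_minus_divide field_simps)
          also have "(hc\<^sup>2 * gc\<^sup>2) powr (- a) = (hc\<^sup>2) powr (- a) * (gc\<^sup>2) powr (- a)" using hc0 gc0 by (simp add: powr_mult)
          finally have "(gc\<^sup>2) powr (- 1) * 1 \<le> (gc\<^sup>2) powr (- 1) * ((1024 * \<tau>\<^sup>2 / \<Delta>\<^sup>2) powr a * ((hc\<^sup>2) powr (- a) * (gc\<^sup>2) powr (- a)))"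
            by (intro mult_left_mono) auto
          also have "\<dots> = (1024 * \<tau>\<^sup>2 / \<Delta>\<^sup>2) powr a * (\<rho> powr (- 1) * \<rho> powr (- a) * \<rho> powr (- a)) * ((h\<^sup>2) powr (- a) * ((g\<^sup>2) powr (- 1) * (g\<^sup>2) powr (- a)))"
            unfolding gc_def hc_def powr_scaled_square[OF \<rho>] by (simp only: mult_ac)
          also have "\<rho> powr (- 1) * \<rho> powr (- a) * \<rho> powr (- a) = \<rho> powr (- 1 - 2 * a)"
            unfolding powr_add[symmetric] by (rule arg_cong[where f = "\<lambda>r. _ powr r"]) simp
          also have "(g\<^sup>2) powr (- 1) * (g\<^sup>2) powr (- a) = (g\<^sup>2) powr (- (1 + a))"
            unfolding powr_add[symmetric] by (rule arg_cong[where f = "\<lambda>r. _ powr r"]) simp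
          finally have "(gc\<^sup>2) powr (- 1) \<le> T4" by (simp add: T4_def c4_def)
          then have "z\<^sup>2 * (gc\<^sup>2) powr (- 1) \<le> S ^ Suc p * T4" using S zS by (intro mult_mono) auto
          then show ?thesis using ez by simp
        qed
      qed
      moreover have "S ^ Suc p * T \<le> S ^ Suc p * (c1 + T2 + T3 + T4)" if "T = c1 + T2 \<or> T = T3 \<or> T = T4" for T
        using that T0 c0 S by (intro mult_left_mono) auto
      ultimately have "e\<^sup>2 \<le> S ^ Suc p * (c1 + T2 + T3 + T4)" by (metis order_trans)
      then show "(s - G (sqrt \<rho> * h * F s + w, sqrt \<rho> * g * s + z, sqrt \<rho> * h, sqrt \<rho> * g))\<^sup>2
           \<le> (1 + s\<^sup>2 + w\<^sup>2 + z\<^sup>2) ^ Suc p * (c1 * ((h\<^sup>2) powr (- 0) * (g\<^sup>2) powr (- 0)) + c2 * ((h\<^sup>2) powr (- 0) * (g\<^sup>2) powr (- 1))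
              + c3 * ((h\<^sup>2) powr (- a) * (g\<^sup>2) powr (- 1)) + c4 * ((h\<^sup>2) powr (- a) * (g\<^sup>2) powr (- (1 + a))))"
        using h g by (simp add: e_def v_def hc_def gc_def S_def T2_def T3_def T4_def)
    qed
    also have "\<dots> \<le> C * (3 * \<rho> powr (- E) + 3 * \<rho> powr (- E) + 1024 powr a * \<rho> powr (- E) + 1024 powr a * \<rho> powr (- E))"
    proof (intro mult_left_mono add_mono C)
      have "\<rho> powr (- \<delta>) \<le> \<rho> powr (- E)" using \<rho> assms(3) by (intro powr_mono) (auto simp: E)
      then show "c1 \<le> 3 * \<rho> powr (- E)" by (simp add: c1_def \<Delta>2)
      have "\<tau> ^ p = \<rho> powr (\<epsilon> * real p)" using \<rho> by (simp add: \<tau>_def powr_powr[symmetric] powr_realpow)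
      then have "\<tau> / \<tau> ^ p * \<rho> powr (- 1) = \<rho> powr (\<epsilon> - \<epsilon> * real p + (- 1))"
        by (simp only: \<tau>_def powr_diff powr_add)
      also have "\<dots> \<le> \<rho> powr (- E)" using \<rho> p x assms(3) by (intro powr_mono) (auto simp: E \<delta>_def)
      finally show "c2 \<le> 3 * \<rho> powr (- E)" unfolding c2_def mult.assoc by (rule mult_left_mono) simp
      have ea: "\<epsilon> * a \<le> \<epsilon> * Ls" using a \<epsilon> by (intro mult_left_mono) auto
      have \<kappa>: "\<epsilon> + 2 * (\<epsilon> * Ls) \<le> \<kappa>" using \<epsilon>(3) by (simp add: algebra_simps)
      have "c3 = 1024 powr a * \<rho> powr (\<epsilon> * a + (- 1 - a))"
        using \<tau>1 \<rho> unfolding c3_def by (simp add: powr_mult \<tau>_def powr_powr powr_add)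
      also have "\<dots> \<le> 1024 powr a * \<rho> powr (- E)"
      proof (intro mult_left_mono powr_mono)
        \<comment> \<open>\<open>Ls + 1 / Ls \<ge> 2\<close>, so a weak channel, with exponent close
          to \<open>Ls\<close>, does not determine the rate.\<close>
        have "\<delta> \<le> Ls"
        proof -
          have "0 \<le> (Ls - 1)\<^sup>2" by simp
          then have "2 * Ls - 1 \<le> Ls * Ls" by (simp add: power2_eq_square algebra_simps)
          then have "(2 - 1 / Ls) * Ls \<le> Ls * Ls" using assms(1) by (simp add: left_diff_distrib)
          then show ?thesis using assms(1) by (simp add: \<delta>_def x_def)
        qed
        moreover have "0 \<le> \<epsilon> * Ls" using \<epsilon> Ls by simp
        ultimately show "\<epsilon> * a + (- 1 - a) \<le> - E" using ea \<kappa> by (simp add: E a_def)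
      qed (use \<rho> in auto)
      finally show "c3 \<le> 1024 powr a * \<rho> powr (- E)" .
      have "\<tau>\<^sup>2 / \<Delta>\<^sup>2 = \<rho> powr (2 * \<epsilon> + \<delta>)"
      proof -
        have "\<tau>\<^sup>2 = \<rho> powr (2 * \<epsilon>)" by (simp add: \<tau>_def power2_eq_square powr_add[symmetric])
        then show ?thesis unfolding \<Delta>2 powr_diff[symmetric] by (simp only: powr_diff[symmetric] diff_minus_eq_add)
      qed
      then have "c4 = 1024 powr a * \<rho> powr ((2 * \<epsilon> + \<delta>) * a + (- 1 - 2 * a))"
      proof -
        assume eq: "\<tau>\<^sup>2 / \<Delta>\<^sup>2 = \<rho> powr (2 * \<epsilon> + \<delta>)"
        have "(1024 * \<rho> powr r) powr a = 1024 powr a * \<rho> powr (r * a)" for r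
          by (simp add: powr_mult powr_powr)
        then show ?thesis
          unfolding c4_def times_divide_eq_right[symmetric] eq
          by (simp only: powr_add[of \<rho> "(2 * \<epsilon> + \<delta>) * a"] mult.assoc)
      qed
      also have "\<dots> \<le> 1024 powr a * \<rho> powr (- E)"
      proof (intro mult_left_mono powr_mono)
        \<comment> \<open>Apart from terms in \<open>\<epsilon>\<close>,
          \<open>x * Ls = Ls - 1\<close> reduces this exactly to \<open>- 1 - x\<close>, so the
          small-product event attains the target exponent.\<close>
        have "(2 * \<epsilon> + \<delta>) * a + (- 1 - 2 * a) = 2 * (\<epsilon> * a) - 1 - a + x * a" by (simp add: \<delta>_def algebra_simps)
        also have "x * a = Ls - 1 - x - x * \<epsilon>" using x(3) by (simp add: a_def algebra_simps)
        also have "2 * (\<epsilon> * a) - 1 - a + (Ls - 1 - x - x * \<epsilon>) = 2 * (\<epsilon> * a) - 1 - x + \<epsilon> - x * \<epsilon>" by (simp add: a_def)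
        also have "\<dots> \<le> 2 * (\<epsilon> * Ls) - 1 - x + \<epsilon>" using ea mult_pos_pos[OF x(1) \<epsilon>(1)] by linarith
        also have "\<dots> \<le> - E" using \<kappa> by (simp add: E \<delta>_def)
        finally show "(2 * \<epsilon> + \<delta>) * a + (- 1 - 2 * a) \<le> - E" .
      qed (use \<rho> in auto)
      finally show "c4 \<le> 1024 powr a * \<rho> powr (- E)" .
    qed
    finally show "EDstar \<mu>h \<mu>g \<rho> \<le> C * (6 + 2 * 1024 powr a) * \<rho> powr (- (2 - 1 / Ls - \<kappa>))"
      by (simp add: E_def algebra_simps)
  qed
qed

end

section \<open>From power bounds to the distortion exponent\<close>

lemma exponent_tendsto:
  fixes f :: "real \<Rightarrow> real"
  assumes up: "\<And>\<kappa>. \<kappa> > 0 \<Longrightarrow> \<exists>C. \<forall>\<rho>\<ge>1. f \<rho> \<le> C * \<rho> powr (- (d - \<kappa>))"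
    and low: "\<And>\<kappa>. \<kappa> > 0 \<Longrightarrow> \<exists>c>0. eventually (\<lambda>\<rho>. c * \<rho> powr (- (d + \<kappa>)) \<le> f \<rho>) at_top"
  shows "((\<lambda>\<rho>. - ln (f \<rho>) / ln \<rho>) \<longlongrightarrow> d) at_top"
proof (rule tendstoI)
  fix e :: real assume e: "e > 0"
  \<comment> \<open>One \<open>\<kappa>\<close> is lost in the given bounds and one in absorbing the
    constants \<open>C\<close> and \<open>c\<close>; the third makes the final inequality
    strict.\<close>
  define \<kappa> where "\<kappa> = e / 3"
  have \<kappa>: "\<kappa> > 0" using e by (simp add: \<kappa>_def)
  obtain C where C: "\<forall>\<rho>\<ge>1. f \<rho> \<le> C * \<rho> powr (- (d - \<kappa>))" using up[OF \<kappa>] by blast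
  obtain c where c: "c > 0" "eventually (\<lambda>\<rho>. c * \<rho> powr (- (d + \<kappa>)) \<le> f \<rho>) at_top" using low[OF \<kappa>] by blast
  show "eventually (\<lambda>\<rho>. dist (- ln (f \<rho>) / ln \<rho>) d < e) at_top"
    using c(2) eventually_gt_at_top[of 1] eventually_powr_gt[OF \<kappa>, of C] eventually_powr_gt[OF \<kappa>, of "1 / c"]
  proof eventually_elim
    case (elim \<rho>)
    have l\<rho>: "ln \<rho> > 0" using elim by simp
    have "\<rho> powr (- (d + 2 * \<kappa>)) = \<rho> powr (- \<kappa>) * \<rho> powr (- (d + \<kappa>))"
      unfolding powr_add[symmetric] by (rule arg_cong[where f = "\<lambda>r. _ powr r"]) simp
    also have "\<dots> \<le> c * \<rho> powr (- (d + \<kappa>))"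
    proof (intro mult_right_mono)
      have "1 < c * \<rho> powr \<kappa>" using elim c(1) by (simp add: field_simps)
      then show "\<rho> powr (- \<kappa>) \<le> c" using elim by (simp add: powr_minus_divide field_simps)
    qed simp
    finally have l: "\<rho> powr (- (d + 2 * \<kappa>)) \<le> f \<rho>" using elim by linarith
    have "f \<rho> \<le> C * \<rho> powr (- (d - \<kappa>))" using C elim by simp
    also have "\<dots> \<le> \<rho> powr \<kappa> * \<rho> powr (- (d - \<kappa>))" using elim by (intro mult_right_mono) auto
    also have "\<dots> = \<rho> powr (- (d - 2 * \<kappa>))"
            unfolding powr_add[symmetric] by (rule arg_cong[where f = "\<lambda>r. _ powr r"]) simp
    finally have u: "f \<rho> \<le> \<rho> powr (- (d - 2 * \<kappa>))" .
    have pos: "0 < \<rho> powr (- (d + 2 * \<kappa>))" using elim by simp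
    then have f0: "0 < f \<rho>" using l by linarith
    have "ln (\<rho> powr (- (d + 2 * \<kappa>))) \<le> ln (f \<rho>)" using l pos by (intro ln_mono) auto
    then have l': "- (d + 2 * \<kappa>) * ln \<rho> \<le> ln (f \<rho>)" using elim by (simp add: ln_powr)
    have "ln (f \<rho>) \<le> ln (\<rho> powr (- (d - 2 * \<kappa>)))" using u f0 by (intro ln_mono) auto
    then have u': "ln (f \<rho>) \<le> - (d - 2 * \<kappa>) * ln \<rho>" using elim by (simp add: ln_powr)
    have "- ln (f \<rho>) / ln \<rho> \<le> d + 2 * \<kappa>" using l' l\<rho> by (simp add: field_simps)
    moreover have "d - 2 * \<kappa> \<le> - ln (f \<rho>) / ln \<rho>" using u' l\<rho> by (simp add: field_simps)
    ultimately have "\<bar>- ln (f \<rho>) / ln \<rho> - d\<bar> \<le> 2 * \<kappa>" by (simp add: abs_le_iff)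
    then show ?case using e by (simp add: dist_real_def \<kappa>_def)
  qed
qed

theorem theorem4:
  fixes Lc Ls :: real and \<mu>h \<mu>g :: "real measure"
  assumes "Lc > 0" and "Ls > 0"
    and "nakagami_amplitude_law Lc \<mu>h"
    and "nakagami_amplitude_law Ls \<mu>g"
  shows "(Lc \<ge> 1 \<longrightarrow>
            ((\<lambda>\<rho>. - ln (EDstar \<mu>h \<mu>g \<rho>) / ln \<rho>) \<longlongrightarrow> 1 + max 0 (1 - 1 / Ls)) at_top)
       \<and> (Lc < 1 \<and> Ls \<le> 1 + Lc \<longrightarrow>
            ((\<lambda>\<rho>. - ln (EDstar \<mu>h \<mu>g \<rho>) / ln \<rho>)
               \<longlongrightarrow> min 1 (Ls + Lc) + max 0 (1 - 1 / Ls)) at_top)"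
proof -
  interpret nakagami_pair Lc Ls \<mu>h \<mu>g by unfold_locales (fact assms)+
  have low: "\<exists>c>0. eventually (\<lambda>\<rho>. c * \<rho> powr (- (d + \<kappa>)) \<le> EDstar \<mu>h \<mu>g \<rho>) at_top"
    if "\<kappa> > 0" "d = 2 - min 1 (1 / Ls)" for \<kappa> d
    using EDstar_lower_sideinfo[OF that(1) refl] that(2) by (intro exI[of _ 1]) auto
  have uncoded: "\<exists>C. \<forall>\<rho>\<ge>1. EDstar \<mu>h \<mu>g \<rho> \<le> C * \<rho> powr (- (d - \<kappa>))"
    if "\<kappa> > 0" "d = min 1 (Ls + Lc)" for \<kappa> d
  proof -
    \<comment> \<open>The uncoded bound is stated for nonnegative orders. If
      \<open>d < \<kappa>\<close>, then \<open>e = 0\<close> still suffices because the target power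
      is then at least 1.\<close>
    define e where "e = max 0 (d - \<kappa>)"
    have "0 \<le> e" "e \<le> 1" "e < Lc + Ls" using that assms(1,2) by (auto simp: e_def)
    then obtain C where C: "\<And>\<rho>. \<rho> \<ge> 1 \<Longrightarrow> EDstar \<mu>h \<mu>g \<rho> \<le> C * \<rho> powr (- e)"
      using EDstar_upper_uncoded by blast
    have "EDstar \<mu>h \<mu>g \<rho> \<le> max C 0 * \<rho> powr (- (d - \<kappa>))" if "\<rho> \<ge> 1" for \<rho>
    proof -
      have "EDstar \<mu>h \<mu>g \<rho> \<le> C * \<rho> powr (- e)" using C that .
      also have "\<dots> \<le> max C 0 * \<rho> powr (- (d - \<kappa>))"
        using that by (intro mult_mono powr_mono) (auto simp: e_def)
      finally show ?thesis .
    qed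
    then show ?thesis by blast
  qed
  have two: "2 - min 1 (1 / Ls) = 1 + max 0 (1 - 1 / Ls)" by (auto simp: min_def max_def)
  show ?thesis
  proof (intro conjI impI)
    assume L: "Lc \<ge> 1"
    show "((\<lambda>\<rho>. - ln (EDstar \<mu>h \<mu>g \<rho>) / ln \<rho>) \<longlongrightarrow> 1 + max 0 (1 - 1 / Ls)) at_top"
    proof (rule exponent_tendsto)
      fix \<kappa> :: real assume \<kappa>: "\<kappa> > 0"
      show "\<exists>C. \<forall>\<rho>\<ge>1. EDstar \<mu>h \<mu>g \<rho> \<le> C * \<rho> powr (- (1 + max 0 (1 - 1 / Ls) - \<kappa>))"
      proof (cases "Ls > 1")
        case True
        then have "1 + max 0 (1 - 1 / Ls) = 2 - 1 / Ls" by simp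
        then show ?thesis using EDstar_upper_modulo[OF L True \<kappa>] by metis
      next
        case False
        then have "1 + max 0 (1 - 1 / Ls) = min 1 (Ls + Lc)" using L assms(2) by (simp add: max_def field_simps)
        then show ?thesis using uncoded[OF \<kappa>] by simp
      qed
    qed (rule low, simp_all add: two)
  next
    assume L: "Lc < 1 \<and> Ls \<le> 1 + Lc"
    show "((\<lambda>\<rho>. - ln (EDstar \<mu>h \<mu>g \<rho>) / ln \<rho>) \<longlongrightarrow> min 1 (Ls + Lc) + max 0 (1 - 1 / Ls)) at_top"
    proof (cases "Ls > 1")
      case True
      then have d: "min 1 (Ls + Lc) + max 0 (1 - 1 / Ls) = 2 - 1 / Ls" "2 - min 1 (1 / Ls) = 2 - 1 / Ls"
        using assms(1) by (auto simp: min_def max_def)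
      show ?thesis unfolding d(1)
      proof (rule exponent_tendsto)
        fix \<kappa> :: real assume \<kappa>: "\<kappa> > 0"
        show "\<exists>C. \<forall>\<rho>\<ge>1. EDstar \<mu>h \<mu>g \<rho> \<le> C * \<rho> powr (- (2 - 1 / Ls - \<kappa>))"
          using EDstar_upper_joint_decoding[OF True conjunct2[OF L] \<kappa>] by metis
      qed (rule low, simp_all add: d(2))
    next
      case False
      then have d: "min 1 (Ls + Lc) + max 0 (1 - 1 / Ls) = min 1 (Ls + Lc)" "2 - min 1 (1 / Ls) = 1"
        using assms(2) by (auto simp: min_def max_def field_simps)
      show ?thesis unfolding d(1)
      proof (rule exponent_tendsto)
        fix \<kappa> :: real assume \<kappa>: "\<kappa> > 0"
        show "\<exists>C. \<forall>\<rho>\<ge>1. EDstar \<mu>h \<mu>g \<rho> \<le> C * \<rho> powr (- (min 1 (Ls + Lc) - \<kappa>))"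
          by (rule uncoded[OF \<kappa> refl])
        show "\<exists>c>0. eventually (\<lambda>\<rho>. c * \<rho> powr (- (min 1 (Ls + Lc) + \<kappa>)) \<le> EDstar \<mu>h \<mu>g \<rho>) at_top"
        \<comment> \<open>For \<open>Ls \<le> 1\<close> the side information bound has exponent 1;
          when \<open>Ls + Lc < 1\<close>, the simultaneous outage of channel and side information
          is more restrictive.\<close>
        proof (cases "Ls + Lc \<ge> 1")
          case True
          then show ?thesis using low[OF \<kappa>, of 1] d(2) by (simp add: min_def)
        next
          case False
          obtain c where c: "c > 0" "\<And>\<rho>. \<rho> \<ge> 1 \<Longrightarrow> c * \<rho> powr (- (Ls + Lc)) \<le> EDstar \<mu>h \<mu>g \<rho>"
            using EDstar_lower_channel_outage by blast
          have "c * \<rho> powr (- (min 1 (Ls + Lc) + \<kappa>)) \<le> EDstar \<mu>h \<mu>g \<rho>" if "\<rho> \<ge> 1" for \<rho>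
          proof -
            have "c * \<rho> powr (- (min 1 (Ls + Lc) + \<kappa>)) \<le> c * \<rho> powr (- (Ls + Lc))"
              using that c False \<kappa> by (intro mult_left_mono powr_mono) auto
            then show ?thesis using c(2)[OF that] by linarith
          qed
          then show ?thesis using c(1)
            by (intro exI[of _ c] conjI eventually_mono[OF eventually_ge_at_top[of 1]]) auto
        qed
      qed
    qed
  qed
qed

end
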